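(* Let $r,d\in\mathbb{N}$ and let $B\in\mathbb{R}^{d\times d}$ be a Frolov matrix. There is a constant $c>0$ (which may depend on $r$, $d$ and $B$) such that for any shift parameter $v\in\mathbb{R}^d$, any natural number $n\geq 2$ and any $f\in \mathring{H}^{r,\mathrm{mix}}([0,1]^d)$ \[ \sup_{u\in [1,2^{1/d}]^d} \left|Q_{n^{1/d}\hat{u}B}^v(f)-I_d(f)\right| \leq c\, n^{-r}\, (\log n)^{\frac{d-1}{2}}\, \Vert f\Vert_{H^{r,\mathrm{mix}}([0,1]^d)}. \]
   Context: Notation: $\mathbb{N}=\{1,2,\dots\}$ and $I_d(f)=\int_{\mathbb{R}^d} f(x)\,dx$. For an invertible matrix $S\in\mathbb{R}^{d\times d}$ and $v\in\mathbb{R}^d$, the quadrature rule $Q_S^v$ is \[Q_S^v(f)=\frac{1}{|\det S|}\sum_{m\in\mathbb{Z}^d} f\left(S^{-\top}(m+v)\right),\] where $S^{-\top}$ is the transpose of the inverse of $S$. For $u\in\mathbb{R}^d$, $\hat{u}=\mathrm{diag}(u_1,\dots,u_d)$. A matrix $B\in\mathbb{R}^{d\times d}$ is a Frolov matrix if: (a) $B$ is invertible; (b) $\left|\prod_{j=1}^d (Bm)_j\right|\geq 1$ for every $m\in\mathbb{Z}^d\setminus\{0\}$; (c) for all $x,y\in\mathbb{R}^d$ the box $[x,y]=\{z\in\mathbb{R}^d : z_j \text{ lies between } x_j \text{ and } y_j \text{ (inclusive) for } j=1,\dots,d\}$ with volume $V=\prod_{j=1}^d|x_j-y_j|$ contains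 at most $V+1$ lattice points $Bm$, $m\in\mathbb{Z}^d$. $H^{r,\mathrm{mix}}(\mathbb{R}^d)$ is the space of real-valued $f\in L^2(\mathbb{R}^d)$ whose weak derivatives $D^\alpha f$ exist and lie in $L^2(\mathbb{R}^d)$ for all $\alpha\in\{0,\dots,r\}^d$; its elements are identified with their continuous representatives. $\mathring{H}^{r,\mathrm{mix}}([0,1]^d)$ is the subspace of those $f$ with support in $[0,1]^d$. The norm is $\Vert f\Vert_{H^{r,\mathrm{mix}}([0,1]^d)}=\left(\sum_{\alpha\in\{0,\dots,r\}^d}\Vert D^\alpha f\Vert_{L^2([0,1]^d)}^2\right)^{1/2}$. *)

theory Defs
  imports "HOL-Analysis.Analysis"
begin

subsection \<open>Lattice rules and Frolov matrices\<close>

definition real_vec :: "int ^ 'n \<Rightarrow> real ^ 'n" where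
  "real_vec m = (\<chi> i. real_of_int (m $ i))"

definition diag :: "real ^ 'n \<Rightarrow> real ^ 'n ^ 'n" where
  "diag u = (\<chi> i j. if i = j then u $ i else 0)"

text \<open>For an \<open>f\<close> of compact support and an invertible \<open>S\<close> only finitely many summands are nonzero,
  so the unordered sum is then a finite one.\<close>

definition quadrature :: "real ^ 'n ^ 'n \<Rightarrow> real ^ 'n \<Rightarrow> (real ^ 'n \<Rightarrow> real) \<Rightarrow> real" where
  "quadrature S v f =
     1 / \<bar>det S\<bar> * (\<Sum>\<^sub>\<infinity>m\<in>UNIV. f (transpose (matrix_inv S) *v (real_vec m + v)))"

definition coord_box :: "real ^ 'n \<Rightarrow> real ^ 'n \<Rightarrow> (real ^ 'n) set" where
  "coord_box x y = {z. \<forall>j. min (x $ j) (y $ j) \<le> z $ j \<and> z $ j \<le> max (x $ j) (y $ j)}"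

text \<open>Finiteness is required explicitly because \<^term>\<open>card\<close> of an infinite set is 0.\<close>

definition frolov_matrix :: "real ^ 'n ^ 'n \<Rightarrow> bool" where
  "frolov_matrix B \<longleftrightarrow>
     invertible B \<and>
     (\<forall>m. m \<noteq> 0 \<longrightarrow> 1 \<le> \<bar>\<Prod>j\<in>UNIV. (B *v real_vec m) $ j\<bar>) \<and>
     (\<forall>x y. finite (range (\<lambda>m. B *v real_vec m) \<inter> coord_box x y) \<and>
            real (card (range (\<lambda>m. B *v real_vec m) \<inter> coord_box x y))
              \<le> (\<Prod>j\<in>UNIV. \<bar>x $ j - y $ j\<bar>) + 1)"


subsection \<open>Weak derivatives\<close>

definition partial_deriv :: "'n \<Rightarrow> (real ^ 'n \<Rightarrow> real) \<Rightarrow> real ^ 'n \<Rightarrow> real" where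
  "partial_deriv i \<phi> x = deriv (\<lambda>t. \<phi> (x + t *\<^sub>R axis i 1)) 0"

primrec partial_derivs :: "'n list \<Rightarrow> (real ^ 'n \<Rightarrow> real) \<Rightarrow> real ^ 'n \<Rightarrow> real" where
  "partial_derivs [] \<phi> = \<phi>"
| "partial_derivs (i # is) \<phi> = partial_deriv i (partial_derivs is \<phi>)"

text \<open>Smoothness: all iterated partial derivatives exist and are (Frechet) differentiable,
  hence continuous.\<close>

definition test_function :: "(real ^ 'n \<Rightarrow> real) \<Rightarrow> bool" where
  "test_function \<phi> \<longleftrightarrow>
     (\<forall>is x. partial_derivs is \<phi> differentiable (at x)) \<and> compact (closure {x. \<phi> x \<noteq> 0})"

definition locally_integrable :: "(real ^ 'n \<Rightarrow> real) \<Rightarrow> bool" where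
  "locally_integrable f \<longleftrightarrow>
     f \<in> borel_measurable lborel \<and> (\<forall>K. compact K \<longrightarrow> set_integrable lborel K f)"

text \<open>A multi-index is a function \<open>\<alpha> :: 'n \<Rightarrow> nat\<close>. The lists \<open>is\<close> below are the orders in which
  the partial derivatives in \<open>D\<^sup>\<alpha> \<phi>\<close> can be taken; by symmetry of the derivatives of smooth
  functions they all give the same \<open>D\<^sup>\<alpha> \<phi>\<close>.\<close>

definition has_weak_deriv ::
  "('n \<Rightarrow> nat) \<Rightarrow> (real ^ 'n \<Rightarrow> real) \<Rightarrow> (real ^ 'n \<Rightarrow> real) \<Rightarrow> bool" where
  "has_weak_deriv \<alpha> f g \<longleftrightarrow>
     locally_integrable f \<and> locally_integrable g \<and>
     (\<forall>\<phi> is. test_function \<phi> \<longrightarrow> (\<forall>i. count_list is i = \<alpha> i) \<longrightarrow>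
        (LINT x|lborel. f x * partial_derivs is \<phi> x) =
        (-1) ^ (\<Sum>i\<in>UNIV. \<alpha> i) * (LINT x|lborel. g x * \<phi> x))"

text \<open>A representative: weak derivatives are unique up to null sets.\<close>

definition weak_deriv :: "('n \<Rightarrow> nat) \<Rightarrow> (real ^ 'n \<Rightarrow> real) \<Rightarrow> real ^ 'n \<Rightarrow> real" where
  "weak_deriv \<alpha> f = (SOME g. has_weak_deriv \<alpha> f g)"


subsection \<open>Sobolev spaces of dominating mixed smoothness\<close>

definition square_integrable :: "(real ^ 'n \<Rightarrow> real) \<Rightarrow> bool" where
  "square_integrable f \<longleftrightarrow> f \<in> borel_measurable lborel \<and> integrable lborel (\<lambda>x. (f x)\<^sup>2)"

definition L2_norm_on :: "(real ^ 'n) set \<Rightarrow> (real ^ 'n \<Rightarrow> real) \<Rightarrow> real" where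
  "L2_norm_on A f = sqrt (LINT x:A|lborel. (f x)\<^sup>2)"

text \<open>The elements are the continuous representatives.\<close>

definition H_mix :: "nat \<Rightarrow> (real ^ 'n \<Rightarrow> real) set" where
  "H_mix r =
     {f. continuous_on UNIV f \<and> square_integrable f \<and>
         (\<forall>\<alpha>. (\<forall>i. \<alpha> i \<le> r) \<longrightarrow>
            (\<exists>g. has_weak_deriv \<alpha> f g) \<and> square_integrable (weak_deriv \<alpha> f))}"

text \<open>In \<^typ>\<open>real ^ 'n\<close>, the constant \<open>1\<close> is the all-ones vector, so \<^term>\<open>cbox 0 1\<close> is the
  unit cube.\<close>

definition H_mix_0 :: "nat \<Rightarrow> (real ^ 'n \<Rightarrow> real) set" where
  "H_mix_0 r = {f \<in> H_mix r. closure {x. f x \<noteq> 0} \<subseteq> cbox 0 1}"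

definition H_mix_norm :: "nat \<Rightarrow> (real ^ 'n \<Rightarrow> real) \<Rightarrow> real" where
  "H_mix_norm r f =
     sqrt (\<Sum>\<alpha> | \<forall>i. \<alpha> i \<le> r. (L2_norm_on (cbox 0 1) (weak_deriv \<alpha> f))\<^sup>2)"

lemma finite_multi_indices: "finite {\<alpha> :: 'n::finite \<Rightarrow> nat. \<forall>i. \<alpha> i \<le> r}"
proof -
  have "{\<alpha> :: 'n \<Rightarrow> nat. \<forall>i. \<alpha> i \<le> r} = (\<Pi>\<^sub>E i\<in>UNIV. {..r})"
    by (auto simp: PiE_def)
  then show ?thesis
    by (simp add: finite_PiE)
qed

end

theory Submission
  imports Defs
begin

text \<open>
  Poisson summation bounds the error of the rule \<open>Q\<^sub>S\<close> by the sum of the Fourier coefficients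
  \<open>\<bar>F f (S k)\<bar>\<close> over \<open>k \<noteq> 0\<close>. By Cauchy-Schwarz, this sum is at most the square root of the product of
  \<open>\<Sum> w (S k) \<bar>F f (S k)\<bar>\<^sup>2\<close> and \<open>\<Sum> 1 / w (S k)\<close>, where \<open>w \<xi> = \<Prod>\<^sub>j \<Sum>\<^bsub>a \<le> r\<^esub> \<bar>2 \<pi> \<xi>\<^sub>j\<bar>\<^sup>2\<^sup>a\<close>.

  Since \<open>w\<close> is the sum of the squared multipliers of the derivatives in the norm and these derivatives
  live on the unit cube, a large sieve inequality bounds the first sum by a multiple of the squared
  Sobolev norm: by duality it suffices to bound the integral of \<open>\<bar>\<Sum> a\<^sub>k e (k \<bullet> S\<^sup>T x)\<bar>\<^sup>2\<close> over the cube,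
  and the image of the cube under \<open>S\<^sup>T\<close> meets only \<open>O (n)\<close> lattice translates of the period cell.

  For the second sum, distribute the points \<open>S k\<close> over dyadic boxes. The product of the coordinates of a
  nonzero Frolov point is at least 1, so only boxes of volume at least a multiple of \<open>n\<close> are occupied, and
  such a box contains \<open>O (volume / n)\<close> points. Summing over the boxes of the same volume, of which there
  are \<open>O ((log volume)\<^sup>d\<^sup>-\<^sup>1)\<close>, gives \<open>O (n\<^sup>-\<^sup>2\<^sup>r (log n)\<^sup>d\<^sup>-\<^sup>1)\<close>.
\<close>

subsection \<open>Integration over finite Cartesian products\<close>

text \<open>Two obstacles shape the proof. First, \<open>f\<close> is merely continuous with square
  integrable weak derivatives, so the Fourier series of its periodization is not known beforehand to
  converge. Poisson summation therefore enters as an inequality that asks for bounds over finite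
  sets of frequencies, and Fejer averages carry these bounds to the value at the origin. Second,
  weak derivatives are tested against real, compactly supported smooth functions, while characters
  are neither real nor of compact support. Characters are therefore expanded into products of
  phase-shifted cosines, which are cut off outside the cube; letting the cutoffs shrink to the cube
  also restricts the weak derivative to it.

  The constant is uniform in \<open>v\<close> because a shift changes Fourier coefficients only by
  unimodular factors. It is uniform in \<open>u\<close> because the coordinates of \<open>u\<close>
  lie between 1 and 2: the lower bound controls determinants and lattice counts, the upper bound
  controls the image of the cube.\<close>

lemma prod_Basis_vec: "(\<Prod>b\<in>Basis. g b) = (\<Prod>i\<in>UNIV. g (axis i (1::real) :: real ^ 'n))"
proof -
  have "(\<Prod>b\<in>Basis. g b) = (\<Prod>b\<in>range (\<lambda>i. axis i (1::real) :: real ^ 'n). g b)"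
    by (rule prod.cong) (auto simp: Basis_vec_def)
  also have "\<dots> = (\<Prod>i\<in>UNIV. g (axis i 1))"
    by (subst prod.reindex) (auto simp: inj_on_def axis_eq_axis)
  finally show ?thesis .
qed

lemma measurable_vec_lambda:
  "(\<lambda>f. \<chi> i. f i) \<in> borel_measurable (\<Pi>\<^sub>M i\<in>(UNIV::'n::finite set). (lborel :: real measure))"
proof (subst borel_measurable_euclidean_space, intro ballI)
  fix b :: "real ^ 'n" assume "b \<in> Basis"
  then obtain i where b: "b = axis i 1" by (auto simp: Basis_vec_def)
  have "(\<lambda>f. (\<chi> i. f i) \<bullet> b) = (\<lambda>f :: 'n \<Rightarrow> real. f i)"
    by (simp add: b inner_axis fun_eq_iff)
  then show "(\<lambda>f. (\<chi> i. f i) \<bullet> b) \<in> borel_measurable (\<Pi>\<^sub>M i\<in>(UNIV::'n set). (lborel :: real measure))"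
    by simp
qed

text \<open>\<open>lborel\<close> is determined by the volumes of open boxes, and these agree. The
  identity makes Fubini over single coordinates available on \<open>real ^ 'n\<close>.\<close>

lemma lborel_vec_eq:
  "(lborel :: (real ^ 'n) measure) = distr (\<Pi>\<^sub>M i\<in>(UNIV::'n set). lborel) borel (\<lambda>f. \<chi> i. f i)"
proof (rule lborel_eqI)
  interpret product_sigma_finite "\<lambda>_::'n. lborel :: real measure"
    by standard
  fix l u :: "real ^ 'n" assume le: "\<And>b. b \<in> Basis \<Longrightarrow> l \<bullet> b \<le> u \<bullet> b"
  have le': "l $ i \<le> u $ i" for i
    using le[of "axis i 1"] by (auto simp: inner_axis)
  have pre: "(\<lambda>f. \<chi> i. f i) -` box l u \<inter> space (\<Pi>\<^sub>M i\<in>(UNIV::'n set). (lborel :: real measure))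
     = (\<Pi>\<^sub>E i\<in>UNIV. {l $ i <..< u $ i})"
    by (auto simp: space_PiM mem_box_cart PiE_def Pi_def)
  have "emeasure (distr (\<Pi>\<^sub>M i\<in>(UNIV::'n set). lborel) borel (\<lambda>f. \<chi> i. f i)) (box l u)
     = emeasure (\<Pi>\<^sub>M i\<in>(UNIV::'n set). lborel) (\<Pi>\<^sub>E i\<in>UNIV. {l $ i <..< u $ i})"
    by (subst emeasure_distr) (use measurable_vec_lambda pre in auto)
  also have "\<dots> = (\<Prod>i\<in>UNIV. emeasure lborel {l $ i <..< u $ i})"
    by (rule emeasure_PiM) auto
  also have "\<dots> = ennreal (\<Prod>i\<in>UNIV. u $ i - l $ i)"
    by (simp add: le' prod_ennreal)
  also have "(\<Prod>i\<in>UNIV. u $ i - l $ i) = (\<Prod>b\<in>Basis. (u - l) \<bullet> b)"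
    by (simp add: prod_Basis_vec inner_axis)
  finally show "emeasure (distr (\<Pi>\<^sub>M i\<in>(UNIV::'n set). lborel) borel (\<lambda>f. \<chi> i. f i)) (box l u)
     = ennreal (\<Prod>b\<in>Basis. (u - l) \<bullet> b)" .
qed simp

lemma integrable_prod_vec:
  fixes \<psi> :: "'n::finite \<Rightarrow> real \<Rightarrow> complex"
  assumes "\<And>i. integrable lborel (\<psi> i)"
  shows "integrable lborel (\<lambda>x :: real ^ 'n. \<Prod>i\<in>UNIV. \<psi> i (x $ i))"
    and "(LINT x|(lborel :: (real ^ 'n) measure). (\<Prod>i\<in>UNIV. \<psi> i (x $ i))) = (\<Prod>i\<in>UNIV. LINT t|lborel. \<psi> i t)"
proof -
  interpret product_sigma_finite "\<lambda>_::'n. lborel :: real measure"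
    by standard
  have [measurable]: "\<psi> i \<in> borel_measurable borel" for i
    using borel_measurable_integrable[OF assms[of i]] by simp
  have m: "(\<lambda>x :: real ^ 'n. \<Prod>i\<in>UNIV. \<psi> i (x $ i)) \<in> borel_measurable borel"
    by measurable
  show "integrable lborel (\<lambda>x :: real ^ 'n. \<Prod>i\<in>UNIV. \<psi> i (x $ i))"
    unfolding lborel_vec_eq
    by (subst integrable_distr_eq[OF measurable_vec_lambda])
       (use m in simp, simp add: product_integrable_prod assms)
  show "(LINT x|(lborel :: (real ^ 'n) measure). (\<Prod>i\<in>UNIV. \<psi> i (x $ i))) = (\<Prod>i\<in>UNIV. LINT t|lborel. \<psi> i t)"
    unfolding lborel_vec_eq
    by (subst integral_distr[OF measurable_vec_lambda])
       (use m in simp, simp add: product_integral_prod assms)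
qed

section \<open>Linear changes of variables and translations in the Lebesgue integral\<close>

lemma nn_integral_shear:
  fixes f :: "real ^ 'n \<Rightarrow> ennreal"
  assumes [measurable]: "f \<in> borel_measurable borel" and "m \<noteq> n"
  shows "(\<integral>\<^sup>+ x. f (\<chi> i. if i = m then x $ m + x $ n else x $ i) \<partial>lborel) = (\<integral>\<^sup>+ x. f x \<partial>lborel)"
proof -
  interpret product_sigma_finite "\<lambda>_::'n. lborel :: real measure"
    by standard
  let ?R = "UNIV - {m}"
  have U: "UNIV = insert m ?R" by auto
  have [measurable]: "(\<lambda>f. \<chi> i. f i) \<in> borel_measurable (\<Pi>\<^sub>M i\<in>(UNIV::'n set). (lborel :: real measure))"
    by (rule measurable_vec_lambda)
  have shm: "(\<lambda>x :: real ^ 'n. \<chi> i. if i = m then x $ m + x $ n else x $ i) \<in> borel_measurable borel"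
  proof (intro borel_measurable_continuous_onI continuous_on_vec_lambda)
    show "continuous_on UNIV (\<lambda>x :: real ^ 'n. if i = m then x $ m + x $ n else x $ i)" for i
      by (cases "i = m") (auto intro!: continuous_intros)
  qed
  have rep: "(\<integral>\<^sup>+ x. g x \<partial>lborel) = (\<integral>\<^sup>+ x. (\<integral>\<^sup>+ t. g (\<chi> i. (x(m := t)) i) \<partial>lborel) \<partial>(\<Pi>\<^sub>M i\<in>?R. lborel))"
    if [measurable]: "g \<in> borel_measurable borel" for g :: "real ^ 'n \<Rightarrow> ennreal"
  proof -
    have "(\<integral>\<^sup>+ x. g x \<partial>lborel) = (\<integral>\<^sup>+ x. g (\<chi> i. x i) \<partial>(\<Pi>\<^sub>M i\<in>UNIV. lborel))"
      unfolding lborel_vec_eq by (subst nn_integral_distr) auto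
    also have "\<dots> = (\<integral>\<^sup>+ x. g (\<chi> i. x i) \<partial>(\<Pi>\<^sub>M i\<in>insert m ?R. lborel))"
      using U by simp
    also have "\<dots> = (\<integral>\<^sup>+ x. (\<integral>\<^sup>+ t. g (\<chi> i. (x(m := t)) i) \<partial>lborel) \<partial>(\<Pi>\<^sub>M i\<in>?R. lborel))"
    proof (rule product_nn_integral_insert)
      have "(\<lambda>x. g (\<chi> i. x i)) \<in> borel_measurable (\<Pi>\<^sub>M i\<in>(UNIV::'n set). (lborel :: real measure))"
        by measurable
      then show "(\<lambda>x. g (\<chi> i. x i)) \<in> borel_measurable (\<Pi>\<^sub>M i\<in>insert m ?R. lborel :: real measure)"
        using U by simp
    qed auto
    finally show ?thesis .
  qed
  \<comment> \<open>With the other coordinates frozen, the shear translates coordinate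
    \<open>m\<close> by a constant, so one-dimensional translation invariance is enough once
    \<open>m\<close> is integrated innermost.\<close>
  have inner: "(\<integral>\<^sup>+ t. f (\<chi> i. if i = m then t + c else x i) \<partial>lborel)
       = (\<integral>\<^sup>+ t. f (\<chi> i. if i = m then t else x i) \<partial>lborel)" for x and c :: real
  proof -
    have [measurable]: "(\<lambda>t. (\<chi> i. if i = m then t else x i) :: real ^ 'n) \<in> borel_measurable borel"
    proof (intro borel_measurable_continuous_onI continuous_on_vec_lambda)
      show "continuous_on UNIV (\<lambda>t. if i = m then t else x i)" for i
        by (cases "i = m") (auto intro!: continuous_intros)
    qed
    show ?thesis
      by (subst (2) lborel_distr_plus[of c, symmetric], subst nn_integral_distr)
         (auto simp: add.commute cong: if_cong)
  qed
  have "(\<integral>\<^sup>+ x. f (\<chi> i. if i = m then x $ m + x $ n else x $ i) \<partial>lborel)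
     = (\<integral>\<^sup>+ x. (\<integral>\<^sup>+ t. f (\<chi> i. if i = m then t + x n else x i) \<partial>lborel) \<partial>(\<Pi>\<^sub>M i\<in>?R. lborel))"
    using measurable_compose[OF shm assms(1)] \<open>m \<noteq> n\<close>
    by (subst rep) (auto intro!: nn_integral_cong arg_cong[where f=f] simp: vec_eq_iff)
  also have "\<dots> = (\<integral>\<^sup>+ x. (\<integral>\<^sup>+ t. f (\<chi> i. if i = m then t else x i) \<partial>lborel) \<partial>(\<Pi>\<^sub>M i\<in>?R. lborel))"
    by (simp add: inner)
  also have "\<dots> = (\<integral>\<^sup>+ x. f x \<partial>lborel)"
    by (subst rep) (auto intro!: nn_integral_cong arg_cong[where f=f] simp: vec_eq_iff)
  finally show ?thesis .
qed

lemma borel_measurable_matrix_vector_mult [measurable]: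
  "(\<lambda>x. (A :: real ^ 'n ^ 'm) *v x) \<in> borel_measurable borel"
  by (intro borel_measurable_continuous_onI linear_continuous_on matrix_vector_mul_bounded_linear)

text \<open>Induction over elementary factors: products, zero rows (excluded by the determinant),
  diagonal matrices, column swaps and shears. The quantifier over \<open>f\<close> stands inside
  because the product case applies the hypothesis for \<open>B\<close> to
  \<open>\<lambda>x. f (A *v x)\<close>.\<close>

lemma nn_integral_matrix:
  fixes A :: "real ^ 'n ^ 'n"
  shows "det A \<noteq> 0 \<Longrightarrow> \<forall>f \<in> borel_measurable borel.
           ennreal \<bar>det A\<bar> * (\<integral>\<^sup>+ x. f (A *v x) \<partial>lborel) = (\<integral>\<^sup>+ x. f x \<partial>lborel)"
proof (induction A rule: induct_matrix_elementary_alt)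
  case (1 A B)
  show ?case
  proof
    fix f :: "real ^ 'n \<Rightarrow> ennreal" assume [measurable]: "f \<in> borel_measurable borel"
    from 1(3) have nz: "det A \<noteq> 0" "det B \<noteq> 0" by (auto simp: det_mul)
    have "ennreal \<bar>det (A ** B)\<bar> * (\<integral>\<^sup>+ x. f ((A ** B) *v x) \<partial>lborel)
       = ennreal \<bar>det A\<bar> * (ennreal \<bar>det B\<bar> * (\<integral>\<^sup>+ x. f (A *v (B *v x)) \<partial>lborel))"
      by (simp add: det_mul abs_mult ennreal_mult mult.assoc matrix_vector_mul_assoc)
    also have "ennreal \<bar>det B\<bar> * (\<integral>\<^sup>+ x. f (A *v (B *v x)) \<partial>lborel) = (\<integral>\<^sup>+ x. f (A *v x) \<partial>lborel)"
      using bspec[OF 1(2)[OF nz(2)], of "\<lambda>x. f (A *v x)"] by simp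
    also have "ennreal \<bar>det A\<bar> * \<dots> = (\<integral>\<^sup>+ x. f x \<partial>lborel)"
      using bspec[OF 1(1)[OF nz(1)], of f] by simp
    finally show "ennreal \<bar>det (A ** B)\<bar> * (\<integral>\<^sup>+ x. f ((A ** B) *v x) \<partial>lborel) = (\<integral>\<^sup>+ x. f x \<partial>lborel)" .
  qed
next
  case (2 A i)
  then show ?case by (simp add: det_zero_row)
next
  case (3 A)
  then have d: "det A = (\<Prod>i\<in>UNIV. A $ i $ i)" by (intro det_diagonal) auto
  with 3(2) have nz: "A $ i $ i \<noteq> 0" for i by auto
  show ?case
  proof
    fix f :: "real ^ 'n \<Rightarrow> ennreal" assume [measurable]: "f \<in> borel_measurable borel"
    \<comment> \<open>\<open>lborel_affine_euclidean\<close> indexes its scaling factors by basis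
      vectors; for a diagonal matrix, \<open>c (axis i 1)\<close> is the entry
      \<open>A $ i $ i\<close>.\<close>
    define c where "c b = (A *v b) \<bullet> b" for b :: "real ^ 'n"
    have cax: "c (axis i 1) = A $ i $ i" for i
      by (simp add: c_def inner_axis matrix_vector_mul_component axis_def row_def inner_vec_def
          if_distrib cong: if_cong)
    have c: "c b \<noteq> 0" if "b \<in> Basis" for b
      using that nz by (auto simp: Basis_vec_def cax)
    have T: "0 + (\<Sum>b\<in>Basis. (c b * (x \<bullet> b)) *\<^sub>R b) = A *v x" for x :: "real ^ 'n"
    proof (rule euclidean_eqI)
      fix b :: "real ^ 'n" assume b: "b \<in> Basis"
      then obtain i where bi: "b = axis i 1" by (auto simp: Basis_vec_def)
      have "(0 + (\<Sum>b\<in>Basis. (c b * (x \<bullet> b)) *\<^sub>R b)) \<bullet> b = c b * (x \<bullet> b)"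
        using b by simp
      also have "\<dots> = A $ i $ i * x $ i" by (simp add: bi cax) (simp add: inner_axis)
      also have "\<dots> = (\<Sum>j\<in>UNIV. A $ i $ j * x $ j)"
        by (simp add: 3(1) sum.remove[where x=i])
      also have "\<dots> = (A *v x) \<bullet> b"
        by (simp add: bi inner_axis matrix_vector_mult_def)
      finally show "(0 + (\<Sum>b\<in>Basis. (c b * (x \<bullet> b)) *\<^sub>R b)) \<bullet> b = (A *v x) \<bullet> b" .
    qed
    have pr: "(\<Prod>b\<in>Basis. \<bar>c b\<bar>) = \<bar>det A\<bar>"
      by (simp add: prod_Basis_vec cax d abs_prod)
    have "lborel = density (distr lborel borel ((*v) A)) (\<lambda>_. ennreal \<bar>det A\<bar>)"
      using lborel_affine_euclidean[of c 0, OF c] unfolding T pr .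
    then have "(\<integral>\<^sup>+ x. f x \<partial>lborel) = (\<integral>\<^sup>+ x. f x \<partial>density (distr lborel borel ((*v) A)) (\<lambda>_. ennreal \<bar>det A\<bar>))"
      by simp
    also have "\<dots> = ennreal \<bar>det A\<bar> * (\<integral>\<^sup>+ x. f (A *v x) \<partial>lborel)"
      by (simp add: nn_integral_density nn_integral_distr nn_integral_cmult)
    finally show "ennreal \<bar>det A\<bar> * (\<integral>\<^sup>+ x. f (A *v x) \<partial>lborel) = (\<integral>\<^sup>+ x. f x \<partial>lborel)" ..
  qed
next
  case (4 m n)
  let ?p = "Transposition.transpose m n"
  let ?A = "(\<chi> i j. mat 1 $ i $ ?p j) :: real ^ 'n ^ 'n"
  have mv: "?A *v x = (\<chi> i. x $ ?p i)" for x :: "real ^ 'n"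
  proof -
    have "(?A *v x) $ i = x $ ?p i" for i
    proof -
      have "(?A *v x) $ i = (\<Sum>j\<in>UNIV. if j = ?p i then x $ j else 0)"
        unfolding matrix_vector_mult_def mat_def vec_lambda_beta
        by (intro sum.cong refl) (metis mult_zero_left mult_1 transpose_involutory)
      then show ?thesis by simp
    qed
    then show ?thesis by (simp add: vec_eq_iff)
  qed
  have dA: "\<bar>det ?A\<bar> = 1"
  proof -
    have "det ?A = of_int (sign ?p) * det (mat 1 :: real ^ 'n ^ 'n)"
      by (rule det_permute_columns) (rule permutes_swap_id, auto)
    then show ?thesis by (simp add: sign_swap_id 4)
  qed
  show ?case
  proof
    fix f :: "real ^ 'n \<Rightarrow> ennreal" assume [measurable]: "f \<in> borel_measurable borel"
    \<comment> \<open>Boxes determine \<open>lborel\<close>, and a coordinate swap carries boxes to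
      boxes of the same volume.\<close>
    have "distr lborel borel ((*v) ?A) = lborel"
    proof (rule lborel_eqI[symmetric])
      fix l u :: "real ^ 'n" assume le: "\<And>b. b \<in> Basis \<Longrightarrow> l \<bullet> b \<le> u \<bullet> b"
      have le': "l $ i \<le> u $ i" for i
        using le[of "axis i 1"] by (auto simp: inner_axis)
      have pre: "(*v) ?A -` box l u = box (\<chi> i. l $ ?p i) (\<chi> i. u $ ?p i)"
        unfolding mv by (auto simp: mem_box_cart) (metis transpose_involutory)+
      have "emeasure (distr lborel borel ((*v) ?A)) (box l u) = emeasure lborel (box (\<chi> i. l $ ?p i) (\<chi> i. u $ ?p i))"
        by (subst emeasure_distr) (auto simp: pre)
      also have "\<dots> = ennreal (\<Prod>b\<in>Basis. ((\<chi> i. u $ ?p i) - (\<chi> i. l $ ?p i)) \<bullet> b)"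
        by (rule emeasure_lborel_box) (auto simp: Basis_vec_def inner_axis le')
      also have "(\<Prod>b\<in>Basis. ((\<chi> i. u $ ?p i) - (\<chi> i. l $ ?p i)) \<bullet> b) = (\<Prod>i\<in>UNIV. u $ ?p i - l $ ?p i)"
        by (simp add: prod_Basis_vec inner_axis)
      also have "\<dots> = (\<Prod>i\<in>UNIV. u $ i - l $ i)"
        by (rule prod.reindex_bij_betw) simp
      finally show "emeasure (distr lborel borel ((*v) ?A)) (box l u) = ennreal (\<Prod>b\<in>Basis. (u - l) \<bullet> b)"
        by (simp add: prod_Basis_vec inner_axis)
    qed simp
    then have "(\<integral>\<^sup>+ x. f x \<partial>lborel) = (\<integral>\<^sup>+ x. f x \<partial>distr lborel borel ((*v) ?A))" by simp
    also have "\<dots> = (\<integral>\<^sup>+ x. f (?A *v x) \<partial>lborel)" by (subst nn_integral_distr) auto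
    finally show "ennreal \<bar>det ?A\<bar> * (\<integral>\<^sup>+ x. f (?A *v x) \<partial>lborel) = (\<integral>\<^sup>+ x. f x \<partial>lborel)"
      by (simp add: dA)
  qed
next
  case (5 m n)
  let ?A = "(\<chi> i j. of_bool (i = m \<and> j = n \<or> i = j)) :: real ^ 'n ^ 'n"
  have mv: "?A *v x = (\<chi> i. if i = m then x $ m + x $ n else x $ i)" for x :: "real ^ 'n"
  proof -
    have "(?A *v x) $ i = (if i = m then x $ m + x $ n else x $ i)" for i
    proof (cases "i = m")
      case True
      have "(?A *v x) $ i = (\<Sum>j\<in>UNIV. (if j = m then x $ j else 0) + (if j = n then x $ j else 0))"
        using True 5 by (auto simp: matrix_vector_mult_def intro!: sum.cong)
      then show ?thesis using True by (simp add: sum.distrib)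
    next
      case False
      have "(?A *v x) $ i = (\<Sum>j\<in>UNIV. (if j = i then x $ j else 0))"
        using False by (auto simp: matrix_vector_mult_def intro!: sum.cong)
      then show ?thesis using False by simp
    qed
    then show ?thesis by (simp add: vec_eq_iff)
  qed
  have dA: "det ?A = 1"
  proof -
    have "?A = (\<chi> k. if k = m then row m (mat 1) + 1 *s row n (mat 1) else row k (mat 1))"
      using 5 by (auto simp: vec_eq_iff row_def mat_def)
    also have "det \<dots> = det (mat 1 :: real ^ 'n ^ 'n)"
      by (rule det_row_operation) (use 5 in auto)
    finally show ?thesis by simp
  qed
  show ?case using nn_integral_shear[OF _ 5(1)] unfolding dA mv by simp
qed

lemma lborel_matrix_eq:
  fixes A :: "real ^ 'n ^ 'n"
  assumes "det A \<noteq> 0"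
  shows "lborel = density (distr lborel borel ((*v) A)) (\<lambda>_. ennreal \<bar>det A\<bar>)"
proof (rule measure_eqI)
  fix X :: "(real ^ 'n) set" assume "X \<in> sets lborel"
  then have [measurable]: "X \<in> sets borel" by simp
  have "emeasure lborel X = (\<integral>\<^sup>+ x. indicator X x \<partial>lborel)" by simp
  also have "\<dots> = ennreal \<bar>det A\<bar> * (\<integral>\<^sup>+ x. indicator X (A *v x) \<partial>lborel)"
    using bspec[OF nn_integral_matrix[OF assms], of "indicator X"] by simp
  also have "\<dots> = emeasure (density (distr lborel borel ((*v) A)) (\<lambda>_. ennreal \<bar>det A\<bar>)) X"
  proof -
    have "(\<integral>\<^sup>+ x. indicator X (A *v x) \<partial>lborel)
        = (\<integral>\<^sup>+ x. indicator X x \<partial>distr lborel borel ((*v) A))"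
      by (subst nn_integral_distr) auto
    then show ?thesis by (simp add: emeasure_density nn_integral_cmult)
  qed
  finally show "emeasure lborel X = emeasure (density (distr lborel borel ((*v) A)) (\<lambda>_. ennreal \<bar>det A\<bar>)) X" .
qed simp

lemma integral_matrix:
  fixes A :: "real ^ 'n ^ 'n" and f :: "real ^ 'n \<Rightarrow> 'b::{banach, second_countable_topology}"
  assumes "det A \<noteq> 0" and [measurable]: "f \<in> borel_measurable borel"
  shows "integrable lborel (\<lambda>x. f (A *v x)) \<longleftrightarrow> integrable lborel f"
    and "(LINT x|lborel. f x) = \<bar>det A\<bar> *\<^sub>R (LINT x|lborel. f (A *v x))"
proof -
  have sc: "integrable lborel (\<lambda>x. k *\<^sub>R g x) \<longleftrightarrow> integrable lborel g"
    if "k \<noteq> 0" for k :: real and g :: "real ^ 'n \<Rightarrow> 'b"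
    using integrable_scaleR_right[of "1 / k" lborel "\<lambda>x. k *\<^sub>R g x"] that by auto
  show "integrable lborel (\<lambda>x. f (A *v x)) \<longleftrightarrow> integrable lborel f"
    using assms(1)
    by (subst (2) lborel_matrix_eq[OF assms(1)])
       (simp add: integrable_density integrable_distr_eq, metis sc abs_eq_0_iff)
  show "(LINT x|lborel. f x) = \<bar>det A\<bar> *\<^sub>R (LINT x|lborel. f (A *v x))"
    by (subst lborel_matrix_eq[OF assms(1)])
       (simp add: integral_density integral_distr)
qed

lemma integral_translate:
  fixes f :: "'a::euclidean_space \<Rightarrow> 'b::{banach, second_countable_topology}"
  assumes [measurable]: "f \<in> borel_measurable borel"
  shows "integrable lborel (\<lambda>x. f (c + x)) \<longleftrightarrow> integrable lborel f"
    and "(LINT x|lborel. f (c + x)) = (LINT x|lborel. f x)"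
proof -
  show "integrable lborel (\<lambda>x. f (c + x)) \<longleftrightarrow> integrable lborel f"
    by (subst (2) lborel_distr_plus[of c, symmetric]) (simp add: integrable_distr_eq)
  show "(LINT x|lborel. f (c + x)) = (LINT x|lborel. f x)"
    by (subst (2) lborel_distr_plus[of c, symmetric]) (simp add: integral_distr)
qed


subsection \<open>Characters and trigonometric polynomials\<close>

definition ee :: "real \<Rightarrow> complex" where
  "ee x = cis (2 * pi * x)"

lemma ee_0 [simp]: "ee 0 = 1" by (simp add: ee_def)
lemma ee_add: "ee (x + y) = ee x * ee y" by (simp add: ee_def cis_mult ring_distribs)
lemma cnj_ee: "cnj (ee x) = ee (- x)" by (simp add: ee_def cis_cnj)
lemma norm_ee [simp]: "cmod (ee x) = 1" by (simp add: ee_def)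
lemma ee_of_int [simp]: "ee (of_int k) = 1"
  using cis_multiple_2pi[of "of_int k"] by (simp add: ee_def)
lemma ee_sum: "ee (sum f A) = (\<Prod>i\<in>A. ee (f i))"
  by (induction A rule: infinite_finite_induct) (auto simp: ee_add)
lemma continuous_on_ee [continuous_intros]: "continuous_on S f \<Longrightarrow> continuous_on S (\<lambda>x. ee (f x))"
  unfolding ee_def by (intro continuous_intros)
lemma ee_measurable [measurable]: "ee \<in> borel_measurable borel"
  by (intro borel_measurable_continuous_onI continuous_intros)

lemma real_vec_simps [simp]:
  "real_vec 0 = 0" "real_vec (k + l) = real_vec k + real_vec l" "real_vec (- k) = - real_vec k"
  "real_vec (k - l) = real_vec k - real_vec l" "real_vec k $ i = of_int (k $ i)"
  by (auto simp: real_vec_def vec_eq_iff)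

lemma ee_real_vec_inner_real_vec [simp]: "ee (real_vec k \<bullet> real_vec m) = 1"
proof -
  have "real_vec k \<bullet> real_vec m = of_int (\<Sum>i\<in>UNIV. k $ i * m $ i)"
    by (simp add: inner_vec_def)
  then show ?thesis by (simp only: ee_of_int)
qed

text \<open>Half-open, so that the integer translates tile the space without overlap; centred, so
  that the origin is an interior point when the Fejer kernel concentrates there.\<close>

definition cell :: "(real ^ 'n) set" where
  "cell = {y. \<forall>i. - (1/2) \<le> y $ i \<and> y $ i < 1/2}"

lemma cell_measurable [measurable]: "cell \<in> sets borel"
  unfolding cell_def by measurable

lemma indicator_cell: "indicator cell y = (\<Prod>i\<in>UNIV. indicator {-(1/2)..<1/2} (y $ i) :: real)"
proof (cases "y \<in> cell")
  case True
  then show ?thesis by (auto simp: cell_def intro!: prod.neutral[symmetric])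
next
  case False
  then obtain i where "\<not> (- (1/2) \<le> y $ i \<and> y $ i < 1/2)" by (auto simp: cell_def)
  then have "(\<Prod>i\<in>UNIV. indicator {-(1/2)..<1/2} (y $ i) :: real) = 0"
    by (intro prod_zero bexI[of _ i]) auto
  with False show ?thesis by simp
qed

lemma integral_ee_unit:
  "integrable lborel (\<lambda>t. indicator {-(1/2)..<1/2} t *\<^sub>R ee (of_int k * t))"
  "(LINT t|lborel. indicator {-(1/2)..<1/2} t *\<^sub>R ee (of_int k * t)) = (if k = 0 then 1 else 0)"
proof -
  \<comment> \<open>The endpoint 1/2 is a null set, and the fundamental theorem of calculus is
    applied on the closed interval.\<close>
  have ae: "AE t in lborel. indicator {-(1/2)..<1/2} t *\<^sub>R ee (of_int k * t)
      = indicator {-(1/2)..1/2} t *\<^sub>R ee (of_int k * t)"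
    using AE_lborel_singleton[of "1/2::real"] by eventually_elim (auto simp: indicator_def)
  have cont: "continuous_on {-(1/2)..1/2} (\<lambda>t. ee (of_int k * t))"
    by (intro continuous_intros)
  have int: "integrable lborel (\<lambda>t. indicator {-(1/2)..1/2} t *\<^sub>R ee (of_int k * t))"
    using borel_integrable_compact[OF compact_Icc cont] by (simp add: indicator_def if_distrib cong: if_cong)
  show "integrable lborel (\<lambda>t. indicator {-(1/2)..<1/2} t *\<^sub>R ee (of_int k * t))"
    by (subst integrable_cong_AE[OF _ _ ae]) (use int in auto)
  have "(LINT t|lborel. indicator {-(1/2)..<1/2} t *\<^sub>R ee (of_int k * t))
      = (LINT t|lborel. indicator {-(1/2)..1/2} t *\<^sub>R ee (of_int k * t))"
    by (rule integral_cong_AE[OF _ _ ae]) auto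
  also have "\<dots> = (if k = 0 then 1 else 0)"
  proof (cases "k = 0")
    case True
    then show ?thesis by simp
  next
    case False
    let ?c = "\<i> * (2 * pi * of_int k)"
    have eq: "ee (of_int k * t) = exp (?c * of_real t)" for t
      by (simp add: ee_def cis_conv_exp mult_ac)
    have der: "((\<lambda>t. ee (of_int k * t) / ?c) has_vector_derivative ee (of_int k * x)) (at x within S)" for x S
      unfolding eq using False
      by (auto intro!: derivative_eq_intros has_vector_derivative_real_field simp: field_simps)
    have "(LINT t|lborel. indicator {-(1/2)..1/2} t *\<^sub>R ee (of_int k * t))
       = ee (of_int k * (1/2)) / ?c - ee (of_int k * (-(1/2))) / ?c"
      by (rule integral_FTC_Icc[OF _ der cont]) simp
    also have "ee (of_int k * (1/2)) = ee (of_int k * (-(1/2)) + of_int k)" by (simp add: field_simps)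
    also have "\<dots> = ee (of_int k * (-(1/2)))" by (simp only: ee_add ee_of_int mult_1_right)
    finally show ?thesis using False by simp
  qed
  finally show "(LINT t|lborel. indicator {-(1/2)..<1/2} t *\<^sub>R ee (of_int k * t)) = (if k = 0 then 1 else 0)" .
qed

lemma integral_ee_cell:
  fixes k :: "int ^ 'n"
  shows "integrable lborel (\<lambda>y. indicator cell y *\<^sub>R ee (real_vec k \<bullet> y))"
    and "(LINT y|lborel. indicator cell y *\<^sub>R ee (real_vec k \<bullet> y)) = (if k = 0 then 1 else 0)"
proof -
  have eq: "indicator cell y *\<^sub>R ee (real_vec k \<bullet> y)
     = (\<Prod>i\<in>UNIV. indicator {-(1/2)..<1/2} (y $ i) *\<^sub>R ee (of_int (k $ i) * (y $ i)))" for y :: "real ^ 'n"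
    by (simp add: indicator_cell scaleR_conv_of_real prod.distrib inner_vec_def ee_sum)
  show "integrable lborel (\<lambda>y. indicator cell y *\<^sub>R ee (real_vec k \<bullet> y))"
    unfolding eq by (rule integrable_prod_vec(1)) (rule integral_ee_unit)
  have "(LINT y|lborel. indicator cell y *\<^sub>R ee (real_vec k \<bullet> y))
     = (\<Prod>i\<in>UNIV. (LINT t|lborel. indicator {-(1/2)..<1/2} t *\<^sub>R ee (of_int (k $ i) * t)))"
    unfolding eq by (rule integrable_prod_vec(2)) (rule integral_ee_unit)
  also have "\<dots> = (\<Prod>i\<in>UNIV. if k $ i = 0 then 1 else 0)"
    by (simp only: integral_ee_unit)
  also have "\<dots> = (if k = 0 then 1 else 0)"
    by (auto simp: vec_eq_iff intro!: prod_zero)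
  finally show "(LINT y|lborel. indicator cell y *\<^sub>R ee (real_vec k \<bullet> y)) = (if k = 0 then 1 else 0)" .
qed

definition trig_poly :: "(int ^ 'n) set \<Rightarrow> (int ^ 'n \<Rightarrow> complex) \<Rightarrow> real ^ 'n \<Rightarrow> complex" where
  "trig_poly K a y = (\<Sum>k\<in>K. a k * ee (real_vec k \<bullet> y))"

lemma continuous_on_trig_poly: "continuous_on S (trig_poly K a)"
  unfolding trig_poly_def by (intro continuous_intros)

lemma trig_poly_measurable [measurable]: "trig_poly K a \<in> borel_measurable borel"
  by (intro borel_measurable_continuous_onI continuous_on_trig_poly)

lemma trig_poly_periodic: "trig_poly K a (real_vec m + y) = trig_poly K a y"
  by (simp add: trig_poly_def inner_add_right ee_add)

lemma integrable_of_realD: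
  assumes "integrable M (\<lambda>x. complex_of_real (f x))"
  shows "integrable M f"
proof -
  have "integrable M (\<lambda>x. Re (complex_of_real (f x)))"
    using assms by (rule integrable_Re)
  then show ?thesis by simp
qed

lemma norm_trig_poly_square:
  "complex_of_real ((cmod (trig_poly K a y))\<^sup>2) = (\<Sum>k\<in>K. \<Sum>l\<in>K. a k * cnj (a l) * ee (real_vec (k - l) \<bullet> y))"
proof -
  have "ee (real_vec (k - l) \<bullet> y) = ee (real_vec k \<bullet> y) * cnj (ee (real_vec l \<bullet> y))" for k l
    by (simp add: cnj_ee inner_diff_left flip: ee_add)
  then show ?thesis
    unfolding complex_norm_square trig_poly_def cnj_sum sum_product
    by (simp add: mult_ac)
qed

lemma integral_trig_poly_square:
  fixes K :: "(int ^ 'n) set"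
  assumes "finite K"
  shows "integrable lborel (\<lambda>y. indicator cell y * (cmod (trig_poly K a y))\<^sup>2)"
    and "(LINT y|lborel. indicator cell y * (cmod (trig_poly K a y))\<^sup>2) = (\<Sum>k\<in>K. (cmod (a k))\<^sup>2)"
proof -
  have eq: "complex_of_real (indicator cell y * (cmod (trig_poly K a y))\<^sup>2)
     = (\<Sum>k\<in>K. \<Sum>l\<in>K. a k * cnj (a l) * (indicator cell y *\<^sub>R ee (real_vec (k - l) \<bullet> y)))" for y :: "real ^ 'n"
    by (simp only: of_real_mult norm_trig_poly_square sum_distrib_left)
       (intro sum.cong refl, simp add: scaleR_conv_of_real mult_ac)
  have "integrable lborel (\<lambda>y. complex_of_real (indicator cell y * (cmod (trig_poly K a y))\<^sup>2))"
    unfolding eq by (intro Bochner_Integration.integrable_sum integrable_mult_right integral_ee_cell)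
  then show int: "integrable lborel (\<lambda>y. indicator cell y * (cmod (trig_poly K a y))\<^sup>2)"
    by (rule integrable_of_realD)
  have "complex_of_real (LINT y|lborel. indicator cell y * (cmod (trig_poly K a y))\<^sup>2)
     = (LINT y|lborel. complex_of_real (indicator cell y * (cmod (trig_poly K a y))\<^sup>2))"
    by (rule integral_of_real[OF int, symmetric])
  also have "\<dots> = (\<Sum>k\<in>K. \<Sum>l\<in>K. a k * cnj (a l) * (if k - l = 0 then 1 else 0))"
    unfolding eq
    by (intro has_bochner_integral_integral_eq has_bochner_integral_sum has_bochner_integral_mult_right)
       (simp only: has_bochner_integral_iff integral_ee_cell)
  also have "\<dots> = (\<Sum>k\<in>K. \<Sum>l\<in>K. if k = l then a k * cnj (a l) else 0)"
    by (intro sum.cong refl) auto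
  also have "\<dots> = (\<Sum>k\<in>K. a k * cnj (a k))"
    using assms by simp
  also have "\<dots> = complex_of_real (\<Sum>k\<in>K. (cmod (a k))\<^sup>2)"
    by (simp add: complex_norm_square[symmetric])
  finally show "(LINT y|lborel. indicator cell y * (cmod (trig_poly K a y))\<^sup>2) = (\<Sum>k\<in>K. (cmod (a k))\<^sup>2)"
    by (simp only: of_real_eq_iff)
qed

section \<open>Integer points in cubes and the tiling by translates of the cell\<close>

lemma boxed_int_vecs:
  fixes S :: "'n::finite \<Rightarrow> int set"
  assumes "\<And>i. finite (S i)"
  shows "finite {m :: int ^ 'n. \<forall>i. m $ i \<in> S i}"
    and "card {m :: int ^ 'n. \<forall>i. m $ i \<in> S i} = (\<Prod>i\<in>UNIV. card (S i))"
proof -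
  have eq: "{m :: int ^ 'n. \<forall>i. m $ i \<in> S i} = vec_lambda ` (\<Pi>\<^sub>E i\<in>UNIV. S i)"
    by (auto simp: image_iff PiE_def Pi_def intro!: bexI[of _ "vec_nth _"] exI[of _ "vec_nth _"])
  show "finite {m :: int ^ 'n. \<forall>i. m $ i \<in> S i}"
    unfolding eq by (intro finite_imageI finite_PiE) (auto simp: assms)
  show "card {m :: int ^ 'n. \<forall>i. m $ i \<in> S i} = (\<Prod>i\<in>UNIV. card (S i))"
    unfolding eq by (subst card_image) (auto simp: card_PiE inj_on_def vec_lambda_inject)
qed

definition lattice_cube :: "real \<Rightarrow> (int ^ 'n) set" where
  "lattice_cube X = {m. \<forall>i. \<bar>real_of_int (m $ i)\<bar> \<le> X}"

lemma lattice_cube_eq: "lattice_cube X = {m. \<forall>i. m $ i \<in> {- \<lfloor>X\<rfloor>..\<lfloor>X\<rfloor>}}"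
  unfolding lattice_cube_def by (auto simp: abs_le_iff le_floor_iff) (metis le_floor_iff minus_le_iff of_int_minus)+

lemma finite_lattice_cube [simp]: "finite (lattice_cube X)"
  unfolding lattice_cube_eq by (rule boxed_int_vecs) simp

lemma card_lattice_cube:
  assumes "X \<ge> 0"
  shows "real (card (lattice_cube X :: (int ^ 'n) set)) \<le> (2 * X + 1) ^ CARD('n)"
proof -
  have "card (lattice_cube X :: (int ^ 'n) set) = (nat (2 * \<lfloor>X\<rfloor> + 1)) ^ CARD('n)"
    unfolding lattice_cube_eq by (subst boxed_int_vecs) (auto simp: algebra_simps)
  moreover have "real (nat (2 * \<lfloor>X\<rfloor> + 1)) \<le> 2 * X + 1"
    using assms of_int_floor_le[of X] by (simp add: of_nat_nat)
  ultimately show ?thesis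
    by (auto intro!: power_mono)
qed

text \<open>Rounding each coordinate to a nearest integer moves it by at most 1/2, hence the radius
  \<open>R + 1/2\<close>.\<close>

lemma exists_cell_translate:
  fixes y :: "real ^ 'n"
  assumes "\<And>i. \<bar>y $ i\<bar> \<le> R"
  shows "\<exists>m \<in> lattice_cube (R + 1/2). y - real_vec m \<in> cell"
proof (intro bexI)
  let ?m = "(\<chi> i. \<lfloor>y $ i + 1/2\<rfloor>) :: int ^ 'n"
  show "y - real_vec ?m \<in> cell"
    unfolding cell_def by (auto; linarith)
  have "\<bar>real_of_int \<lfloor>y $ i + 1/2\<rfloor>\<bar> \<le> R + 1/2" for i
    using assms[of i] by linarith
  then show "?m \<in> lattice_cube (R + 1/2)"
    by (simp add: lattice_cube_def)
qed

lemma cell_translate_unique: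
  assumes "y - real_vec m \<in> cell" "y - real_vec m' \<in> cell"
  shows "m = m'"
proof -
  have "m $ i = m' $ i" for i
  proof -
    have "\<bar>real_of_int (m $ i) - real_of_int (m' $ i)\<bar> < 1"
      using assms[unfolded cell_def mem_Collect_eq, rule_format, of i] by auto
    then show ?thesis by linarith
  qed
  then show ?thesis by (simp add: vec_eq_iff)
qed

text \<open>Exactly one translate of the cell contains a given point, so the tiling cuts
  \<open>g\<close> into finitely many pieces as soon as \<open>M\<close> lists the cells that meet
  its support. Against a periodic factor the right-hand side becomes an integral of the
  periodization over one cell.\<close>

lemma integral_split_cells:
  fixes g :: "real ^ 'n \<Rightarrow> real"
  assumes g: "integrable lborel g" and "finite M"
    and cover: "\<And>y. g y \<noteq> 0 \<Longrightarrow> \<exists>m\<in>M. y - real_vec m \<in> cell"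
  shows "integrable lborel (\<lambda>y. indicator cell y * g (real_vec m + y))"
    and "(LINT y|lborel. g y) = (\<Sum>m\<in>M. (LINT y|lborel. indicator cell y * g (real_vec m + y)))"
proof -
  have [measurable]: "g \<in> borel_measurable borel"
    using borel_measurable_integrable[OF g] by simp
  let ?G = "\<lambda>m y. indicator cell (y - real_vec m) * g y"
  have iG: "integrable lborel (?G m)" for m
    by (rule Bochner_Integration.integrable_bound[OF g]) (auto simp: indicator_def)
  have tr: "integrable lborel (\<lambda>y. indicator cell y * g (real_vec m + y))"
      "(LINT y|lborel. indicator cell y * g (real_vec m + y)) = (LINT y|lborel. ?G m y)" for m
    using integral_translate[of "?G m" "real_vec m"] iG[of m] by auto
  show "integrable lborel (\<lambda>y. indicator cell y * g (real_vec m + y))" by (rule tr)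
  have "g y = (\<Sum>m\<in>M. ?G m y)" for y
  proof (cases "g y = 0")
    case False
    then obtain m where m: "m \<in> M" "y - real_vec m \<in> cell" using cover[OF False] by blast
    have "(\<Sum>m'\<in>M. ?G m' y) = (\<Sum>m'\<in>M. if m' = m then g y else 0)"
    proof (intro sum.cong refl)
      fix m' show "?G m' y = (if m' = m then g y else 0)"
        using cell_translate_unique[OF m(2), of m'] m by (cases "m' = m") (auto simp: indicator_def)
    qed
    then show ?thesis using m \<open>finite M\<close> by simp
  qed simp
  then have "(LINT y|lborel. g y) = (LINT y|lborel. (\<Sum>m\<in>M. ?G m y))" by simp
  also have "\<dots> = (\<Sum>m\<in>M. (LINT y|lborel. ?G m y))"
    by (rule Bochner_Integration.integral_sum) (rule iG)
  finally show "(LINT y|lborel. g y) = (\<Sum>m\<in>M. (LINT y|lborel. indicator cell y * g (real_vec m + y)))"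
    by (simp only: tr)
qed


subsection \<open>The Fejer kernel and Poisson summation\<close>

definition fejer_index :: "nat \<Rightarrow> (int ^ 'n) set" where
  "fejer_index N = {m. \<forall>i. m $ i \<in> {0..<int N}}"

text \<open>The product of the one-dimensional Fejer kernels. Writing it as a normalized square
  makes it visibly nonnegative, and its Fourier coefficients are counts of pairs of indices with a
  given difference.\<close>

definition fejer_kernel :: "nat \<Rightarrow> real ^ 'n \<Rightarrow> real" where
  "fejer_kernel N y = (cmod (trig_poly (fejer_index N) (\<lambda>_. 1) y))\<^sup>2 / real N ^ CARD('n)"

lemma finite_fejer_index [simp]: "finite (fejer_index N)"
  unfolding fejer_index_def by (rule boxed_int_vecs) simp

lemma card_fejer_index: "card (fejer_index N :: (int ^ 'n) set) = N ^ CARD('n)"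
  unfolding fejer_index_def by (subst boxed_int_vecs) auto

text \<open>This face consists of the indices that leave the box when coordinate \<open>p\<close> is
  increased by 1.\<close>

lemma card_fejer_face:
  "card {m \<in> fejer_index N :: (int ^ 'n) set. m $ p = int N - 1} \<le> N ^ (CARD('n) - 1)"
proof (cases "N = 0")
  case True
  then show ?thesis by (simp add: fejer_index_def)
next
  case False
  let ?S = "\<lambda>i. if i = p then {int N - 1} else {0..<int N}"
  have "{m \<in> fejer_index N :: (int ^ 'n) set. m $ p = int N - 1} \<subseteq> {m. \<forall>i. m $ i \<in> ?S i}"
    by (auto simp: fejer_index_def)
  then have "card {m \<in> fejer_index N :: (int ^ 'n) set. m $ p = int N - 1} \<le> card {m :: int ^ 'n. \<forall>i. m $ i \<in> ?S i}"
    by (intro card_mono boxed_int_vecs) auto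
  also have "\<dots> = (\<Prod>i\<in>UNIV. card (?S i))"
    by (rule boxed_int_vecs) auto
  also have "\<dots> = (\<Prod>i\<in>UNIV - {p}. card (?S i))"
    by (subst prod.remove[of _ p]) auto
  also have "\<dots> = (\<Prod>i\<in>UNIV - {p}. N)"
    by (intro prod.cong) auto
  also have "\<dots> = N ^ (CARD('n) - 1)"
    by (simp add: card_Diff_singleton)
  finally show ?thesis .
qed

lemma fejer_kernel_nonneg: "fejer_kernel N y \<ge> 0"
  by (simp add: fejer_kernel_def)

lemma continuous_on_fejer_kernel: "continuous_on S (fejer_kernel N)"
  unfolding fejer_kernel_def divide_inverse by (intro continuous_intros continuous_on_trig_poly)

lemma fejer_kernel_measurable [measurable]: "fejer_kernel N \<in> borel_measurable borel"
  by (intro borel_measurable_continuous_onI continuous_on_fejer_kernel)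

lemma fejer_kernel_periodic: "fejer_kernel N (real_vec m + y) = fejer_kernel N y"
  by (simp add: fejer_kernel_def trig_poly_periodic)

lemma fejer_kernel_expand:
  "complex_of_real (fejer_kernel N (y :: real ^ 'n)) =
     (\<Sum>j\<in>fejer_index N. \<Sum>l\<in>fejer_index N. ee (real_vec (j - l) \<bullet> y)) / of_nat N ^ CARD('n)"
  unfolding fejer_kernel_def of_real_divide norm_trig_poly_square by simp

lemma integral_fejer_kernel:
  assumes "N > 0"
  shows "integrable lborel (\<lambda>y. indicator cell y * fejer_kernel N (y :: real ^ 'n))"
    and "(LINT y|lborel. indicator cell y * fejer_kernel N (y :: real ^ 'n)) = 1"
  using integral_trig_poly_square[of "fejer_index N :: (int ^ 'n) set" "\<lambda>_. 1"] assms
  by (simp_all add: fejer_kernel_def card_fejer_index)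

text \<open>The integral is 1 minus the coefficient of the kernel at the unit frequency in direction
  \<open>p\<close>. That coefficient is the proportion of box indices \<open>j\<close> for which
  \<open>j + ?e\<close> stays in the box; the others lie on one face, which is at most a fraction
  \<open>1 / N\<close> of the box.\<close>

lemma integral_fejer_kernel_cos:
  assumes "N > 0"
  shows "integrable lborel (\<lambda>y. indicator cell y * (fejer_kernel N (y :: real ^ 'n) * (1 - cos (2 * pi * (y $ p)))))"
    and "(LINT y|lborel. indicator cell y * (fejer_kernel N (y :: real ^ 'n) * (1 - cos (2 * pi * (y $ p))))) \<le> 1 / real N"
proof -
  let ?J = "fejer_index N :: (int ^ 'n) set"
  let ?e = "axis p 1 :: int ^ 'n"
  let ?D = "of_nat N ^ CARD('n) :: complex"
  have e: "ee (y $ p) = ee (real_vec ?e \<bullet> y)" for y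
  proof -
    have "real_vec ?e = axis p 1" by (auto simp: vec_eq_iff axis_def)
    then show ?thesis by (simp add: inner_axis inner_commute)
  qed
  have eq: "indicator cell y *\<^sub>R (complex_of_real (fejer_kernel N y) * ee (y $ p))
     = (\<Sum>j\<in>?J. \<Sum>l\<in>?J. (1 / ?D) * (indicator cell y *\<^sub>R ee (real_vec (j - l + ?e) \<bullet> y)))" for y
    unfolding fejer_kernel_expand e
    by (simp add: sum_divide_distrib sum_distrib_left sum_distrib_right scaleR_conv_of_real
        inner_add_left ee_add mult_ac del: real_vec_simps(4))
  have hb: "has_bochner_integral lborel (\<lambda>y. indicator cell y *\<^sub>R (complex_of_real (fejer_kernel N y) * ee (y $ p)))
     (\<Sum>j\<in>?J. \<Sum>l\<in>?J. (1 / ?D) * (if j - l + ?e = 0 then 1 else 0))"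
    unfolding eq
    by (intro has_bochner_integral_sum has_bochner_integral_mult_right)
       (simp only: has_bochner_integral_iff integral_ee_cell)
  have Re1: "Re (indicator cell y *\<^sub>R (complex_of_real (fejer_kernel N y) * ee (y $ p)))
      = indicator cell y * (fejer_kernel N y * cos (2 * pi * (y $ p)))" for y :: "real ^ 'n"
    by (simp add: ee_def)
  have Re2: "Re (\<Sum>j\<in>?J. \<Sum>l\<in>?J. (1 / ?D) * (if j - l + ?e = 0 then 1 else 0))
     = real (card {j \<in> ?J. j + ?e \<in> ?J}) / real N ^ CARD('n)"
  proof -
    have "(\<Sum>l\<in>?J. (1 / ?D) * (if j - l + ?e = 0 then 1 else 0)) = (if j + ?e \<in> ?J then 1 / ?D else 0)" for j
    proof -
      have "(\<Sum>l\<in>?J. (1 / ?D) * (if j - l + ?e = 0 then 1 else 0)) = (\<Sum>l\<in>?J. if l = j + ?e then 1 / ?D else 0)"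
        by (intro sum.cong refl) (auto simp: algebra_simps)
      then show ?thesis by simp
    qed
    then have "(\<Sum>j\<in>?J. \<Sum>l\<in>?J. (1 / ?D) * (if j - l + ?e = 0 then 1 else 0))
        = of_nat (card {j \<in> ?J. j + ?e \<in> ?J}) / ?D"
      by (simp add: sum.If_cases Int_def)
    also have "\<dots> = complex_of_real (real (card {j \<in> ?J. j + ?e \<in> ?J}) / real N ^ CARD('n))"
      by simp
    finally show ?thesis by (simp only: Re_complex_of_real)
  qed
  have hb': "has_bochner_integral lborel (\<lambda>y. indicator cell y * (fejer_kernel N y * cos (2 * pi * (y $ p))))
     (real (card {j \<in> ?J. j + ?e \<in> ?J}) / real N ^ CARD('n))"
    using has_bochner_integral_Re[OF hb] unfolding Re1 Re2 .
  have "has_bochner_integral lborel (\<lambda>y. indicator cell y * fejer_kernel N (y :: real ^ 'n)) 1"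
    using integral_fejer_kernel[OF assms] by (simp add: has_bochner_integral_iff)
  from has_bochner_integral_diff[OF this hb']
  have hb'': "has_bochner_integral lborel
      (\<lambda>y. indicator cell y * (fejer_kernel N (y :: real ^ 'n) * (1 - cos (2 * pi * (y $ p)))))
      (1 - real (card {j \<in> ?J. j + ?e \<in> ?J}) / real N ^ CARD('n))"
    by (simp add: algebra_simps)
  then show "integrable lborel (\<lambda>y. indicator cell y * (fejer_kernel N (y :: real ^ 'n) * (1 - cos (2 * pi * (y $ p)))))"
    by (simp add: has_bochner_integral_iff)
  have "?J \<subseteq> {j \<in> ?J. j + ?e \<in> ?J} \<union> {j \<in> ?J. j $ p = int N - 1}"
    by (auto simp: fejer_index_def axis_def) (smt (verit, best))
  then have "card ?J \<le> card ({j \<in> ?J. j + ?e \<in> ?J} \<union> {j \<in> ?J. j $ p = int N - 1})"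
    by (intro card_mono) auto
  also have "\<dots> \<le> card {j \<in> ?J. j + ?e \<in> ?J} + N ^ (CARD('n) - 1)"
    using card_fejer_face[of N p] by (intro order.trans[OF card_Un_le]) auto
  finally have "real (N ^ CARD('n)) \<le> real (card {j \<in> ?J. j + ?e \<in> ?J} + N ^ (CARD('n) - 1))"
    unfolding card_fejer_index by (rule of_nat_mono)
  then have "real N ^ CARD('n) \<le> real (card {j \<in> ?J. j + ?e \<in> ?J}) + real N ^ (CARD('n) - 1)"
    by simp
  then have "(real N ^ CARD('n) - real N ^ (CARD('n) - 1)) / real N ^ CARD('n)
      \<le> real (card {j \<in> ?J. j + ?e \<in> ?J}) / real N ^ CARD('n)"
    by (intro divide_right_mono) auto
  moreover have "real N ^ CARD('n) = real N * real N ^ (CARD('n) - 1)"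
    by (metis power_eq_if zero_less_card_finite less_irrefl)
  ultimately have "1 - real (card {j \<in> ?J. j + ?e \<in> ?J}) / real N ^ CARD('n) \<le> 1 / real N"
    using assms by (simp add: diff_divide_distrib)
  then show "(LINT y|lborel. indicator cell y * (fejer_kernel N (y :: real ^ 'n) * (1 - cos (2 * pi * (y $ p))))) \<le> 1 / real N"
    using hb'' by (simp add: has_bochner_integral_iff)
qed

text \<open>Korovkin's argument: the test functions \<open>1 - cos (2 \<pi> y\<^sub>p)\<close> control the concentration of
  the kernel at the origin.\<close>

lemma fejer_kernel_approximation:
  fixes H :: "real ^ 'n \<Rightarrow> real"
  assumes cont: "continuous_on UNIV H" and bdd: "\<And>y. \<bar>H y\<bar> \<le> A" and "\<epsilon> > 0"
  shows "\<exists>C. \<forall>N>0. \<bar>(LINT y|lborel. indicator cell y * (H y * fejer_kernel N y)) - H 0\<bar> \<le> \<epsilon> + C / real N"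
proof -
  have [measurable]: "H \<in> borel_measurable borel"
    by (rule borel_measurable_continuous_onI[OF cont])
  have "A \<ge> 0" using bdd[of 0] by linarith
  have "isCont H 0" using cont by (simp add: continuous_on_eq_continuous_at)
  then obtain \<delta>' where "\<delta>' > 0" and \<delta>': "\<And>y. norm y < \<delta>' \<Longrightarrow> \<bar>H y - H 0\<bar> < \<epsilon>"
    using \<open>\<epsilon> > 0\<close> unfolding continuous_at_eps_delta by (auto simp: dist_norm)
  \<comment> \<open>Dividing by twice the dimension makes the l1 norm, and so the norm, smaller than
    \<open>\<delta>'\<close> when all coordinates are below \<open>\<delta>\<close>. The cap 1/2
    keeps \<open>2 * pi * \<delta>\<close> in the range where the cosine decreases.\<close>
  define \<delta> where "\<delta> = min (\<delta>' / (2 * real CARD('n))) (1/2)"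
  have \<delta>: "0 < \<delta>" "\<delta> \<le> 1/2" using \<open>\<delta>' > 0\<close> by (auto simp: \<delta>_def)
  define \<eta> where "\<eta> = 1 - cos (2 * pi * \<delta>)"
  have "cos (2 * pi * \<delta>) < cos 0"
    using \<delta> by (intro cos_monotone_0_pi) (auto simp: field_simps)
  then have "\<eta> > 0" by (simp add: \<eta>_def)
  \<comment> \<open>Away from the origin some coordinate is at least \<open>\<delta>\<close> in
    modulus, so the sum of the terms \<open>1 - cos\<close> is at least \<open>\<eta>\<close>. The
    factor is chosen so that \<open>?B * \<eta>\<close> equals \<open>2 * A\<close>, the largest
    possible oscillation of \<open>H\<close>.\<close>
  let ?B = "2 * A / \<eta>"
  have "?B \<ge> 0" using \<open>A \<ge> 0\<close> \<open>\<eta> > 0\<close> by simp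
  have key: "\<bar>H y - H 0\<bar> \<le> \<epsilon> + ?B * (\<Sum>p\<in>UNIV. 1 - cos (2 * pi * (y $ p)))" if "y \<in> cell" for y
  proof (cases "\<forall>p. \<bar>y $ p\<bar> < \<delta>")
    case True
    have "norm y \<le> (\<Sum>p\<in>UNIV. \<bar>y $ p\<bar>)" by (rule norm_le_l1_cart)
    also have "\<dots> \<le> (\<Sum>p\<in>(UNIV::'n set). \<delta>)" using True by (intro sum_mono) (simp add: less_imp_le)
    also have "\<dots> \<le> real CARD('n) * (\<delta>' / (2 * real CARD('n)))"
      unfolding sum_constant \<delta>_def by (intro mult_left_mono) auto
    also have "\<dots> < \<delta>'" using \<open>\<delta>' > 0\<close> by simp
    finally have "\<bar>H y - H 0\<bar> < \<epsilon>" by (rule \<delta>')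
    moreover have "(\<Sum>p\<in>UNIV. 1 - cos (2 * pi * (y $ p))) \<ge> 0" by (intro sum_nonneg) simp
    ultimately show ?thesis using \<open>?B \<ge> 0\<close> by (smt (verit) mult_nonneg_nonneg)
  next
    case False
    then obtain p where p: "\<bar>y $ p\<bar> \<ge> \<delta>" by (auto simp: not_less)
    have "cos (2 * pi * \<bar>y $ p\<bar>) \<le> cos (2 * pi * \<delta>)"
    proof (intro cos_monotone_0_pi_le)
      have "\<bar>y $ p\<bar> \<le> 1/2" using that unfolding cell_def mem_Collect_eq by (smt (verit))
      then show "2 * pi * \<bar>y $ p\<bar> \<le> pi" by simp
    qed (use \<delta> p in auto)
    moreover have "cos (2 * pi * \<bar>y $ p\<bar>) = cos (2 * pi * (y $ p))"
      by (simp add: abs_if)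
    ultimately have "\<eta> \<le> 1 - cos (2 * pi * (y $ p))" by (simp add: \<eta>_def)
    also have "\<dots> \<le> (\<Sum>p\<in>UNIV. 1 - cos (2 * pi * (y $ p)))"
      by (rule member_le_sum) auto
    finally have "?B * \<eta> \<le> ?B * (\<Sum>p\<in>UNIV. 1 - cos (2 * pi * (y $ p)))"
      using \<open>?B \<ge> 0\<close> by (rule mult_left_mono)
    moreover have "?B * \<eta> = 2 * A" using \<open>\<eta> > 0\<close> by simp
    moreover have "\<bar>H y - H 0\<bar> \<le> 2 * A" using bdd[of y] bdd[of 0] by linarith
    ultimately show ?thesis using \<open>\<epsilon> > 0\<close> by linarith
  qed
  have "\<bar>(LINT y|lborel. indicator cell y * (H y * fejer_kernel N y)) - H 0\<bar> \<le> \<epsilon> + ?B * real CARD('n) / real N"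
    if "N > 0" for N
  proof -
    let ?K = "fejer_kernel N :: real ^ 'n \<Rightarrow> real"
    note iK = integral_fejer_kernel[OF that, where 'n='n]
    have iHK: "integrable lborel (\<lambda>y. indicator cell y * (H y * ?K y))"
      by (rule Bochner_Integration.integrable_bound[OF integrable_mult_left[OF iK(1), of A]])
         (auto simp: abs_mult indicator_def fejer_kernel_nonneg mult.commute
           intro!: AE_I2 mult_right_mono order.trans[OF bdd abs_ge_self])
    have "(LINT y|lborel. indicator cell y * (H y * ?K y)) - H 0
        = (LINT y|lborel. indicator cell y * (H y * ?K y) - H 0 * (indicator cell y * ?K y))"
      using iK iHK by simp
    also have "\<bar>\<dots>\<bar> \<le> (LINT y|lborel. \<bar>indicator cell y * (H y * ?K y) - H 0 * (indicator cell y * ?K y)\<bar>)"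
      using integral_norm_bound[of lborel "\<lambda>y. indicator cell y * (H y * ?K y) - H 0 * (indicator cell y * ?K y)"] by simp
    also have "\<dots> \<le> (LINT y|lborel. \<epsilon> * (indicator cell y * ?K y)
        + ?B * (\<Sum>p\<in>UNIV. indicator cell y * (?K y * (1 - cos (2 * pi * (y $ p))))))"
    proof (rule integral_mono)
      show "integrable lborel (\<lambda>y. \<bar>indicator cell y * (H y * ?K y) - H 0 * (indicator cell y * ?K y)\<bar>)"
        using iK iHK by simp
      show "integrable lborel (\<lambda>y. \<epsilon> * (indicator cell y * ?K y)
        + ?B * (\<Sum>p\<in>UNIV. indicator cell y * (?K y * (1 - cos (2 * pi * (y $ p))))))"
        using iK integral_fejer_kernel_cos[OF that]
        by (intro Bochner_Integration.integrable_add integrable_mult_right Bochner_Integration.integrable_sum) auto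
      show "\<bar>indicator cell y * (H y * ?K y) - H 0 * (indicator cell y * ?K y)\<bar>
        \<le> \<epsilon> * (indicator cell y * ?K y)
        + ?B * (\<Sum>p\<in>UNIV. indicator cell y * (?K y * (1 - cos (2 * pi * (y $ p)))))" for y
      proof (cases "y \<in> cell")
        case True
        have "\<bar>H y * ?K y - H 0 * ?K y\<bar> = \<bar>H y - H 0\<bar> * ?K y"
          by (simp add: left_diff_distrib[symmetric] abs_mult fejer_kernel_nonneg)
        also have "\<dots> \<le> (\<epsilon> + ?B * (\<Sum>p\<in>UNIV. 1 - cos (2 * pi * (y $ p)))) * ?K y"
          by (intro mult_right_mono key True fejer_kernel_nonneg)
        also have "\<dots> = \<epsilon> * ?K y + ?B * (\<Sum>p\<in>UNIV. ?K y * (1 - cos (2 * pi * (y $ p))))"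
          by (simp only: sum_distrib_left[symmetric] distrib_right distrib_left mult_ac)
        finally show ?thesis using True by simp
      qed simp
    qed
    also have "\<dots> = \<epsilon> * 1 + ?B * (\<Sum>p\<in>UNIV. LINT y|lborel. indicator cell y * (?K y * (1 - cos (2 * pi * (y $ p)))))"
      by (intro has_bochner_integral_integral_eq has_bochner_integral_add
          has_bochner_integral_mult_right has_bochner_integral_sum)
         (use iK integral_fejer_kernel_cos(1)[OF that] in \<open>auto simp only: has_bochner_integral_iff\<close>)
    also have "\<dots> \<le> \<epsilon> * 1 + ?B * (\<Sum>p\<in>(UNIV::'n set). 1 / real N)"
      using integral_fejer_kernel_cos(2)[OF that] \<open>?B \<ge> 0\<close>
      by (intro add_left_mono mult_left_mono sum_mono) auto
    finally show ?thesis by simp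
  qed
  then show ?thesis by blast
qed


text \<open>Let \<open>H\<close> be the periodization of \<open>h\<close>, whose value at 0 is the
  lattice sum. The integral of \<open>H\<close> against the Fejer kernel is the mean over
  \<open>j\<close> of the sums over \<open>l\<close> of the coefficients \<open>c (j - l)\<close>.
  The terms with \<open>l = j\<close> give exactly the integral of \<open>h\<close>; for fixed
  \<open>j\<close> the remaining frequencies are distinct and nonzero, so \<open>bound\<close>
  limits their sum by \<open>A\<close>. For large \<open>N\<close> the Fejer integral is close to
  \<open>H 0\<close>, so no convergence of the Fourier series enters.\<close>

lemma poisson_inequality:
  fixes h :: "real ^ 'n \<Rightarrow> real"
  assumes cont: "continuous_on UNIV h"
    and supp: "\<And>y i. h y \<noteq> 0 \<Longrightarrow> \<bar>y $ i\<bar> \<le> R"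
    and bound: "\<And>K. finite K \<Longrightarrow> 0 \<notin> K \<Longrightarrow>
       (\<Sum>k\<in>K. cmod (LINT y|lborel. h y *\<^sub>R ee (real_vec k \<bullet> y))) \<le> A"
  shows "\<bar>(\<Sum>\<^sub>\<infinity>m\<in>UNIV. h (real_vec m)) - (LINT y|lborel. h y)\<bar> \<le> A"
proof (rule field_le_epsilon)
  fix \<epsilon> :: real assume "\<epsilon> > 0"
  define M where "M = (lattice_cube (R + 1/2) :: (int ^ 'n) set)"
  have [simp]: "finite M" by (simp add: M_def)
  have [measurable]: "h \<in> borel_measurable borel"
    by (rule borel_measurable_continuous_onI[OF cont])
  have "bounded {y. h y \<noteq> 0}"
  proof (rule boundedI)
    fix y assume "y \<in> {y. h y \<noteq> 0}"
    then have "(\<Sum>i\<in>UNIV. \<bar>y $ i\<bar>) \<le> (\<Sum>i\<in>(UNIV::'n set). R)" using supp by (intro sum_mono) auto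
    then show "norm y \<le> (\<Sum>i\<in>(UNIV::'n set). R)" using norm_le_l1_cart[of y] by linarith
  qed
  then obtain a where a: "{y. h y \<noteq> 0} \<subseteq> cbox (- a) a" by (rule bounded_subset_cbox_symmetric)
  have out: "h y = indicator (cbox (- a) a) y *\<^sub>R h y" for y using a by (auto simp: indicator_def)
  have "continuous_on (cbox (- a) a) h" using cont continuous_on_subset by blast
  then have "bounded (h ` cbox (- a) a)"
    by (intro compact_imp_bounded compact_continuous_image compact_cbox)
  then obtain b where b: "\<And>y. y \<in> cbox (- a) a \<Longrightarrow> \<bar>h y\<bar> \<le> b"
    by (auto simp: bounded_iff)
  have hb: "\<bar>h y\<bar> \<le> \<bar>b\<bar>" for y
    using b[of y] a by (cases "h y = 0") auto
  have inth: "integrable lborel (\<lambda>y. h y *\<^sub>R g y)" if "continuous_on UNIV g" for g :: "real ^ 'n \<Rightarrow> complex"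
  proof -
    have "integrable lborel (\<lambda>y. indicator (cbox (- a) a) y *\<^sub>R (h y *\<^sub>R g y))"
      by (intro borel_integrable_compact[OF compact_cbox, unfolded if_distrib]
           continuous_intros continuous_on_subset[OF cont] continuous_on_subset[OF that]
           | simp add: indicator_def if_distrib cong: if_cong)+
    then show ?thesis by (subst out) (simp add: ac_simps)
  qed
  define c where "c k = (LINT y|lborel. h y *\<^sub>R ee (real_vec k \<bullet> y))" for k
  have c0: "c 0 = complex_of_real (LINT y|lborel. h y)"
    by (simp add: c_def scaleR_conv_of_real)
  define H where "H y = (\<Sum>m\<in>M. h (real_vec m + y))" for y
  have contH: "continuous_on UNIV H"
    unfolding H_def by (intro continuous_intros continuous_on_compose2[OF cont]) auto
  have bddH: "\<bar>H y\<bar> \<le> (\<Sum>m\<in>M. \<bar>b\<bar>)" for y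
    unfolding H_def by (intro order.trans[OF sum_abs] sum_mono hb)
  have H0: "(\<Sum>\<^sub>\<infinity>m\<in>UNIV. h (real_vec m)) = H 0"
  proof -
    have "(\<Sum>\<^sub>\<infinity>m\<in>UNIV. h (real_vec m)) = (\<Sum>\<^sub>\<infinity>m\<in>M. h (real_vec m))"
    proof (rule infsum_cong_neutral)
      fix m :: "int ^ 'n" assume "m \<in> UNIV - M"
      then obtain i where "\<bar>real_of_int (m $ i)\<bar> > R + 1/2"
        by (auto simp: M_def lattice_cube_def not_le)
      then show "h (real_vec m) = 0" using supp[of "real_vec m" i] by auto
    qed auto
    then show ?thesis by (simp add: H_def)
  qed
  obtain C where C: "\<And>N. N > 0 \<Longrightarrow> \<bar>(LINT y|lborel. indicator cell y * (H y * fejer_kernel N y)) - H 0\<bar> \<le> \<epsilon> / 2 + C / real N"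
    using fejer_kernel_approximation[OF contH bddH, of "\<epsilon> / 2"] \<open>\<epsilon> > 0\<close> by auto
  obtain N0 :: nat where N0: "real N0 > 2 * C / \<epsilon>" using reals_Archimedean2 by blast
  \<comment> \<open>\<open>Suc\<close> makes \<open>N\<close> positive even when \<open>C\<close> is
    not.\<close>
  define N where "N = Suc N0"
  have N: "N > 0" "real N > 2 * C / \<epsilon>" using N0 by (auto simp: N_def)
  have CN: "C / real N \<le> \<epsilon> / 2"
    using N \<open>\<epsilon> > 0\<close> by (simp add: field_simps)
  let ?K = "fejer_kernel N :: real ^ 'n \<Rightarrow> real"
  let ?J = "fejer_index N :: (int ^ 'n) set"
  have inthK: "integrable lborel (\<lambda>y. h y * ?K y)"
  proof (rule integrable_of_realD)
    have "integrable lborel (\<lambda>y. h y *\<^sub>R complex_of_real (?K y))"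
      by (intro inth continuous_intros continuous_on_fejer_kernel)
    then show "integrable lborel (\<lambda>y. complex_of_real (h y * ?K y))" by (simp add: scaleR_conv_of_real)
  qed
  have cover: "\<exists>m\<in>M. y - real_vec m \<in> cell" if "h y * ?K y \<noteq> 0" for y
    unfolding M_def using supp[of y] that by (intro exists_cell_translate) auto
  note split = integral_split_cells[OF inthK \<open>finite M\<close> cover]
  have eq1: "(LINT y|lborel. h y * ?K y) = (LINT y|lborel. indicator cell y * (H y * ?K y))"
  proof -
    have "(LINT y|lborel. indicator cell y * (H y * ?K y))
       = (LINT y|lborel. (\<Sum>m\<in>M. indicator cell y * (h (real_vec m + y) * ?K (real_vec m + y))))"
      by (simp add: H_def sum_distrib_left sum_distrib_right fejer_kernel_periodic)
    also have "\<dots> = (\<Sum>m\<in>M. LINT y|lborel. indicator cell y * (h (real_vec m + y) * ?K (real_vec m + y)))"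
      by (rule Bochner_Integration.integral_sum) (use split(1) in auto)
    finally show ?thesis using split(2) by simp
  qed
  let ?D = "of_nat N ^ CARD('n) :: complex"
  have eq2: "complex_of_real (LINT y|lborel. h y * ?K y) = (\<Sum>j\<in>?J. \<Sum>l\<in>?J. (1 / ?D) * c (j - l))"
  proof -
    have "complex_of_real (LINT y|lborel. h y * ?K y) = (LINT y|lborel. complex_of_real (h y * ?K y))"
      by (rule integral_of_real[OF inthK, symmetric])
    also have "\<dots> = (LINT y|lborel. (\<Sum>j\<in>?J. \<Sum>l\<in>?J. (1 / ?D) * (h y *\<^sub>R ee (real_vec (j - l) \<bullet> y))))"
      unfolding of_real_mult fejer_kernel_expand
      by (simp add: sum_divide_distrib sum_distrib_left scaleR_conv_of_real del: real_vec_simps)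
    also have "\<dots> = (\<Sum>j\<in>?J. \<Sum>l\<in>?J. (1 / ?D) * c (j - l))"
    proof (intro has_bochner_integral_integral_eq has_bochner_integral_sum has_bochner_integral_mult_right)
      fix j l
      show "has_bochner_integral lborel (\<lambda>y. h y *\<^sub>R ee (real_vec (j - l) \<bullet> y)) (c (j - l))"
        unfolding has_bochner_integral_iff c_def
        by (intro conjI inth refl continuous_intros)
    qed
    finally show ?thesis .
  qed
  have "complex_of_real (LINT y|lborel. h y * ?K y) - c 0
     = (\<Sum>j\<in>?J. (1 / ?D) * (\<Sum>l\<in>?J - {j}. c (j - l)))"
  proof -
    \<comment> \<open>The box has as many indices as the normalizing factor says, so the diagonal
      terms average to \<open>c 0\<close> without error.\<close>
    have "c 0 = (\<Sum>j\<in>?J. (1 / ?D) * c 0)" using N by (simp add: card_fejer_index)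
    moreover have "(\<Sum>l\<in>?J. (1 / ?D) * c (j - l)) = (1 / ?D) * c 0 + (1 / ?D) * (\<Sum>l\<in>?J - {j}. c (j - l))"
      if "j \<in> ?J" for j
      using that by (subst sum.remove[of _ j]) (auto simp: sum_distrib_left)
    ultimately show ?thesis
      unfolding eq2 by (simp add: sum.distrib)
  qed
  also have "cmod \<dots> \<le> (\<Sum>j\<in>?J. (1 / real N ^ CARD('n)) * A)"
  proof (rule order.trans[OF norm_sum], rule sum_mono)
    fix j assume "j \<in> ?J"
    have "cmod (\<Sum>l\<in>?J - {j}. c (j - l)) \<le> (\<Sum>l\<in>?J - {j}. cmod (c (j - l)))" by (rule norm_sum)
    also have "\<dots> = (\<Sum>k\<in>(\<lambda>l. j - l) ` (?J - {j}). cmod (c k))"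
      by (subst sum.reindex) (auto simp: inj_on_def)
    also have "\<dots> \<le> A" unfolding c_def by (rule bound) auto
    finally show "cmod ((1 / ?D) * (\<Sum>l\<in>?J - {j}. c (j - l))) \<le> (1 / real N ^ CARD('n)) * A"
      unfolding norm_mult by (intro mult_mono) (auto simp: norm_divide norm_power)
  qed
  also have "\<dots> = A" using N by (simp add: card_fejer_index)
  finally have "\<bar>(LINT y|lborel. h y * ?K y) - (LINT y|lborel. h y)\<bar> \<le> A"
    unfolding c0 of_real_diff[symmetric] norm_of_real .
  then show "\<bar>(\<Sum>\<^sub>\<infinity>m\<in>UNIV. h (real_vec m)) - (LINT y|lborel. h y)\<bar> \<le> A + \<epsilon>"
    using C[OF N(1)] CN unfolding H0 eq1 by linarith
qed


subsection \<open>A large sieve inequality\<close>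

text \<open>Substituting \<open>y = A *v x\<close> moves the integral to the image of
  \<open>\<Omega>\<close>, which lies in the union of \<open>card M\<close> translates of the cell.
  By periodicity each translate contributes at most one full period, whose value is given by
  Parseval's identity.\<close>

lemma integral_trig_poly_matrix_le:
  fixes A :: "real ^ 'n ^ 'n"
  assumes det: "det A \<noteq> 0" and "compact \<Omega>" and "finite K" and "finite M"
    and cover: "\<And>x. x \<in> \<Omega> \<Longrightarrow> \<exists>m\<in>M. A *v x - real_vec m \<in> cell"
  shows "integrable lborel (\<lambda>x. indicator \<Omega> x * (cmod (trig_poly K a (A *v x)))\<^sup>2)"
    and "\<bar>det A\<bar> * (LINT x|lborel. indicator \<Omega> x * (cmod (trig_poly K a (A *v x)))\<^sup>2)
      \<le> real (card M) * (\<Sum>k\<in>K. (cmod (a k))\<^sup>2)"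
proof -
  let ?\<Omega>' = "(*v) A ` \<Omega>"
  define G where "G y = indicator ?\<Omega>' y * (cmod (trig_poly K a y))\<^sup>2" for y
  have comp: "compact ?\<Omega>'"
    using \<open>compact \<Omega>\<close>
    by (intro compact_continuous_image linear_continuous_on matrix_vector_mul_bounded_linear)
  then have [measurable]: "?\<Omega>' \<in> sets borel" by (rule borel_compact)
  have [measurable]: "G \<in> borel_measurable borel" unfolding G_def by measurable
  have inj: "A *v x = A *v y \<longleftrightarrow> x = y" for x y
    using det by (meson inj_matrix_vector_mult invertible_det_nz injD)
  have GA: "G (A *v x) = indicator \<Omega> x * (cmod (trig_poly K a (A *v x)))\<^sup>2" for x
    by (auto simp: G_def indicator_def image_iff inj)
  have "continuous_on ?\<Omega>' (\<lambda>y. (cmod (trig_poly K a y))\<^sup>2)"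
    by (intro continuous_intros continuous_on_trig_poly)
  from borel_integrable_compact[OF comp this] have intG: "integrable lborel G"
    by (simp add: G_def[abs_def])
  then show "integrable lborel (\<lambda>x. indicator \<Omega> x * (cmod (trig_poly K a (A *v x)))\<^sup>2)"
    using integral_matrix(1)[OF det, of G] by (simp add: GA)
  have coverG: "\<exists>m\<in>M. y - real_vec m \<in> cell" if "G y \<noteq> 0" for y
    using that cover by (auto simp: G_def indicator_def split: if_splits)
  note split = integral_split_cells[OF intG \<open>finite M\<close> coverG]
  have "\<bar>det A\<bar> * (LINT x|lborel. indicator \<Omega> x * (cmod (trig_poly K a (A *v x)))\<^sup>2) = (LINT y|lborel. G y)"
    using integral_matrix(2)[OF det, of G] by (simp add: GA)
  also have "\<dots> = (\<Sum>m\<in>M. LINT y|lborel. indicator cell y * G (real_vec m + y))"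
    by (rule split(2))
  also have "\<dots> \<le> (\<Sum>m\<in>M. LINT y|lborel. indicator cell y * (cmod (trig_poly K a y))\<^sup>2)"
    using integral_trig_poly_square(1)[OF \<open>finite K\<close>, of a] split(1)
    by (intro sum_mono integral_mono) (auto simp: G_def trig_poly_periodic indicator_def)
  also have "\<dots> = real (card M) * (\<Sum>k\<in>K. (cmod (a k))\<^sup>2)"
    by (simp add: integral_trig_poly_square(2)[OF \<open>finite K\<close>])
  finally show "\<bar>det A\<bar> * (LINT x|lborel. indicator \<Omega> x * (cmod (trig_poly K a (A *v x)))\<^sup>2)
      \<le> real (card M) * (\<Sum>k\<in>K. (cmod (a k))\<^sup>2)" .
qed

text \<open>Let \<open>X\<close> be the left-hand side. Taking the conjugated coefficients of
  \<open>g\<close> as coefficients of a trigonometric polynomial \<open>T\<close> makes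
  \<open>X\<close> the integral of \<open>g\<close> times \<open>T\<close> over
  \<open>\<Omega>\<close>, while the previous bound gives at most \<open>C * X\<close> for the
  integral of the squared modulus of \<open>T\<close>. A bound of \<open>X\<close> in terms of
  itself results.\<close>

lemma large_sieve:
  fixes A :: "real ^ 'n ^ 'n" and g :: "real ^ 'n \<Rightarrow> real"
  assumes det: "det A \<noteq> 0" and "compact \<Omega>" and "finite K" and "finite M"
    and cover: "\<And>x. x \<in> \<Omega> \<Longrightarrow> \<exists>m\<in>M. A *v x - real_vec m \<in> cell"
    and [measurable]: "g \<in> borel_measurable borel"
    and g2: "integrable lborel (\<lambda>x. indicator \<Omega> x * (g x)\<^sup>2)"
    and "C > 0" and C: "real (card M) \<le> C * \<bar>det A\<bar>"
  shows "(\<Sum>k\<in>K. (cmod (LINT x|lborel. (indicator \<Omega> x * g x) *\<^sub>R ee (real_vec k \<bullet> (A *v x))))\<^sup>2)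
     \<le> C * (LINT x|lborel. indicator \<Omega> x * (g x)\<^sup>2)"
proof -
  have [measurable]: "\<Omega> \<in> sets borel" using \<open>compact \<Omega>\<close> by (rule borel_compact)
  \<comment> \<open>On a set of finite measure a square integrable function is integrable;
    \<open>1 + (g x)\<^sup>2\<close> serves as the majorant.\<close>
  have "integrable lborel (\<lambda>x. indicator \<Omega> x + indicator \<Omega> x * (g x)\<^sup>2 :: real)"
    using g2 emeasure_compact_finite[OF \<open>compact \<Omega>\<close>] by (intro Bochner_Integration.integrable_add) auto
  then have g1: "integrable lborel (\<lambda>x. indicator \<Omega> x * g x)"
  proof (rule Bochner_Integration.integrable_bound)
    have "\<bar>g x\<bar> \<le> 1 + (g x)\<^sup>2" for x
    proof -
      have "2 * \<bar>g x\<bar> \<le> 1 + (g x)\<^sup>2" using sum_squares_bound[of 1 "\<bar>g x\<bar>"] by simp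
      then show ?thesis using abs_ge_zero[of "g x"] by linarith
    qed
    then show "AE x in lborel. norm (indicator \<Omega> x * g x) \<le> norm (indicator \<Omega> x + indicator \<Omega> x * (g x)\<^sup>2 :: real)"
      by (intro AE_I2) (auto simp: indicator_def)
  qed auto
  have ig: "integrable lborel (\<lambda>x. (indicator \<Omega> x * g x) *\<^sub>R ee (real_vec k \<bullet> (A *v x)))" for k
    by (rule Bochner_Integration.integrable_bound[OF g1]) auto
  define b where "b k = (LINT x|lborel. (indicator \<Omega> x * g x) *\<^sub>R ee (real_vec k \<bullet> (A *v x)))" for k
  define X where "X = (\<Sum>k\<in>K. (cmod (b k))\<^sup>2)"
  define T where "T x = trig_poly K (\<lambda>k. cnj (b k)) (A *v x)" for x
  define G where "G = (LINT x|lborel. indicator \<Omega> x * (g x)\<^sup>2)"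
  have T2: "integrable lborel (\<lambda>x. indicator \<Omega> x * (cmod (T x))\<^sup>2)"
    and T2': "\<bar>det A\<bar> * (LINT x|lborel. indicator \<Omega> x * (cmod (T x))\<^sup>2) \<le> real (card M) * X"
    unfolding T_def X_def
    using integral_trig_poly_matrix_le[OF det \<open>compact \<Omega>\<close> \<open>finite K\<close> \<open>finite M\<close> cover, of "\<lambda>k. cnj (b k)"] by simp_all
  have "X \<ge> 0" unfolding X_def by (intro sum_nonneg) auto
  have T2'': "(LINT x|lborel. indicator \<Omega> x * (cmod (T x))\<^sup>2) \<le> C * X"
  proof -
    have "\<bar>det A\<bar> * (LINT x|lborel. indicator \<Omega> x * (cmod (T x))\<^sup>2) \<le> (C * \<bar>det A\<bar>) * X"
      using T2' mult_right_mono[OF C \<open>X \<ge> 0\<close>] by linarith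
    then have "\<bar>det A\<bar> * (LINT x|lborel. indicator \<Omega> x * (cmod (T x))\<^sup>2) \<le> \<bar>det A\<bar> * (C * X)"
      by (simp add: mult_ac)
    then show ?thesis using det by simp
  qed
  have hb: "has_bochner_integral lborel (\<lambda>x. (indicator \<Omega> x * g x) *\<^sub>R T x) (\<Sum>k\<in>K. cnj (b k) * b k)"
  proof -
    have "(\<lambda>x. (indicator \<Omega> x * g x) *\<^sub>R T x)
        = (\<lambda>x. \<Sum>k\<in>K. cnj (b k) * ((indicator \<Omega> x * g x) *\<^sub>R ee (real_vec k \<bullet> (A *v x))))"
      by (simp add: T_def trig_poly_def scaleR_sum_right)
    then show ?thesis
      by (simp only:) (intro has_bochner_integral_sum has_bochner_integral_mult_right,
        auto simp only: has_bochner_integral_iff ig b_def)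
  qed
  have "complex_of_real X = (LINT x|lborel. (indicator \<Omega> x * g x) *\<^sub>R T x)"
    using hb by (simp only: has_bochner_integral_iff X_def of_real_sum complex_norm_square mult.commute)
  then have "X = cmod (LINT x|lborel. (indicator \<Omega> x * g x) *\<^sub>R T x)"
    using \<open>X \<ge> 0\<close> by (metis abs_of_nonneg norm_of_real)
  also have "\<dots> \<le> (LINT x|lborel. cmod ((indicator \<Omega> x * g x) *\<^sub>R T x))"
    by (rule integral_norm_bound)
  also have "\<dots> \<le> (LINT x|lborel. (C / 2) * (indicator \<Omega> x * (g x)\<^sup>2) + (1 / (2 * C)) * (indicator \<Omega> x * (cmod (T x))\<^sup>2))"
  proof (rule integral_mono)
    show "integrable lborel (\<lambda>x. cmod ((indicator \<Omega> x * g x) *\<^sub>R T x))"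
      using hb integrable_norm unfolding has_bochner_integral_iff by blast
    show "integrable lborel (\<lambda>x. (C / 2) * (indicator \<Omega> x * (g x)\<^sup>2) + (1 / (2 * C)) * (indicator \<Omega> x * (cmod (T x))\<^sup>2))"
      by (intro Bochner_Integration.integrable_add integrable_mult_right g2 T2)
    fix x
    \<comment> \<open>The arithmetic-geometric mean inequality, weighted so that the term with
      \<open>T\<close> integrates to at most \<open>X / 2\<close> and can be absorbed by the
      left-hand side.\<close>
    have "0 \<le> (C * \<bar>g x\<bar> - cmod (T x))\<^sup>2" by simp
    then have "2 * C * (\<bar>g x\<bar> * cmod (T x)) \<le> C\<^sup>2 * (g x)\<^sup>2 + (cmod (T x))\<^sup>2"
      by (simp add: power2_diff power_mult_distrib algebra_simps)
    then have "\<bar>g x\<bar> * cmod (T x) \<le> (C\<^sup>2 * (g x)\<^sup>2 + (cmod (T x))\<^sup>2) / (2 * C)"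
      using \<open>C > 0\<close> by (simp add: field_simps)
    also have "\<dots> = (C / 2) * (g x)\<^sup>2 + (1 / (2 * C)) * (cmod (T x))\<^sup>2"
      using \<open>C > 0\<close> by (simp add: field_simps power2_eq_square)
    finally show "cmod ((indicator \<Omega> x * g x) *\<^sub>R T x)
       \<le> (C / 2) * (indicator \<Omega> x * (g x)\<^sup>2) + (1 / (2 * C)) * (indicator \<Omega> x * (cmod (T x))\<^sup>2)"
      by (simp add: indicator_def)
  qed
  also have "\<dots> = (C / 2) * G + (1 / (2 * C)) * (LINT x|lborel. indicator \<Omega> x * (cmod (T x))\<^sup>2)"
    unfolding G_def
    by (intro has_bochner_integral_integral_eq has_bochner_integral_add has_bochner_integral_mult_right)
       (use g2 T2 in \<open>auto simp only: has_bochner_integral_iff\<close>)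
  also have "\<dots> \<le> (C / 2) * G + (1 / (2 * C)) * (C * X)"
    using T2'' \<open>C > 0\<close> by (intro add_left_mono mult_left_mono) auto
  also have "\<dots> = C * G / 2 + X / 2" using \<open>C > 0\<close> by (simp add: field_simps)
  finally have "X \<le> C * G" by simp
  then show ?thesis by (simp add: X_def G_def b_def)
qed


subsection \<open>Smooth cutoff functions\<close>

text \<open>\<open>flat 0\<close> is the classical smooth function that vanishes on the negative
  axis. The powers of \<open>inverse x\<close> are included because they appear under
  differentiation; with them the linear span of the family is closed under derivatives.\<close>

definition flat :: "nat \<Rightarrow> real \<Rightarrow> real" where
  "flat k x = (if x \<le> 0 then 0 else inverse x ^ k * exp (- inverse x))"

lemma flat_tendsto_0: "(flat k \<longlongrightarrow> 0) (at_right 0)"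
proof -
  have "((\<lambda>x :: real. x ^ k / exp x) \<longlongrightarrow> 0) at_top" by (rule tendsto_power_div_exp_0)
  from filterlim_compose[OF this filterlim_inverse_at_top_right]
  have "((\<lambda>x :: real. inverse x ^ k / exp (inverse x)) \<longlongrightarrow> 0) (at_right 0)" .
  then show ?thesis
    by (rule Lim_transform_eventually)
       (auto simp: eventually_at_filter flat_def exp_minus divide_inverse)
qed

text \<open>Only the origin needs an argument: the difference quotient of \<open>flat k\<close> from
  the right is \<open>flat (k + 1)\<close>, which tends to 0 since the exponential beats every
  power.\<close>

lemma flat_has_derivative:
  "(flat k has_real_derivative flat (k + 2) x - real k * flat (k + 1) x) (at x)"
proof -
  consider "x < 0" | "x = 0" | "x > 0" by linarith
  then show ?thesis
  proof cases
    case 1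
    then have "eventually (\<lambda>y. y \<in> {..<0}) (nhds x)" by (intro eventually_nhds_in_open) auto
    then have "eventually (\<lambda>y. flat k y = 0) (nhds x)" by eventually_elim (simp add: flat_def)
    then have "(flat k has_real_derivative 0) (at x)"
      by (subst DERIV_cong_ev[OF refl _ refl]) auto
    then show ?thesis using 1 by (simp add: flat_def)
  next
    case 2
    have "((\<lambda>y. (flat k y - flat k 0) / (y - 0)) \<longlongrightarrow> 0) (at 0)"
    proof (rule filterlim_split_at)
      show "((\<lambda>y. (flat k y - flat k 0) / (y - 0)) \<longlongrightarrow> 0) (at_left 0)"
        by (rule Lim_transform_eventually[OF tendsto_const])
           (auto simp: eventually_at_filter flat_def)
      show "((\<lambda>y. (flat k y - flat k 0) / (y - 0)) \<longlongrightarrow> 0) (at_right 0)"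
        by (rule Lim_transform_eventually[OF flat_tendsto_0[of "k + 1"]])
           (auto simp: eventually_at_filter flat_def divide_inverse)
    qed
    then show ?thesis using 2 by (simp add: has_field_derivative_iff flat_def)
  next
    case 3
    then have ev: "eventually (\<lambda>y. y \<in> {0<..}) (nhds x)" by (intro eventually_nhds_in_open) auto
    have eq: "eventually (\<lambda>y. flat k y = inverse y ^ k * exp (- inverse y)) (nhds x)"
      using ev by eventually_elim (simp add: flat_def)
    have "((\<lambda>y. inverse y ^ k * exp (- inverse y)) has_real_derivative
        flat (k + 2) x - real k * flat (k + 1) x) (at x)"
    proof -
      have "((\<lambda>y. inverse y ^ k) has_real_derivative
          real k * (inverse x ^ (k - 1) * (- (inverse x * inverse x)))) (at x)"
        using 3 by (auto intro!: derivative_eq_intros simp: power2_eq_square)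
      also have "real k * (inverse x ^ (k - 1) * (- (inverse x * inverse x))) = - real k * inverse x ^ (k + 1)"
        by (cases k) (auto simp: algebra_simps)
      finally have 1: "((\<lambda>y. inverse y ^ k) has_real_derivative - real k * inverse x ^ (k + 1)) (at x)" .
      have 2: "((\<lambda>y. exp (- inverse y)) has_real_derivative exp (- inverse x) * (inverse x * inverse x)) (at x)"
        using 3 by (auto intro!: derivative_eq_intros simp: power2_eq_square)
      note DERIV_mult[OF 1 2]
      then show ?thesis using 3 by (simp add: flat_def algebra_simps)
    qed
    then show ?thesis by (subst DERIV_cong_ev[OF refl eq refl])
  qed
qed

text \<open>A class of functions that contains the derivatives of its members, so that membership
  already gives differentiability of every order. Phases in the \<open>cos\<close> rule let it cover
  its own derivatives, since differentiating a cosine advances its phase by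
  \<open>pi / 2\<close>.\<close>

inductive elementary :: "(real \<Rightarrow> real) \<Rightarrow> bool" where
  const: "elementary (\<lambda>_. c)"
| cos: "elementary (\<lambda>x. cos (a * x + b))"
| flat: "elementary (\<lambda>x. flat k (a * x + b))"
| add: "elementary f \<Longrightarrow> elementary g \<Longrightarrow> elementary (\<lambda>x. f x + g x)"
| mult: "elementary f \<Longrightarrow> elementary g \<Longrightarrow> elementary (\<lambda>x. f x * g x)"
| inverse: "elementary f \<Longrightarrow> (\<And>x. f x \<noteq> 0) \<Longrightarrow> elementary (\<lambda>x. inverse (f x))"

lemma elementary_has_derivative:
  "elementary f \<Longrightarrow> \<exists>g. elementary g \<and> (\<forall>x. (f has_real_derivative g x) (at x))"
proof (induction rule: elementary.induct)
  case (const c)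
  show ?case by (intro exI[of _ "\<lambda>_. 0"] conjI elementary.const) simp
next
  case (cos a b)
  have "((\<lambda>x. cos (a * x + b)) has_real_derivative a * cos (a * x + (b + pi / 2))) (at x)" for x
  proof -
    have "cos (a * x + (b + pi / 2)) = - sin (a * x + b)"
      by (simp add: add.assoc[symmetric] cos_add)
    then show ?thesis by (auto intro!: derivative_eq_intros)
  qed
  then show ?case
    by (intro exI[of _ "\<lambda>x. a * cos (a * x + (b + pi / 2))"] conjI elementary.intros allI)
next
  case (flat k a b)
  let ?g = "\<lambda>x. a * flat (k + 2) (a * x + b) + (- a * real k) * flat (k + 1) (a * x + b)"
  have "((\<lambda>x. flat k (a * x + b)) has_real_derivative ?g x) (at x)" for x
  proof -
    have "((\<lambda>x. a * x + b) has_real_derivative a) (at x)" by (auto intro!: derivative_eq_intros)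
    from DERIV_chain2[OF flat_has_derivative this] show ?thesis by (simp add: algebra_simps)
  qed
  then show ?case by (intro exI[of _ ?g] conjI elementary.intros allI)
next
  case (add f g)
  then obtain f' g' where "elementary f'" "elementary g'"
    "\<And>x. (f has_real_derivative f' x) (at x)" "\<And>x. (g has_real_derivative g' x) (at x)" by blast
  then show ?case
    by (intro exI[of _ "\<lambda>x. f' x + g' x"]) (auto intro!: elementary.intros derivative_eq_intros)
next
  case (mult f g)
  then obtain f' g' where "elementary f'" "elementary g'"
    "\<And>x. (f has_real_derivative f' x) (at x)" "\<And>x. (g has_real_derivative g' x) (at x)" by blast
  with mult.hyps show ?case
    by (intro exI[of _ "\<lambda>x. f' x * g x + g' x * f x"] conjI elementary.intros allI DERIV_mult) auto
next
  case (inverse f)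
  then obtain f' where "elementary f'" "\<And>x. (f has_real_derivative f' x) (at x)" by blast
  moreover from this inverse.hyps
  have "elementary (\<lambda>x. (-1) * ((inverse (f x) * f' x) * inverse (f x)))"
    by (intro elementary.intros) auto
  ultimately show ?case using inverse.hyps
    by (intro exI[of _ "\<lambda>x. (-1) * ((inverse (f x) * f' x) * inverse (f x))"])
       (auto intro!: derivative_eq_intros)
qed

lemma elementary_deriv:
  assumes "elementary f"
  shows "elementary (deriv f)" "(f has_real_derivative deriv f x) (at x)"
proof -
  obtain g where g: "elementary g" "\<And>x. (f has_real_derivative g x) (at x)"
    using elementary_has_derivative[OF assms] by blast
  moreover have "deriv f = g" using g(2) by (auto intro!: ext DERIV_imp_deriv)
  ultimately show "elementary (deriv f)" "(f has_real_derivative deriv f x) (at x)" by auto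
qed

lemma elementary_higher_deriv: "elementary f \<Longrightarrow> elementary ((deriv ^^ n) f)"
  by (induction n) (auto intro: elementary_deriv)

text \<open>Used to discard a cutoff factor where it is constantly 1. Derivatives see a whole
  neighbourhood, so equality on an open set is required.\<close>

lemma higher_deriv_cong_open:
  fixes f g :: "real \<Rightarrow> real"
  assumes "open U" "\<And>x. x \<in> U \<Longrightarrow> f x = g x" "x \<in> U"
  shows "(deriv ^^ n) f x = (deriv ^^ n) g x"
  using assms(3)
proof (induction n arbitrary: x)
  case (Suc n)
  have "eventually (\<lambda>y. y \<in> U) (nhds x)" using assms(1) Suc.prems by (rule eventually_nhds_in_open)
  then have "eventually (\<lambda>y. (deriv ^^ n) f y = (deriv ^^ n) g y) (nhds x)"
    by eventually_elim (rule Suc.IH)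
  then show ?case by (simp add: deriv_cong_ev)
qed (use assms in auto)

lemma higher_deriv_cos:
  "(deriv ^^ n) (\<lambda>x. cos (w * x + b)) = (\<lambda>x. w ^ n * cos (w * x + b + real n * (pi / 2)))"
proof (induction n)
  case (Suc n)
  have "((\<lambda>x. w ^ n * cos (w * x + b + real n * (pi / 2))) has_real_derivative
     w ^ Suc n * cos (w * x + b + real (Suc n) * (pi / 2))) (at x)" for x
  proof -
    have "cos (w * x + b + real (Suc n) * (pi / 2)) = cos ((w * x + b + real n * (pi / 2)) + pi / 2)"
      by (simp add: algebra_simps add_divide_distrib)
    also have "\<dots> = - sin (w * x + b + real n * (pi / 2))"
      by (simp only: cos_add cos_pi_half sin_pi_half)
    finally show ?thesis by (auto intro!: derivative_eq_intros)
  qed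
  then show ?case by (auto simp: Suc.IH intro!: ext DERIV_imp_deriv)
qed simp

definition smooth_step :: "real \<Rightarrow> real" where
  "smooth_step x = flat 0 x * inverse (flat 0 x + flat 0 (1 - x))"

text \<open>The numbers \<open>x\<close> and \<open>1 - x\<close> cannot both be
  nonpositive.\<close>

lemma smooth_step_denominator: "flat 0 x + flat 0 (1 - x) > 0"
  by (auto simp: flat_def add_pos_pos)

lemma smooth_step:
  "0 \<le> smooth_step x" "smooth_step x \<le> 1" "x \<le> 0 \<Longrightarrow> smooth_step x = 0" "x \<ge> 1 \<Longrightarrow> smooth_step x = 1"
proof -
  have nn: "flat 0 y \<ge> 0" for y by (simp add: flat_def)
  show "0 \<le> smooth_step x" "smooth_step x \<le> 1"
    using nn[of x] nn[of "1 - x"] smooth_step_denominator[of x]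
    by (auto simp: smooth_step_def divide_inverse[symmetric] divide_le_eq_1)
  show "x \<le> 0 \<Longrightarrow> smooth_step x = 0" by (simp add: smooth_step_def flat_def)
  show "x \<ge> 1 \<Longrightarrow> smooth_step x = 1"
    using smooth_step_denominator[of x] by (simp add: smooth_step_def flat_def)
qed

lemma elementary_smooth_step: "elementary (\<lambda>x. smooth_step (a * x + b))"
proof -
  have "elementary (\<lambda>x. flat 0 (a * x + b) * inverse (flat 0 (a * x + b) + flat 0 ((- a) * x + (1 - b))))"
  proof (intro elementary.intros)
    show "flat 0 (a * x + b) + flat 0 ((- a) * x + (1 - b)) \<noteq> 0" for x
      using smooth_step_denominator[of "a * x + b"] by (simp add: algebra_simps)
  qed
  then show ?thesis by (simp add: smooth_step_def algebra_simps)
qed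

text \<open>For positive \<open>\<epsilon>\<close>, the offset 2 places the ramps on the intervals
  from \<open>- 2 * \<epsilon>\<close> to \<open>- \<epsilon>\<close> and from
  \<open>1 + \<epsilon>\<close> to \<open>1 + 2 * \<epsilon>\<close>. The function is thus 1 on a
  neighbourhood of the unit interval, and its derivatives do not disturb the product rule
  there.\<close>

definition cutoff :: "real \<Rightarrow> real \<Rightarrow> real" where
  "cutoff \<epsilon> x = smooth_step (2 + x / \<epsilon>) * smooth_step (2 + (1 - x) / \<epsilon>)"

lemma cutoff:
  assumes "\<epsilon> > 0"
  shows "\<bar>cutoff \<epsilon> x\<bar> \<le> 1" "x \<in> {- \<epsilon><..<1 + \<epsilon>} \<Longrightarrow> cutoff \<epsilon> x = 1"
    "x < - (2 * \<epsilon>) \<or> x > 1 + 2 * \<epsilon> \<Longrightarrow> cutoff \<epsilon> x = 0"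
    "elementary (cutoff \<epsilon>)"
proof -
  show "\<bar>cutoff \<epsilon> x\<bar> \<le> 1"
    using smooth_step by (auto simp: cutoff_def abs_mult intro!: mult_le_one)
  show "cutoff \<epsilon> x = 1" if "x \<in> {- \<epsilon><..<1 + \<epsilon>}"
    using that assms smooth_step(4) by (auto simp: cutoff_def field_simps)
  show "cutoff \<epsilon> x = 0" if "x < - (2 * \<epsilon>) \<or> x > 1 + 2 * \<epsilon>"
    using that assms smooth_step(3)[of "2 + x / \<epsilon>"] smooth_step(3)[of "2 + (1 - x) / \<epsilon>"]
    by (auto simp: cutoff_def field_simps)
  have "elementary (\<lambda>x. smooth_step ((1 / \<epsilon>) * x + 2) * smooth_step ((- (1 / \<epsilon>)) * x + (2 + 1 / \<epsilon>)))"
    by (intro elementary.mult elementary_smooth_step)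
  moreover have "cutoff \<epsilon> = (\<lambda>x. smooth_step ((1 / \<epsilon>) * x + 2) * smooth_step ((- (1 / \<epsilon>)) * x + (2 + 1 / \<epsilon>)))"
    by (auto simp: cutoff_def fun_eq_iff diff_divide_distrib algebra_simps)
  ultimately show "elementary (cutoff \<epsilon>)" by simp
qed

section \<open>Products of one-variable functions as test functions\<close>

lemma has_derivative_prod_vec:
  fixes \<psi> :: "'n::finite \<Rightarrow> real \<Rightarrow> real"
  assumes "\<And>j t. \<psi> j differentiable (at t)"
  shows "(\<lambda>x :: real ^ 'n. \<Prod>j\<in>UNIV. \<psi> j (x $ j)) differentiable (at x)"
proof -
  have "(\<lambda>x :: real ^ 'n. \<psi> j (x $ j)) differentiable (at x)" for j
  proof -
    obtain D where D: "(\<psi> j has_derivative D) (at (x $ j))"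
      using assms[of j "x $ j"] by (auto simp: differentiable_def)
    have "((\<lambda>x :: real ^ 'n. x $ j) has_derivative (\<lambda>x. x $ j)) (at x)"
      by (rule bounded_linear_imp_has_derivative[OF bounded_linear_vec_nth])
    from has_derivative_compose[OF this D] show ?thesis by (auto simp: differentiable_def)
  qed
  then obtain D where D: "\<And>j. ((\<lambda>x :: real ^ 'n. \<psi> j (x $ j)) has_derivative D j) (at x)"
    unfolding differentiable_def by metis
  show ?thesis
    unfolding differentiable_def
    using has_derivative_prod[of UNIV "\<lambda>j x. \<psi> j (x $ j)" D x UNIV] D by blast
qed

lemma partial_deriv_prod_vec:
  fixes \<psi> :: "'n::finite \<Rightarrow> real \<Rightarrow> real"
  assumes "\<And>j t. (\<psi> j has_real_derivative deriv (\<psi> j) t) (at t)"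
  shows "partial_deriv i (\<lambda>x :: real ^ 'n. \<Prod>j\<in>UNIV. \<psi> j (x $ j))
     = (\<lambda>x. \<Prod>j\<in>UNIV. (if j = i then deriv (\<psi> j) else \<psi> j) (x $ j))"
proof
  fix x :: "real ^ 'n"
  let ?c = "\<Prod>j\<in>UNIV - {i}. \<psi> j (x $ j)"
  have eq: "(\<Prod>j\<in>UNIV. \<psi> j ((x + t *\<^sub>R axis i 1) $ j)) = \<psi> i (x $ i + t) * ?c" for t
  proof -
    have "(\<Prod>j\<in>UNIV - {i}. \<psi> j ((x + t *\<^sub>R axis i 1) $ j)) = ?c"
      by (rule prod.cong) (auto simp: axis_def)
    then show ?thesis by (subst prod.remove[of _ i]) (auto simp: axis_def)
  qed
  have "((\<lambda>t. \<psi> i (x $ i + t)) has_real_derivative deriv (\<psi> i) (x $ i)) (at 0)"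
    using assms[of i "x $ i"] by (simp add: DERIV_shift[of _ _ _ "x $ i"] add.commute flip: DERIV_shift)
  then have "((\<lambda>t. \<psi> i (x $ i + t) * ?c) has_real_derivative deriv (\<psi> i) (x $ i) * ?c) (at 0)"
    by (rule DERIV_cmult_right)
  then have "partial_deriv i (\<lambda>x :: real ^ 'n. \<Prod>j\<in>UNIV. \<psi> j (x $ j)) x = deriv (\<psi> i) (x $ i) * ?c"
    unfolding partial_deriv_def eq by (rule DERIV_imp_deriv)
  also have "?c = (\<Prod>j\<in>UNIV - {i}. (if j = i then deriv (\<psi> j) else \<psi> j) (x $ j))"
    by (rule prod.cong) auto
  also have "deriv (\<psi> i) (x $ i) * \<dots> = (\<Prod>j\<in>UNIV. (if j = i then deriv (\<psi> j) else \<psi> j) (x $ j))"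
    by (subst (2) prod.remove[of _ i]) auto
  finally show "partial_deriv i (\<lambda>x :: real ^ 'n. \<Prod>j\<in>UNIV. \<psi> j (x $ j)) x
     = (\<Prod>j\<in>UNIV. (if j = i then deriv (\<psi> j) else \<psi> j) (x $ j))" .
qed

text \<open>Each partial derivative differentiates one factor once, so for products only the number
  of occurrences of each direction matters and the order of differentiation disappears at
  once.\<close>

lemma partial_derivs_prod_vec:
  fixes \<psi> :: "'n::finite \<Rightarrow> real \<Rightarrow> real"
  assumes "\<And>j. elementary (\<psi> j)"
  shows "partial_derivs is (\<lambda>x :: real ^ 'n. \<Prod>j\<in>UNIV. \<psi> j (x $ j))
     = (\<lambda>x. \<Prod>j\<in>UNIV. (deriv ^^ count_list is j) (\<psi> j) (x $ j))"
proof (induction "is")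
  case (Cons i "is")
  show ?case
    unfolding partial_derivs.simps Cons.IH
    by (subst partial_deriv_prod_vec)
       (auto intro!: elementary_deriv(2) elementary_higher_deriv assms prod.cong)
qed simp

lemma test_function_prod_vec:
  fixes \<psi> :: "'n::finite \<Rightarrow> real \<Rightarrow> real"
  assumes "\<And>j. elementary (\<psi> j)" and supp: "\<And>j t. \<psi> j t \<noteq> 0 \<Longrightarrow> t \<in> {a..b}"
  shows "test_function (\<lambda>x :: real ^ 'n. \<Prod>j\<in>UNIV. \<psi> j (x $ j))"
  unfolding test_function_def
proof (intro conjI allI)
  fix "is" and x :: "real ^ 'n"
  show "partial_derivs is (\<lambda>x :: real ^ 'n. \<Prod>j\<in>UNIV. \<psi> j (x $ j)) differentiable (at x)"
    unfolding partial_derivs_prod_vec[OF assms(1)]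
    using elementary_deriv(2)[OF elementary_higher_deriv[OF assms(1)]]
    by (intro has_derivative_prod_vec) (auto simp: real_differentiable_def)
  have "{x :: real ^ 'n. (\<Prod>j\<in>UNIV. \<psi> j (x $ j)) \<noteq> 0} \<subseteq> cbox (\<chi> j. a) (\<chi> j. b)"
  proof
    fix x :: "real ^ 'n" assume "x \<in> {x. (\<Prod>j\<in>UNIV. \<psi> j (x $ j)) \<noteq> 0}"
    then have "\<psi> j (x $ j) \<noteq> 0" for j by simp
    then show "x \<in> cbox (\<chi> j. a) (\<chi> j. b)" using supp by (auto simp: mem_box_cart)
  qed
  then have "closure {x :: real ^ 'n. (\<Prod>j\<in>UNIV. \<psi> j (x $ j)) \<noteq> 0} \<subseteq> cbox (\<chi> j. a) (\<chi> j. b)"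
    by (intro closure_minimal) auto
  then show "compact (closure {x :: real ^ 'n. (\<Prod>j\<in>UNIV. \<psi> j (x $ j)) \<noteq> 0})"
    by (meson bounded_cbox bounded_subset closed_closure compact_eq_bounded_closed)
qed


subsection \<open>Fourier transforms of weak derivatives\<close>

text \<open>\<open>has_weak_deriv\<close> speaks about every list with the prescribed counts. At
  least one such list must exist before an equation can be drawn from it.\<close>

lemma exists_list_count:
  fixes \<alpha> :: "'n::finite \<Rightarrow> nat"
  shows "\<exists>is. \<forall>i. count_list is i = \<alpha> i"
proof -
  obtain xs :: "'n list" where xs: "set xs = UNIV" "distinct xs"
    using finite_distinct_list[of "UNIV :: 'n set"] by auto
  have rep: "count_list (replicate n a) i = (if i = a then n else 0)" for n and a i :: 'n
    by (induction n) auto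
  have "count_list (concat (map (\<lambda>i. replicate (\<alpha> i) i) ys)) i = (if i \<in> set ys then \<alpha> i else 0)"
    if "distinct ys" for ys i
    using that by (induction ys) (auto simp: rep)
  from this[OF xs(2)] show ?thesis using xs(1) by (intro exI allI) simp
qed

text \<open>On the closed unit interval, endpoints included, the sequence is constantly 1. Elsewhere
  it is 0 once \<open>2 / Suc n\<close> falls below the distance of \<open>t\<close> to the
  interval.\<close>

lemma cutoff_tendsto: "(\<lambda>n. cutoff (1 / real (Suc n)) t) \<longlonglongrightarrow> indicator {0..1} t"
proof (cases "t \<in> {0..1}")
  case True
  then have "cutoff (1 / real (Suc n)) t = 1" for n
    by (intro cutoff(2)) (auto simp: add_pos_nonneg intro: less_le_trans[of _ 0] le_less_trans[of _ 1])
  then show ?thesis using True by simp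
next
  case False
  define d where "d = (if t < 0 then - t else t - 1)"
  have "d > 0" using False by (auto simp: d_def)
  have "(\<lambda>n. 2 * inverse (real (Suc n))) \<longlonglongrightarrow> 2 * 0"
    by (intro tendsto_intros LIMSEQ_inverse_real_of_nat)
  from order_tendstoD(2)[OF this, of d]
  have "\<forall>\<^sub>F n in sequentially. 2 * inverse (real (Suc n)) < d"
    using \<open>d > 0\<close> by simp
  then have "\<forall>\<^sub>F n in sequentially. cutoff (1 / real (Suc n)) t = 0"
  proof eventually_elim
    case (elim n)
    then have "t < - (2 * (1 / real (Suc n))) \<or> t > 1 + 2 * (1 / real (Suc n))"
      using False by (auto simp: d_def inverse_eq_divide split: if_splits)
    then show ?case by (intro cutoff(3)) auto
  qed
  then show ?thesis using False by (simp add: tendsto_eventually)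
qed

lemma indicator_unit_cube: "indicator (cbox 0 (1 :: real ^ 'n)) x = (\<Prod>j\<in>UNIV. indicator {0..1} (x $ j) :: real)"
proof (cases "x \<in> cbox 0 (1 :: real ^ 'n)")
  case True
  then show ?thesis by (auto simp: mem_box_cart intro!: prod.neutral[symmetric])
next
  case False
  then obtain j where "\<not> (0 \<le> x $ j \<and> x $ j \<le> 1)" by (auto simp: mem_box_cart)
  then have "(\<Prod>j\<in>UNIV. indicator {0..1} (x $ j) :: real) = 0"
    by (intro prod_zero bexI[of _ j]) auto
  with False show ?thesis by simp
qed

text \<open>The cosine product is multiplied by cutoffs at scale \<open>1 / Suc n\<close> to become
  a test function. Since \<open>f\<close> lives on the cube, near which the cutoffs are 1, the side
  with \<open>f\<close> is the same for every \<open>n\<close>. On the other side dominated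
  convergence replaces the cutoffs by the indicator of the cube.\<close>

lemma weak_deriv_cos:
  fixes f g :: "real ^ 'n \<Rightarrow> real"
  assumes weak: "has_weak_deriv \<alpha> f g" and supp: "\<And>x. x \<notin> cbox 0 1 \<Longrightarrow> f x = 0"
  shows "(LINT x|lborel. f x * (\<Prod>j\<in>UNIV. w j ^ \<alpha> j * cos (w j * (x $ j) + (real (\<alpha> j) * (pi / 2) + b j))))
     = (-1) ^ (\<Sum>j\<in>UNIV. \<alpha> j) *
       (LINT x|lborel. indicator (cbox 0 1) x * g x * (\<Prod>j\<in>UNIV. cos (w j * (x $ j) + b j)))"
    (is "?L = ?s * ?R")
proof -
  obtain "is" where "is": "\<And>i. count_list is i = \<alpha> i" using exists_list_count[of \<alpha>] by blast
  have g: "g \<in> borel_measurable borel" "\<And>K. compact K \<Longrightarrow> integrable lborel (\<lambda>x. indicator K x *\<^sub>R g x)"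
    using weak by (auto simp: has_weak_deriv_def locally_integrable_def set_integrable_def)
  have [measurable]: "g \<in> borel_measurable borel" by (rule g)
  define \<psi> where "\<psi> n j t = cutoff (1 / real (Suc n)) t * cos (w j * t + b j)" for n j t
  define \<phi> where "\<phi> n x = (\<Prod>j\<in>UNIV. \<psi> n j (x $ j))" for n and x :: "real ^ 'n"
  have el: "elementary (\<psi> n j)" for n j
    unfolding \<psi>_def[abs_def] by (intro elementary.intros cutoff(4)) simp
  have \<psi>_cont: "continuous_on UNIV (\<psi> n j)" for n j
    using elementary_deriv(2)[OF el] by (meson DERIV_continuous continuous_at_imp_continuous_on)
  have [measurable]: "\<psi> n j \<in> borel_measurable borel" for n j
    by (rule borel_measurable_continuous_onI[OF \<psi>_cont])
  \<comment> \<open>The scale is at most 1, so all cutoffs share one compact support. This supplies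
    an integrable majorant although \<open>g\<close> is only locally integrable.\<close>
  have \<psi>_supp: "t \<in> {-2..3}" if "\<psi> n j t \<noteq> 0" for n j t
  proof -
    have "\<not> (t < - (2 * (1 / real (Suc n))) \<or> t > 1 + 2 * (1 / real (Suc n)))"
      using that cutoff(3)[of "1 / real (Suc n)" t] by (auto simp: \<psi>_def)
    moreover have "1 / real (Suc n) \<le> 1" by simp
    ultimately show ?thesis unfolding atLeastAtMost_iff de_Morgan_disj not_less by linarith
  qed
  have \<psi>_le: "\<bar>\<psi> n j t\<bar> \<le> 1" for n j t
    using cutoff(1)[of "1 / real (Suc n)" t] abs_cos_le_one
    by (auto simp: \<psi>_def abs_mult intro!: mult_le_one)
  have test: "test_function (\<phi> n)" for n
    unfolding \<phi>_def[abs_def] by (rule test_function_prod_vec[OF el \<psi>_supp])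
  have L: "(LINT x|lborel. f x * partial_derivs is (\<phi> n) x) = ?L" for n
  proof (rule Bochner_Integration.integral_cong[OF refl])
    fix x :: "real ^ 'n"
    show "f x * partial_derivs is (\<phi> n) x
       = f x * (\<Prod>j\<in>UNIV. w j ^ \<alpha> j * cos (w j * (x $ j) + (real (\<alpha> j) * (pi / 2) + b j)))"
    proof (cases "x \<in> cbox 0 1")
      case True
      have "(deriv ^^ \<alpha> j) (\<psi> n j) (x $ j) = w j ^ \<alpha> j * cos (w j * (x $ j) + (real (\<alpha> j) * (pi / 2) + b j))" for j
      proof -
        let ?e = "1 / real (Suc n)"
        have "?e > 0" by simp
        have "(deriv ^^ \<alpha> j) (\<psi> n j) (x $ j) = (deriv ^^ \<alpha> j) (\<lambda>t. cos (w j * t + b j)) (x $ j)"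
        proof (rule higher_deriv_cong_open)
          show "open {- ?e<..<1 + ?e}" by simp
          show "\<psi> n j t = cos (w j * t + b j)" if "t \<in> {- ?e<..<1 + ?e}" for t
            using cutoff(2)[OF \<open>?e > 0\<close> that] by (simp add: \<psi>_def)
          have "0 \<le> x $ j" "x $ j \<le> 1" using True by (auto simp: mem_box_cart)
          then show "x $ j \<in> {- ?e<..<1 + ?e}"
            using \<open>?e > 0\<close> unfolding greaterThanLessThan_iff by linarith
        qed
        then show ?thesis unfolding higher_deriv_cos by (simp add: add_ac)
      qed
      then show ?thesis
        unfolding \<phi>_def[abs_def] partial_derivs_prod_vec[OF el] "is" by simp
    qed (simp add: supp)
  qed
  have eq: "?L = ?s * (LINT x|lborel. g x * \<phi> n x)" for n
    using weak test[of n] "is" L[of n] by (simp add: has_weak_deriv_def)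
  have "(\<lambda>n. LINT x|lborel. g x * \<phi> n x) \<longlonglongrightarrow> ?R"
  proof (rule integral_dominated_convergence)
    let ?B = "cbox (\<chi> j. -2) (\<chi> j. 3) :: (real ^ 'n) set"
    have "integrable lborel (\<lambda>x. indicator ?B x *\<^sub>R g x)" by (rule g) (rule compact_cbox)
    from integrable_abs[OF this] show "integrable lborel (\<lambda>x. indicator ?B x * \<bar>g x\<bar>)"
      by (simp add: abs_mult)
    show "(\<lambda>x. indicator (cbox 0 1) x * g x * (\<Prod>j\<in>UNIV. cos (w j * (x $ j) + b j))) \<in> borel_measurable lborel"
      by measurable
    show "(\<lambda>x. g x * \<phi> n x) \<in> borel_measurable lborel" for n
      unfolding \<phi>_def by measurable
    show "AE x in lborel. (\<lambda>n. g x * \<phi> n x) \<longlonglongrightarrow> indicator (cbox 0 1) x * g x * (\<Prod>j\<in>UNIV. cos (w j * (x $ j) + b j))"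
    proof (rule AE_I2)
      fix x :: "real ^ 'n"
      have "(\<lambda>n. g x * \<phi> n x) \<longlonglongrightarrow> g x * (\<Prod>j\<in>UNIV. indicator {0..1} (x $ j) * cos (w j * (x $ j) + b j))"
        unfolding \<phi>_def \<psi>_def by (intro tendsto_intros cutoff_tendsto)
      then show "(\<lambda>n. g x * \<phi> n x) \<longlonglongrightarrow> indicator (cbox 0 1) x * g x * (\<Prod>j\<in>UNIV. cos (w j * (x $ j) + b j))"
        by (simp add: indicator_unit_cube prod.distrib mult_ac)
    qed
    show "AE x in lborel. norm (g x * \<phi> n x) \<le> indicator ?B x * \<bar>g x\<bar>" for n
    proof (rule AE_I2)
      fix x :: "real ^ 'n"
      show "norm (g x * \<phi> n x) \<le> indicator ?B x * \<bar>g x\<bar>"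
      proof (cases "\<phi> n x = 0")
        case False
        then have "\<psi> n j (x $ j) \<noteq> 0" for j by (auto simp: \<phi>_def)
        then have "x \<in> ?B" using \<psi>_supp by (auto simp: mem_box_cart)
        moreover have "\<bar>\<phi> n x\<bar> \<le> 1"
          unfolding \<phi>_def abs_prod using \<psi>_le by (intro prod_le_1) auto
        ultimately show ?thesis
          by (simp add: abs_mult mult_left_le)
      qed simp
    qed
  qed
  then have "(\<lambda>n. ?s * (LINT x|lborel. g x * \<phi> n x)) \<longlonglongrightarrow> ?s * ?R" by (intro tendsto_intros)
  then show ?thesis unfolding eq[symmetric] by (simp add: LIMSEQ_const_iff)
qed

text \<open>Multiplying out cosine plus \<open>\<i>\<close> times sine, with each sine written as a
  cosine of phase \<open>- (pi / 2)\<close>, leaves only real products of cosines, the shape that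
  \<open>weak_deriv_cos\<close> treats. The set \<open>A\<close> collects the coordinates that
  contribute the cosine.\<close>

lemma prod_cis_expand:
  fixes c \<theta> :: "'n::finite \<Rightarrow> real"
  shows "(\<Prod>j\<in>UNIV. of_real (c j) * cis (\<theta> j)) =
    (\<Sum>A\<in>Pow UNIV. \<i> ^ card (UNIV - A) *
       of_real (\<Prod>j\<in>UNIV. c j * cos (\<theta> j + (if j \<in> A then 0 else - (pi / 2)))))"
proof -
  have "(\<Prod>j\<in>UNIV. of_real (c j) * cis (\<theta> j))
      = (\<Prod>j\<in>UNIV. of_real (c j * cos (\<theta> j)) + \<i> * of_real (c j * sin (\<theta> j)))"
    by (intro prod.cong refl) (simp add: complex_eq_iff)
  also have "\<dots> = (\<Sum>A\<in>Pow UNIV. (\<Prod>j\<in>A. of_real (c j * cos (\<theta> j)))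
      * (\<Prod>j\<in>UNIV - A. \<i> * of_real (c j * sin (\<theta> j))))"
    by (rule prod_add) simp
  also have "\<dots> = (\<Sum>A\<in>Pow UNIV. \<i> ^ card (UNIV - A) *
       of_real (\<Prod>j\<in>UNIV. c j * cos (\<theta> j + (if j \<in> A then 0 else - (pi / 2)))))"
  proof (intro sum.cong refl)
    fix A :: "'n set"
    let ?t = "\<lambda>j. c j * cos (\<theta> j + (if j \<in> A then 0 else - (pi / 2)))"
    have "(\<Prod>j\<in>UNIV. ?t j) = (\<Prod>j\<in>A \<union> (UNIV - A). ?t j)" by simp
    also have "\<dots> = (\<Prod>j\<in>A. ?t j) * (\<Prod>j\<in>UNIV - A. ?t j)" by (rule prod.union_disjoint) auto
    also have "\<dots> = (\<Prod>j\<in>A. c j * cos (\<theta> j)) * (\<Prod>j\<in>UNIV - A. c j * sin (\<theta> j))"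
      by (simp add: cos_diff)
    finally show "(\<Prod>j\<in>A. of_real (c j * cos (\<theta> j))) * (\<Prod>j\<in>UNIV - A. \<i> * of_real (c j * sin (\<theta> j)))
       = \<i> ^ card (UNIV - A) * of_real (\<Prod>j\<in>UNIV. ?t j)"
      by (simp add: prod.distrib del: of_real_mult) (simp add: prod.distrib mult_ac)
  qed
  finally show ?thesis .
qed

lemma integrable_mult_cos:
  fixes q :: "real ^ 'n \<Rightarrow> real"
  assumes "integrable lborel q"
  shows "integrable lborel (\<lambda>x. q x * (\<Prod>j\<in>UNIV. c j * cos (w j * (x $ j) + b j)))"
proof (rule Bochner_Integration.integrable_bound)
  show "integrable lborel (\<lambda>x. (\<Prod>j\<in>UNIV. \<bar>c j\<bar>) * q x)" using assms by simp
  have [measurable]: "q \<in> borel_measurable borel" using borel_measurable_integrable[OF assms] by simp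
  show "(\<lambda>x. q x * (\<Prod>j\<in>UNIV. c j * cos (w j * (x $ j) + b j))) \<in> borel_measurable lborel" by measurable
  have "\<bar>\<Prod>j\<in>UNIV. c j * cos (w j * (x $ j) + b j)\<bar> \<le> (\<Prod>j\<in>UNIV. \<bar>c j\<bar>)" for x :: "real ^ 'n"
    unfolding abs_prod abs_mult by (intro prod_mono) (auto intro: mult_left_le)
  then show "AE x in lborel. norm (q x * (\<Prod>j\<in>UNIV. c j * cos (w j * (x $ j) + b j))) \<le> norm ((\<Prod>j\<in>UNIV. \<bar>c j\<bar>) * q x)"
    by (intro AE_I2) (simp add: abs_mult abs_prod mult.commute mult_left_mono)
qed

lemma integral_prod_cis:
  fixes q :: "real ^ 'n \<Rightarrow> real"
  assumes "integrable lborel q"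
  shows "(LINT x|lborel. q x *\<^sub>R (\<Prod>j\<in>UNIV. of_real (c j) * cis (w j * (x $ j) + b j)))
    = (\<Sum>A\<in>Pow UNIV. \<i> ^ card (UNIV - A) * of_real (LINT x|lborel. q x *
         (\<Prod>j\<in>UNIV. c j * cos (w j * (x $ j) + (b j + (if j \<in> A then 0 else - (pi / 2)))))))"
proof -
  have "(\<lambda>x. q x *\<^sub>R (\<Prod>j\<in>UNIV. of_real (c j) * cis (w j * (x $ j) + b j)))
    = (\<lambda>x. \<Sum>A\<in>Pow UNIV. \<i> ^ card (UNIV - A) * of_real (q x *
         (\<Prod>j\<in>UNIV. c j * cos (w j * (x $ j) + (b j + (if j \<in> A then 0 else - (pi / 2)))))))"
    unfolding prod_cis_expand
    by (simp add: scaleR_conv_of_real sum_distrib_left mult_ac add.assoc)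
  moreover have "has_bochner_integral lborel
    (\<lambda>x. \<Sum>A\<in>Pow UNIV. \<i> ^ card (UNIV - A) * complex_of_real (q x *
         (\<Prod>j\<in>UNIV. c j * cos (w j * (x $ j) + (b j + (if j \<in> A then 0 else - (pi / 2)))))))
    (\<Sum>A\<in>Pow UNIV. \<i> ^ card (UNIV - A) * of_real (LINT x|lborel. q x *
         (\<Prod>j\<in>UNIV. c j * cos (w j * (x $ j) + (b j + (if j \<in> A then 0 else - (pi / 2)))))))"
    by (intro has_bochner_integral_sum has_bochner_integral_mult_right has_bochner_integral_of_real
        has_bochner_integral_integrable integrable_mult_cos assms)
  ultimately show ?thesis by (simp add: has_bochner_integral_iff)
qed

text \<open>Differentiation becomes multiplication by a monomial in the frequency. Taking moduli
  removes the sign of the integration by parts and the powers of \<open>\<i>\<close>, and the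
  indicator keeps the right-hand side on the cube, where the norm is taken.\<close>

lemma weak_deriv_fourier:
  fixes f g :: "real ^ 'n \<Rightarrow> real"
  assumes weak: "has_weak_deriv \<alpha> f g" and supp: "\<And>x. x \<notin> cbox 0 1 \<Longrightarrow> f x = 0"
  shows "(\<Prod>j\<in>UNIV. \<bar>2 * pi * (\<xi> $ j)\<bar> ^ \<alpha> j) * cmod (LINT x|lborel. f x *\<^sub>R ee (\<xi> \<bullet> x))
    = cmod (LINT x|lborel. (indicator (cbox 0 1) x * g x) *\<^sub>R ee (\<xi> \<bullet> x))"
proof -
  define w where "w j = 2 * pi * (\<xi> $ j)" for j
  let ?p = "\<lambda>j. real (\<alpha> j) * (pi / 2)"
  have li: "locally_integrable f" "locally_integrable g" using weak by (auto simp: has_weak_deriv_def)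
  have ind: "indicator (cbox 0 1) x *\<^sub>R f x = f x" for x using supp[of x] by (auto simp: indicator_def)
  have intf: "integrable lborel f"
    using li(1) unfolding locally_integrable_def set_integrable_def
    by (elim conjE allE[of _ "cbox 0 1 :: (real ^ 'n) set"]) (simp add: ind[unfolded real_scaleR_def])
  have intg: "integrable lborel (\<lambda>x. indicator (cbox 0 1) x * g x)"
    using li(2) unfolding locally_integrable_def set_integrable_def
    by (elim conjE allE[of _ "cbox 0 1 :: (real ^ 'n) set"]) simp
  have ee: "ee (\<xi> \<bullet> x) = (\<Prod>j\<in>UNIV. cis (w j * (x $ j)))" for x
    by (simp add: w_def inner_vec_def ee_sum) (simp add: ee_def mult_ac)
  \<comment> \<open>This is the product of the factors \<open>(\<i> * w j) ^ \<alpha> j\<close>: the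
    phase \<open>?p j\<close> is the one that \<open>\<alpha> j\<close> derivatives add to a cosine,
    so the expansion below matches \<open>weak_deriv_cos\<close> term by term.\<close>
  let ?c = "\<Prod>j\<in>UNIV. of_real (w j ^ \<alpha> j) * cis (?p j)"
  have "?c * (LINT x|lborel. f x *\<^sub>R ee (\<xi> \<bullet> x))
     = (LINT x|lborel. f x *\<^sub>R (\<Prod>j\<in>UNIV. of_real (w j ^ \<alpha> j) * cis (w j * (x $ j) + ?p j)))"
    by (subst integral_mult_right_zero[symmetric])
       (simp add: ee prod.distrib[symmetric] cis_mult[symmetric] mult_ac)
  also have "\<dots> = (\<Sum>A\<in>Pow UNIV. \<i> ^ card (UNIV - A) * of_real (LINT x|lborel. f x *
         (\<Prod>j\<in>UNIV. w j ^ \<alpha> j * cos (w j * (x $ j) + (?p j + (if j \<in> A then 0 else - (pi / 2)))))))"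
    by (rule integral_prod_cis[OF intf])
  also have "\<dots> = (\<Sum>A\<in>Pow UNIV. \<i> ^ card (UNIV - A) * of_real ((-1) ^ (\<Sum>j\<in>UNIV. \<alpha> j) *
         (LINT x|lborel. indicator (cbox 0 1) x * g x *
         (\<Prod>j\<in>UNIV. 1 * cos (w j * (x $ j) + (0 + (if j \<in> A then 0 else - (pi / 2))))))))"
  proof (intro sum.cong refl arg_cong2[where f="(*)"] arg_cong[where f=of_real])
    fix A :: "'n set"
    show "(LINT x|lborel. f x *
         (\<Prod>j\<in>UNIV. w j ^ \<alpha> j * cos (w j * (x $ j) + (?p j + (if j \<in> A then 0 else - (pi / 2))))))
      = (-1) ^ (\<Sum>j\<in>UNIV. \<alpha> j) *
         (LINT x|lborel. indicator (cbox 0 1) x * g x *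
         (\<Prod>j\<in>UNIV. 1 * cos (w j * (x $ j) + (0 + (if j \<in> A then 0 else - (pi / 2))))))"
      unfolding mult_1_left add_0_left by (rule weak_deriv_cos[OF weak]) (rule supp)
  qed
  also have "\<dots> = (-1) ^ (\<Sum>j\<in>UNIV. \<alpha> j) *
      (LINT x|lborel. (indicator (cbox 0 1) x * g x) *\<^sub>R (\<Prod>j\<in>UNIV. of_real 1 * cis (w j * (x $ j) + 0)))"
    unfolding integral_prod_cis[OF intg] by (simp add: sum_distrib_left mult_ac)
  finally have "cmod ?c * cmod (LINT x|lborel. f x *\<^sub>R ee (\<xi> \<bullet> x))
     = cmod (LINT x|lborel. (indicator (cbox 0 1) x * g x) *\<^sub>R ee (\<xi> \<bullet> x))"
    by (simp add: ee norm_mult[symmetric]) (simp add: norm_mult norm_power)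
  moreover have "cmod ?c = (\<Prod>j\<in>UNIV. \<bar>2 * pi * (\<xi> $ j)\<bar> ^ \<alpha> j)"
    by (simp add: w_def prod_norm[symmetric] norm_mult norm_power abs_mult power_abs)
  ultimately show ?thesis by simp
qed


subsection \<open>Frolov lattices and Sobolev weights\<close>

lemma diag_mult_vec: "(s *\<^sub>R (diag u ** B)) *v x = (\<chi> j. s * u $ j * (B *v x) $ j)"
proof -
  have "(diag u ** B) *v x = (\<chi> j. u $ j * (B *v x) $ j)"
  proof -
    have "(diag u *v y) $ j = u $ j * y $ j" for y j
      by (simp add: matrix_vector_mult_def diag_def if_distrib[of "\<lambda>c. c * _"] cong: if_cong)
    then show ?thesis by (simp add: vec_eq_iff matrix_vector_mul_assoc[symmetric])
  qed
  then show ?thesis by (simp add: scaleR_matrix_vector_assoc[symmetric] vec_eq_iff mult_ac)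
qed

text \<open>Level 0 collects everything below 1, and a level \<open>s > 0\<close> is the interval
  from \<open>2 ^ (s - 1)\<close> to \<open>2 ^ s\<close>. Small coordinates thus need no levels of
  their own.\<close>

definition dyadic_level :: "real \<Rightarrow> nat" where
  "dyadic_level t = (LEAST s. t < 2 ^ s)"

lemma dyadic_level:
  "t < 2 ^ dyadic_level t" "dyadic_level t > 0 \<Longrightarrow> 2 ^ (dyadic_level t - 1) \<le> t"
proof -
  obtain s :: nat where "t < 2 ^ s" using real_arch_pow[of 2 t] by auto
  then show "t < 2 ^ dyadic_level t" unfolding dyadic_level_def by (rule LeastI)
  show "2 ^ (dyadic_level t - 1) \<le> t" if "dyadic_level t > 0"
    using not_less_Least[of "dyadic_level t - 1" "\<lambda>s. t < 2 ^ s"] that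
    by (simp add: dyadic_level_def[symmetric])
qed

definition sobolev_weight :: "nat \<Rightarrow> real \<Rightarrow> real" where
  "sobolev_weight r t = (\<Sum>a\<le>r. \<bar>2 * pi * t\<bar> ^ (2 * a))"

text \<open>At a level \<open>s > 0\<close> the summand \<open>a = r\<close> is at least
  \<open>(2 ^ (s - 1)) ^ (2 * r)\<close>; the division by \<open>4 ^ r\<close> pays for the shift
  from \<open>s\<close> to \<open>s - 1\<close>. At level 0 the summand \<open>a = 0\<close>, which
  is 1, suffices.\<close>

lemma sobolev_weight_ge: "sobolev_weight r t \<ge> 4 ^ (r * dyadic_level \<bar>t\<bar>) / 4 ^ r" "sobolev_weight r t > 0"
proof -
  have mem: "\<bar>2 * pi * t\<bar> ^ (2 * a) \<le> sobolev_weight r t" if "a \<le> r" for a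
    unfolding sobolev_weight_def using that by (intro member_le_sum[of a "{..r}"]) auto
  from mem[of 0] show "sobolev_weight r t > 0" by simp
  show "sobolev_weight r t \<ge> 4 ^ (r * dyadic_level \<bar>t\<bar>) / 4 ^ r"
  proof (cases "dyadic_level \<bar>t\<bar>")
    case 0
    have "1 / 4 ^ r \<le> (1 :: real)" by simp
    also have "\<dots> \<le> sobolev_weight r t" using mem[of 0] by simp
    finally show ?thesis using 0 by simp
  next
    case (Suc s)
    have "4 ^ (r * dyadic_level \<bar>t\<bar>) / 4 ^ r = ((2::real) ^ 2) ^ (r * s)"
      by (simp add: Suc power_add)
    also have "\<dots> = (2 ^ s) ^ (2 * r)" by (simp only: power_mult[symmetric] mult_ac)
    also have "\<dots> \<le> \<bar>2 * pi * t\<bar> ^ (2 * r)"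
    proof (intro power_mono)
      have "2 ^ s \<le> \<bar>t\<bar>" using dyadic_level(2)[of "\<bar>t\<bar>"] Suc by simp
      also have "\<dots> \<le> \<bar>2 * pi * t\<bar>" using pi_gt3 by (simp add: abs_mult mult_le_cancel_right1)
      finally show "2 ^ s \<le> \<bar>2 * pi * t\<bar>" .
    qed simp
    also have "\<dots> \<le> sobolev_weight r t" by (rule mem) simp
    finally show ?thesis .
  qed
qed

text \<open>All coordinates but one range over \<open>{..t}\<close> and determine the last one. This
  is the origin of the exponent \<open>CARD('n) - 1\<close> of the logarithm.\<close>

lemma card_functions_sum_eq:
  "finite {s :: 'n::finite \<Rightarrow> nat. (\<Sum>j\<in>UNIV. s j) = t}"
  "card {s :: 'n::finite \<Rightarrow> nat. (\<Sum>j\<in>UNIV. s j) = t} \<le> (t + 1) ^ (CARD('n) - 1)"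
proof -
  fix i :: 'n
  let ?S = "{s :: 'n \<Rightarrow> nat. (\<Sum>j\<in>UNIV. s j) = t}"
  let ?P = "\<Pi>\<^sub>E j\<in>UNIV - {i}. {..t}"
  have finP: "finite ?P" by (intro finite_PiE) auto
  have split: "(\<Sum>j\<in>UNIV. s j) = s i + (\<Sum>j\<in>UNIV - {i}. s j)" for s :: "'n \<Rightarrow> nat"
    by (rule sum.remove) auto
  have inj: "inj_on (\<lambda>s. restrict s (UNIV - {i})) ?S"
  proof (rule inj_onI)
    fix s s' assume s: "s \<in> ?S" "s' \<in> ?S" "restrict s (UNIV - {i}) = restrict s' (UNIV - {i})"
    have off: "s j = s' j" if "j \<noteq> i" for j
      using fun_cong[OF s(3), of j] that by simp
    then have "(\<Sum>j\<in>UNIV - {i}. s j) = (\<Sum>j\<in>UNIV - {i}. s' j)" by (intro sum.cong) auto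
    then have "s i = s' i" using s(1,2) split[of s] split[of s'] by simp
    with off show "s = s'" by (metis ext)
  qed
  have le: "s j \<le> (\<Sum>j\<in>UNIV. s j)" for s :: "'n \<Rightarrow> nat" and j
    by (rule member_le_sum) auto
  have sub: "(\<lambda>s. restrict s (UNIV - {i})) ` ?S \<subseteq> ?P"
    by (intro image_subsetI PiE_I) (auto simp: le)
  show "finite ?S" using finite_subset[OF sub finP] inj by (rule finite_imageD)
  have "card ?S = card ((\<lambda>s. restrict s (UNIV - {i})) ` ?S)" using inj by (simp add: card_image)
  also have "\<dots> \<le> card ?P" using finP sub by (rule card_mono)
  also have "\<dots> = (t + 1) ^ (CARD('n) - 1)" by (simp add: card_PiE card_Diff_singleton)
  finally show "card ?S \<le> (t + 1) ^ (CARD('n) - 1)" .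
qed

section \<open>Summation over dyadic levels and over the Frolov lattice\<close>

lemma summable_power_geometric: "summable (\<lambda>i. real (i + 1) ^ m * (1 / 2) ^ i)"
proof -
  let ?f = "\<lambda>i. real (i + 1) ^ m * (1 / 2) ^ i"
  have "(\<lambda>i. (1 + inverse (real (Suc i))) ^ m) \<longlonglongrightarrow> (1 + 0) ^ m"
    by (intro tendsto_intros LIMSEQ_inverse_real_of_nat)
  \<comment> \<open>Any bound strictly between 1 and 2 would do: together with the factor 1/2 it
    gives the ratio 3/4 below.\<close>
  from order_tendstoD(2)[OF this, of "3/2"]
  have "\<forall>\<^sub>F i in sequentially. (1 + inverse (real (Suc i))) ^ m < 3/2" by simp
  then obtain N where N: "\<And>i. i \<ge> N \<Longrightarrow> (1 + inverse (real (Suc i))) ^ m < 3/2"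
    by (auto simp: eventually_sequentially)
  show ?thesis
  proof (rule summable_ratio_test[of "3/4" N])
    fix i assume "i \<ge> N"
    have "real (Suc i + 1) = real (i + 1) * (1 + inverse (real (Suc i)))"
      by (simp add: field_simps)
    then have "?f (Suc i) = ?f i * ((1 + inverse (real (Suc i))) ^ m * (1 / 2))"
      by (simp only: power_mult_distrib power_Suc mult_ac)
    also have "\<dots> \<le> ?f i * (3 / 4)"
      using N[OF \<open>i \<ge> N\<close>] by (intro mult_left_mono) auto
    finally show "norm (?f (Suc i)) \<le> 3 / 4 * norm (?f i)" by (simp add: abs_mult)
  qed simp
qed

text \<open>Since \<open>r\<close> is at least 1, the terms decay geometrically and the first
  admissible exponent \<open>t0\<close> dominates. Writing \<open>t = t0 + i\<close>, the bound
  \<open>t + 1 \<le> (t0 + 1) * (i + 1)\<close> separates the logarithmic factor, which comes from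
  \<open>t0 + 1\<close>, from a convergent series in \<open>i\<close>.\<close>

lemma dyadic_tail_sum:
  fixes r m :: nat
  assumes "r \<ge> 1"
  shows "\<exists>Z>0. \<forall>x\<ge>2 :: real. \<forall>T. finite T \<longrightarrow> (\<forall>t\<in>T. x \<le> 2 ^ t) \<longrightarrow>
     (\<Sum>t\<in>T. real (t + 1) ^ m * 2 ^ t / 4 ^ (r * t)) \<le> Z * ln x ^ m / x ^ (2 * r - 1)"
proof -
  let ?f = "\<lambda>i. real (i + 1) ^ m * (1 / 2) ^ i"
  define Z where "Z = suminf ?f"
  have "Z > 0" unfolding Z_def by (intro suminf_pos summable_power_geometric) simp
  show ?thesis
  proof (intro exI[of _ "Z * (3 / ln 2) ^ m"] conjI allI impI)
    show "Z * (3 / ln 2) ^ m > 0" using \<open>Z > 0\<close> by simp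
    fix x :: real and T :: "nat set"
    assume x: "x \<ge> 2" and T: "finite T" "\<forall>t\<in>T. x \<le> 2 ^ t"
    define t0 where "t0 = (LEAST t. x \<le> 2 ^ t)"
    obtain s :: nat where "x < 2 ^ s" using real_arch_pow[of 2 x] by auto
    then have "x \<le> 2 ^ s" by simp
    then have t0: "x \<le> 2 ^ t0" unfolding t0_def by (rule LeastI)
    have "t0 > 0" using t0 x by (cases t0) auto
    then have t0': "2 ^ (t0 - 1) < x"
      using not_less_Least[of "t0 - 1" "\<lambda>t. x \<le> 2 ^ t"] by (simp add: t0_def[symmetric])
    have t0_le: "t0 \<le> t" if "t \<in> T" for t
      unfolding t0_def using T(2) that by (intro Least_le) auto
    have "real (t0 - 1) * ln 2 < ln x"
      using t0' x by (subst ln_realpow[symmetric]) auto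
    moreover have "ln 2 \<le> ln x" using x by simp
    \<comment> \<open>The constant 3 splits as 1 + 2: \<open>t0 - 1\<close> is below the binary
      logarithm of \<open>x\<close>, and the remaining 2 is at most twice that logarithm because
      \<open>x\<close> is at least 2.\<close>
    ultimately have "real (t0 + 1) * ln 2 \<le> 3 * ln x"
      using \<open>t0 > 0\<close> by (simp add: of_nat_diff algebra_simps)
    then have log: "real (t0 + 1) \<le> (3 / ln 2) * ln x" by (simp add: field_simps)
    have bnd: "real (t + 1) ^ m * 2 ^ t / 4 ^ (r * t)
        \<le> real (t0 + 1) ^ m / x ^ (2 * r - 1) * ?f (t - t0)" if "t \<in> T" for t
    proof -
      define i where "i = t - t0"
      have t: "t = t0 + i" using t0_le[OF that] by (simp add: i_def)
      have four: "(4::real) ^ (r * k) = 2 ^ k * (2 ^ k) ^ (2 * r - 1)" for k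
      proof -
        have "(4::real) ^ (r * k) = (2 ^ 2) ^ (r * k)" by simp
        also have "\<dots> = (2 ^ k) ^ (2 * r)" by (simp only: power_mult[symmetric] mult_ac)
        also have "\<dots> = (2 ^ k) ^ Suc (2 * r - 1)" using assms by simp
        finally show ?thesis by simp
      qed
      have "real (t + 1) \<le> real (t0 + 1) * real (i + 1)"
        unfolding t of_nat_mult[symmetric] of_nat_le_iff by simp
      then have 1: "real (t + 1) ^ m \<le> real (t0 + 1) ^ m * real (i + 1) ^ m"
        by (metis power_mono power_mult_distrib of_nat_0_le_iff)
      have "2 ^ t / 4 ^ (r * t) = 1 / ((2::real) ^ t) ^ (2 * r - 1)"
        by (simp add: four)
      also have "\<dots> = 1 / (2 ^ t0) ^ (2 * r - 1) * (1 / (2 ^ i) ^ (2 * r - 1))"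
        by (simp add: t power_add power_mult_distrib)
      also have "\<dots> \<le> 1 / x ^ (2 * r - 1) * (1 / 2) ^ i"
      proof (intro mult_mono)
        show "1 / (2 ^ t0) ^ (2 * r - 1) \<le> 1 / x ^ (2 * r - 1)"
          using x t0 by (intro divide_left_mono power_mono) auto
        have "(2::real) ^ i \<le> (2 ^ i) ^ (2 * r - 1)"
          using assms by (intro self_le_power) auto
        then have "1 / (2 ^ i) ^ (2 * r - 1) \<le> 1 / (2::real) ^ i"
          by (intro divide_left_mono) auto
        then show "1 / (2 ^ i) ^ (2 * r - 1) \<le> (1 / 2 :: real) ^ i" by (simp add: power_divide)
      qed (use x in auto)
      finally have 2: "2 ^ t / 4 ^ (r * t) \<le> 1 / x ^ (2 * r - 1) * (1 / 2) ^ i" .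
      have "real (t + 1) ^ m * (2 ^ t / 4 ^ (r * t))
         \<le> (real (t0 + 1) ^ m * real (i + 1) ^ m) * (1 / x ^ (2 * r - 1) * (1 / 2) ^ i)"
        by (intro mult_mono 1 2) auto
      then show ?thesis by (simp add: i_def[symmetric] mult_ac)
    qed
    have "(\<Sum>t\<in>T. real (t + 1) ^ m * 2 ^ t / 4 ^ (r * t))
       \<le> (\<Sum>t\<in>T. real (t0 + 1) ^ m / x ^ (2 * r - 1) * ?f (t - t0))"
      by (intro sum_mono bnd)
    also have "\<dots> = real (t0 + 1) ^ m / x ^ (2 * r - 1) * (\<Sum>i\<in>(\<lambda>t. t - t0) ` T. ?f i)"
    proof -
      have "inj_on (\<lambda>t. t - t0) T" using t0_le by (intro inj_onI) (simp add: eq_diff_iff)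
      then show ?thesis by (simp only: sum.reindex o_def sum_distrib_left)
    qed
    also have "\<dots> \<le> ((3 / ln 2) * ln x) ^ m / x ^ (2 * r - 1) * Z"
    proof (intro mult_mono divide_right_mono power_mono log)
      show "(\<Sum>i\<in>(\<lambda>t. t - t0) ` T. ?f i) \<le> Z"
        unfolding Z_def using T(1) by (intro sum_le_suminf summable_power_geometric) auto
    qed (use x in \<open>auto intro!: sum_nonneg\<close>)
    also have "\<dots> = Z * (3 / ln 2) ^ m * ln x ^ m / x ^ (2 * r - 1)"
      by (simp add: power_mult_distrib power_divide)
    finally show "(\<Sum>t\<in>T. real (t + 1) ^ m * 2 ^ t / 4 ^ (r * t)) \<le> Z * (3 / ln 2) ^ m * ln x ^ m / x ^ (2 * r - 1)" .
  qed
qed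

text \<open>A single constant serves all \<open>u\<close>: since the product of the coordinates of
  \<open>u\<close> is at least 1, scaling by \<open>u\<close> can only enlarge the products of the
  coordinates and only shrink the volume of the boxes pulled back to the unscaled lattice. Hence
  both the threshold for occupied boxes and the count of points in them hold uniformly.\<close>

lemma frolov_lattice_sum:
  fixes B :: "real ^ 'n ^ 'n"
  assumes "r \<ge> 1" and frolov: "frolov_matrix B"
  shows "\<exists>C>0. \<forall>n u K. n \<ge> 2 \<longrightarrow> u \<in> cbox 1 (\<chi> j. 2 powr (1 / real CARD('n))) \<longrightarrow> finite K \<longrightarrow> 0 \<notin> K \<longrightarrow>
     (\<Sum>k\<in>K. 1 / (\<Prod>j\<in>UNIV. sobolev_weight r
        ((((real n powr (1 / real CARD('n))) *\<^sub>R (diag u ** B)) *v real_vec k) $ j)))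
     \<le> C * ln (real n) ^ (CARD('n) - 1) / real n ^ (2 * r)"
proof -
  let ?d = "CARD('n)"
  obtain Z where Z0: "Z > 0" and Z1: "\<forall>x\<ge>2. \<forall>T. finite T \<longrightarrow> (\<forall>t\<in>T. x \<le> 2 ^ t) \<longrightarrow>
     (\<Sum>t\<in>T. real (t + 1) ^ (?d - 1) * 2 ^ t / 4 ^ (r * t)) \<le> Z * ln x ^ (?d - 1) / x ^ (2 * r - 1)"
    using dyadic_tail_sum[OF \<open>r \<ge> 1\<close>, of "?d - 1"] by blast
  note Z = Z0 Z1[rule_format]
  \<comment> \<open>The first factor is the loss in the weights, \<open>4 ^ r\<close> per
    coordinate; the second is the loss in counting points in a box.\<close>
  define D :: real where "D = (4 ^ r) ^ ?d * 2 ^ (?d + 1)"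
  have "D > 0" by (simp add: D_def)
  have inv: "invertible B" and prod_ge: "\<And>m. m \<noteq> 0 \<Longrightarrow> 1 \<le> \<bar>\<Prod>j\<in>UNIV. (B *v real_vec m) $ j\<bar>"
    and fin: "\<And>x y. finite (range (\<lambda>m. B *v real_vec m) \<inter> coord_box x y)"
    and count: "\<And>x y. real (card (range (\<lambda>m. B *v real_vec m) \<inter> coord_box x y))
              \<le> (\<Prod>j\<in>UNIV. \<bar>x $ j - y $ j\<bar>) + 1"
    using frolov by (auto simp: frolov_matrix_def)
  \<comment> \<open>Condition (c) of a Frolov matrix counts lattice points, whereas the sum runs
    over their integer indices.\<close>
  have injB: "inj (\<lambda>m. B *v real_vec m)"
  proof (rule injI)
    fix m m' assume "B *v real_vec m = B *v real_vec m'"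
    then have "real_vec m = real_vec m'" by (rule injD[OF inj_matrix_vector_mult[OF inv]])
    then show "m = m'" by (simp add: real_vec_def vec_eq_iff)
  qed
  show ?thesis
  proof (intro exI[of _ "D * Z"] conjI allI impI)
    show "D * Z > 0" using \<open>D > 0\<close> Z(1) by simp
    fix n :: nat and u :: "real ^ 'n" and K :: "(int ^ 'n) set"
    assume n: "n \<ge> 2" and u: "u \<in> cbox 1 (\<chi> j. 2 powr (1 / real ?d))" and K: "finite K" "0 \<notin> K"
    define N where "N = real n powr (1 / real ?d)"
    have "N > 0" using n by (simp add: N_def)
    have Nd: "N ^ ?d = real n" using n by (simp add: N_def powr_realpow[symmetric] powr_powr)
    have u1: "u $ j \<ge> 1" for j using u by (simp add: mem_box_cart)
    then have u0: "u $ j > 0" for j by (meson less_le_trans zero_less_one)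
    have pu: "(\<Prod>j\<in>UNIV. u $ j) \<ge> 1" using u1 by (intro prod_ge_1) auto
    define \<xi> where "\<xi> k j = N * u $ j * (B *v real_vec k) $ j" for k j
    define \<sigma> where "\<sigma> k j = dyadic_level \<bar>\<xi> k j\<bar>" for k j
    define \<tau> where "\<tau> k = (\<Sum>j\<in>UNIV. \<sigma> k j)" for k
    have weight: "1 / (\<Prod>j\<in>UNIV. sobolev_weight r (\<xi> k j)) \<le> (4 ^ r) ^ ?d / 4 ^ (r * \<tau> k)" for k
    proof -
      have "4 ^ (r * \<tau> k) / (4 ^ r) ^ ?d = (\<Prod>j\<in>UNIV. 4 ^ (r * \<sigma> k j) / (4::real) ^ r)"
        by (simp add: \<tau>_def prod_dividef sum_distrib_left power_sum)
      also have "\<dots> \<le> (\<Prod>j\<in>UNIV. sobolev_weight r (\<xi> k j))"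
        unfolding \<sigma>_def by (intro prod_mono conjI sobolev_weight_ge) auto
      finally have "1 / (\<Prod>j\<in>UNIV. sobolev_weight r (\<xi> k j)) \<le> 1 / (4 ^ (r * \<tau> k) / (4 ^ r) ^ ?d)"
        by (intro divide_left_mono mult_pos_pos prod_pos sobolev_weight_ge) auto
      then show ?thesis by simp
    qed
    have n_le: "real n \<le> 2 ^ \<tau> k" if "k \<in> K" for k
    proof -
      have "k \<noteq> 0" using that K by auto
      have "real n * 1 \<le> (real n * (\<Prod>j\<in>UNIV. u $ j)) * \<bar>\<Prod>j\<in>UNIV. (B *v real_vec k) $ j\<bar>"
        using prod_ge[OF \<open>k \<noteq> 0\<close>] pu by (intro mult_mono) (auto simp: mult_le_cancel_left1)
      also have "\<dots> = (\<Prod>j\<in>UNIV. \<bar>\<xi> k j\<bar>)"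
        using \<open>N > 0\<close> u0 by (simp add: \<xi>_def abs_mult prod.distrib Nd abs_prod less_imp_le abs_of_pos)
      also have "\<dots> \<le> (\<Prod>j\<in>UNIV. 2 ^ \<sigma> k j)"
        unfolding \<sigma>_def by (intro prod_mono conjI less_imp_le[OF dyadic_level(1)]) auto
      also have "\<dots> = 2 ^ \<tau> k" by (simp add: \<tau>_def power_sum)
      finally show ?thesis by simp
    qed
    have count_s: "real (card {k \<in> K. \<sigma> k = s}) \<le> 2 ^ (?d + 1) * 2 ^ t / real n"
      if s: "(\<Sum>j\<in>UNIV. s j) = t" and t: "real n \<le> 2 ^ t" for s t
    proof -
      \<comment> \<open>Points of class \<open>s\<close> lie within \<open>2 ^ s j\<close> of 0 in
        coordinate \<open>j\<close> after scaling. Undoing the scaling gives a symmetric box with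
        half-sides \<open>y $ j\<close>, whose full sides contribute the factor
        \<open>2 ^ ?d\<close>.\<close>
      define y :: "real ^ 'n" where "y = (\<chi> j. 2 ^ s j / (N * u $ j))"
      have "(\<lambda>m. B *v real_vec m) ` {k \<in> K. \<sigma> k = s} \<subseteq> range (\<lambda>m. B *v real_vec m) \<inter> coord_box (- y) y"
      proof (intro image_subsetI IntI rangeI, unfold coord_box_def mem_Collect_eq, intro allI)
        fix k j assume "k \<in> K \<and> \<sigma> k = s"
        then have "s = \<sigma> k" by simp
        have "\<bar>\<xi> k j\<bar> \<le> 2 ^ \<sigma> k j" using dyadic_level(1)[of "\<bar>\<xi> k j\<bar>"] by (simp add: \<sigma>_def)
        then have "\<bar>(B *v real_vec k) $ j\<bar> \<le> 2 ^ \<sigma> k j / (N * u $ j)"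
          using \<open>N > 0\<close> u0[of j] by (simp add: \<xi>_def abs_mult pos_le_divide_eq mult_ac)
        then have "\<bar>(B *v real_vec k) $ j\<bar> \<le> y $ j" by (simp add: y_def \<open>s = \<sigma> k\<close>)
        then show "min ((- y) $ j) (y $ j) \<le> (B *v real_vec k) $ j \<and> (B *v real_vec k) $ j \<le> max ((- y) $ j) (y $ j)"
          by (auto simp: abs_le_iff)
      qed
      then have "card ((\<lambda>m. B *v real_vec m) ` {k \<in> K. \<sigma> k = s}) \<le> card (range (\<lambda>m. B *v real_vec m) \<inter> coord_box (- y) y)"
        by (intro card_mono fin)
      then have "card {k \<in> K. \<sigma> k = s} \<le> card (range (\<lambda>m. B *v real_vec m) \<inter> coord_box (- y) y)"
        using injB by (simp add: card_image inj_on_subset)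
      then have "real (card {k \<in> K. \<sigma> k = s}) \<le> (\<Prod>j\<in>UNIV. \<bar>(- y) $ j - y $ j\<bar>) + 1"
        using count[of "- y" y] by linarith
      also have "(\<Prod>j\<in>UNIV. \<bar>(- y) $ j - y $ j\<bar>) = (\<Prod>j\<in>UNIV. 2 * 2 ^ s j / (N * u $ j))"
      proof (intro prod.cong refl)
        fix j
        have "y $ j \<ge> 0" using \<open>N > 0\<close> u0[of j] by (simp add: y_def)
        then have "\<bar>(- y) $ j - y $ j\<bar> = 2 * y $ j" by simp
        then show "\<bar>(- y) $ j - y $ j\<bar> = 2 * 2 ^ s j / (N * u $ j)" by (simp add: y_def)
      qed
      also have "\<dots> = 2 ^ ?d * 2 ^ t / (real n * (\<Prod>j\<in>UNIV. u $ j))"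
        by (simp add: prod_dividef prod.distrib Nd s[symmetric] power_sum)
      also have "\<dots> \<le> 2 ^ ?d * 2 ^ t / real n"
        using pu n by (intro divide_left_mono) (auto simp: mult_le_cancel_left1 intro!: mult_pos_pos)
      \<comment> \<open>The extra 1 in the lattice count is absorbed by the volume. This works
        exactly in the boxes of volume at least \<open>n\<close>, the only ones that can be
        occupied.\<close>
      also have "1 \<le> 2 ^ t / real n" using t n by simp
      also have "2 ^ ?d * 2 ^ t / real n + 2 ^ t / real n \<le> 2 ^ (?d + 1) * 2 ^ t / real n"
      proof -
        have "(1::real) \<le> 2 ^ ?d" by simp
        then have "2 ^ t / real n * 1 \<le> 2 ^ t / real n * 2 ^ ?d" by (intro mult_left_mono) auto
        then show ?thesis by (simp add: mult_ac)
      qed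
      finally show ?thesis by simp
    qed
    have count_t: "real (card {k \<in> K. \<tau> k = t}) \<le> real (t + 1) ^ (?d - 1) * (2 ^ (?d + 1) * 2 ^ t / real n)"
      if t: "real n \<le> 2 ^ t" for t
    proof -
      let ?S = "{s :: 'n \<Rightarrow> nat. (\<Sum>j\<in>UNIV. s j) = t}"
      have "{k \<in> K. \<tau> k = t} = (\<Union>s\<in>?S. {k \<in> K. \<sigma> k = s})"
        by (auto simp: \<tau>_def)
      then have "card {k \<in> K. \<tau> k = t} \<le> (\<Sum>s\<in>?S. card {k \<in> K. \<sigma> k = s})"
        by (simp only:) (intro card_UN_le card_functions_sum_eq(1))
      from of_nat_mono[OF this, where 'a=real]
      have "real (card {k \<in> K. \<tau> k = t}) \<le> (\<Sum>s\<in>?S. real (card {k \<in> K. \<sigma> k = s}))"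
        by (simp only: of_nat_sum)
      also have "\<dots> \<le> (\<Sum>s\<in>?S. 2 ^ (?d + 1) * 2 ^ t / real n)"
        by (intro sum_mono count_s t) simp
      also have "\<dots> = real (card ?S) * (2 ^ (?d + 1) * 2 ^ t / real n)" by simp
      also have "\<dots> \<le> real (t + 1) ^ (?d - 1) * (2 ^ (?d + 1) * 2 ^ t / real n)"
      proof (rule mult_right_mono)
        show "real (card ?S) \<le> real (t + 1) ^ (?d - 1)"
          using of_nat_mono[OF card_functions_sum_eq(2), where 'a=real] by (simp only: of_nat_power)
      qed simp
      finally show ?thesis .
    qed
    have "(\<Sum>k\<in>K. 1 / (\<Prod>j\<in>UNIV. sobolev_weight r (\<xi> k j))) \<le> (\<Sum>k\<in>K. (4 ^ r) ^ ?d / 4 ^ (r * \<tau> k))"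
      by (intro sum_mono weight)
    also have "\<dots> = (\<Sum>t\<in>\<tau> ` K. \<Sum>k\<in>{k \<in> K. \<tau> k = t}. (4 ^ r) ^ ?d / 4 ^ (r * \<tau> k))"
      by (rule sum.image_gen) (rule K)
    also have "\<dots> = (\<Sum>t\<in>\<tau> ` K. real (card {k \<in> K. \<tau> k = t}) * ((4 ^ r) ^ ?d / 4 ^ (r * t)))"
      by (intro sum.cong refl) simp
    also have "\<dots> \<le> (\<Sum>t\<in>\<tau> ` K. (real (t + 1) ^ (?d - 1) * (2 ^ (?d + 1) * 2 ^ t / real n)) * ((4 ^ r) ^ ?d / 4 ^ (r * t)))"
      using n_le by (intro sum_mono mult_right_mono count_t) auto
    also have "\<dots> = D / real n * (\<Sum>t\<in>\<tau> ` K. real (t + 1) ^ (?d - 1) * 2 ^ t / 4 ^ (r * t))"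
      by (simp add: D_def sum_distrib_left mult_ac)
    also have "\<dots> \<le> D / real n * (Z * ln (real n) ^ (?d - 1) / real n ^ (2 * r - 1))"
      using n n_le \<open>D > 0\<close> K by (intro mult_left_mono Z(2)) auto
    also have "\<dots> = D * Z * ln (real n) ^ (?d - 1) / real n ^ Suc (2 * r - 1)" by simp
    \<comment> \<open>Natural subtraction is exact here because \<open>r\<close> is at least
      1.\<close>
    also have "Suc (2 * r - 1) = 2 * r" using \<open>r \<ge> 1\<close> by simp
    finally show "(\<Sum>k\<in>K. 1 / (\<Prod>j\<in>UNIV. sobolev_weight r
        ((((real n powr (1 / real ?d)) *\<^sub>R (diag u ** B)) *v real_vec k) $ j)))
     \<le> D * Z * ln (real n) ^ (?d - 1) / real n ^ (2 * r)"
      by (simp add: diag_mult_vec \<xi>_def N_def)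
  qed
qed


subsection \<open>The error of Frolov's rule\<close>

lemma inner_transpose_mult_vec:
  fixes S :: "real ^ 'n ^ 'm"
  shows "y \<bullet> (transpose S *v x) = (S *v y) \<bullet> x"
  by (metis dot_lmul_matrix transpose_matrix_vector transpose_transpose)

text \<open>With \<open>y = transpose S *v x - v\<close> the rule becomes a sum of \<open>h\<close>
  over the integer points, and both the rule and the integral acquire the same factor
  \<open>\<bar>det S\<bar>\<close>. The shift multiplies each Fourier coefficient by a number of
  modulus 1, so \<open>v\<close> is absent from the bound.\<close>

lemma quadrature_error_le:
  fixes S :: "real ^ 'n ^ 'n"
  assumes det: "det S \<noteq> 0" and cont: "continuous_on UNIV f"
    and supp: "\<And>x. x \<notin> cbox 0 1 \<Longrightarrow> f x = 0"
    and bound: "\<And>K. finite K \<Longrightarrow> 0 \<notin> K \<Longrightarrow>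
       (\<Sum>k\<in>K. cmod (LINT x|lborel. f x *\<^sub>R ee ((S *v real_vec k) \<bullet> x))) \<le> E"
  shows "\<bar>quadrature S v f - (LINT x|lborel. f x)\<bar> \<le> E"
proof -
  define A where "A = transpose S"
  define T where "T = transpose (matrix_inv S)"
  have inv: "matrix_inv S ** S = mat 1" "S ** matrix_inv S = mat 1"
  proof -
    have "\<exists>A'. S ** A' = mat 1 \<and> A' ** S = mat 1"
      using det by (simp add: invertible_det_nz[symmetric] invertible_def)
    from someI_ex[OF this] show "matrix_inv S ** S = mat 1" "S ** matrix_inv S = mat 1"
      by (simp_all add: matrix_inv_def)
  qed
  have TA: "T *v (A *v x) = x" for x
  proof -
    have "T ** A = mat 1" unfolding T_def A_def matrix_transpose_mul[symmetric] inv by (rule transpose_mat)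
    then show ?thesis by (simp add: matrix_vector_mul_assoc)
  qed
  have AT: "A *v (T *v x) = x" for x
  proof -
    have "A ** T = mat 1" unfolding T_def A_def matrix_transpose_mul[symmetric] inv by (rule transpose_mat)
    then show ?thesis by (simp add: matrix_vector_mul_assoc)
  qed
  have detA: "det A \<noteq> 0" "\<bar>det A\<bar> = \<bar>det S\<bar>" using det by (auto simp: A_def det_transpose)
  define h where "h y = f (T *v (y + v))" for y
  have conth: "continuous_on UNIV h"
    unfolding h_def
    by (intro continuous_on_compose2[OF cont] matrix_vector_mult_linear_continuous_on[THEN continuous_on_compose2]
        continuous_intros) auto
  have [measurable]: "h \<in> borel_measurable borel" by (rule borel_measurable_continuous_onI[OF conth])
  have hA: "h (A *v x - v) = f x" for x by (simp add: h_def TA)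
  have subst: "(LINT y|lborel. q y) = \<bar>det S\<bar> *\<^sub>R (LINT x|lborel. q (A *v x - v))"
    if [measurable]: "q \<in> borel_measurable borel" for q :: "real ^ 'n \<Rightarrow> 'b::{banach, second_countable_topology}"
    using integral_translate(2)[of q "- v"] integral_matrix(2)[OF detA(1), of "\<lambda>y. q (- v + y)"]
    by (simp add: detA)
  have inth: "(LINT y|lborel. h y) = \<bar>det S\<bar> * (LINT x|lborel. f x)"
    using subst[of h] by (simp add: hA)
  have four: "cmod (LINT y|lborel. h y *\<^sub>R ee (real_vec k \<bullet> y))
     = \<bar>det S\<bar> * cmod (LINT x|lborel. f x *\<^sub>R ee ((S *v real_vec k) \<bullet> x))" for k
  proof -
    have "(LINT y|lborel. h y *\<^sub>R ee (real_vec k \<bullet> y))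
       = \<bar>det S\<bar> *\<^sub>R (LINT x|lborel. f x *\<^sub>R ee (real_vec k \<bullet> (A *v x - v)))"
      by (subst subst) (simp_all add: hA)
    also have "(LINT x|lborel. f x *\<^sub>R ee (real_vec k \<bullet> (A *v x - v)))
        = (LINT x|lborel. ee (- (real_vec k \<bullet> v)) * (f x *\<^sub>R ee ((S *v real_vec k) \<bullet> x)))"
    proof (rule Bochner_Integration.integral_cong[OF refl])
      fix x
      have "real_vec k \<bullet> (A *v x - v) = (- (real_vec k \<bullet> v)) + (S *v real_vec k) \<bullet> x"
        unfolding A_def inner_diff_right inner_transpose_mult_vec by simp
      then show "f x *\<^sub>R ee (real_vec k \<bullet> (A *v x - v))
          = ee (- (real_vec k \<bullet> v)) * (f x *\<^sub>R ee ((S *v real_vec k) \<bullet> x))"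
        by (simp only: ee_add) simp
    qed
    also have "\<dots> = ee (- (real_vec k \<bullet> v)) * (LINT x|lborel. f x *\<^sub>R ee ((S *v real_vec k) \<bullet> x))"
      by (rule integral_mult_right_zero)
    finally show ?thesis by (simp only: norm_scaleR norm_mult norm_ee mult_1 abs_abs)
  qed
  \<comment> \<open>The radius depends on \<open>S\<close> and \<open>v\<close>, which is harmless
    because it does not occur in the conclusion of \<open>poisson_inequality\<close>.\<close>
  have "bounded ((\<lambda>x. A *v x - v) ` cbox 0 1)"
    by (intro compact_imp_bounded compact_continuous_image compact_cbox continuous_intros
        matrix_vector_mult_linear_continuous_on)
  then obtain R where R: "\<And>x. x \<in> cbox 0 1 \<Longrightarrow> norm (A *v x - v) \<le> R"
    by (auto simp: bounded_iff)
  have "\<bar>(\<Sum>\<^sub>\<infinity>m\<in>UNIV. h (real_vec m)) - (LINT y|lborel. h y)\<bar> \<le> \<bar>det S\<bar> * E"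
  proof (rule poisson_inequality[OF conth])
    fix y i assume "h y \<noteq> 0"
    then have "T *v (y + v) \<in> cbox 0 1" using supp by (auto simp: h_def)
    from R[OF this] have "norm y \<le> R" by (simp add: AT)
    then show "\<bar>y $ i\<bar> \<le> R" using component_le_norm_cart[of y i] by linarith
  next
    fix K :: "(int ^ 'n) set" assume "finite K" "0 \<notin> K"
    then show "(\<Sum>k\<in>K. cmod (LINT y|lborel. h y *\<^sub>R ee (real_vec k \<bullet> y))) \<le> \<bar>det S\<bar> * E"
      unfolding four sum_distrib_left[symmetric] by (intro mult_left_mono bound) auto
  qed
  moreover have "(\<Sum>\<^sub>\<infinity>m\<in>UNIV. h (real_vec m)) = \<bar>det S\<bar> * quadrature S v f"
    using det by (simp add: quadrature_def h_def T_def)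
  ultimately have "\<bar>\<bar>det S\<bar> * (quadrature S v f - (LINT x|lborel. f x))\<bar> \<le> \<bar>det S\<bar> * E"
    by (simp only: inth right_diff_distrib)
  then have "\<bar>det S\<bar> * \<bar>quadrature S v f - (LINT x|lborel. f x)\<bar> \<le> \<bar>det S\<bar> * E"
    by (simp only: abs_mult abs_idempotent)
  then show ?thesis using det by simp
qed

lemma H_mix_0D:
  assumes "f \<in> H_mix_0 r"
  shows "continuous_on UNIV f" "x \<notin> cbox 0 1 \<Longrightarrow> f x = 0"
    "(\<And>i. \<alpha> i \<le> r) \<Longrightarrow> has_weak_deriv \<alpha> f (weak_deriv \<alpha> f)"
    "(\<And>i. \<alpha> i \<le> r) \<Longrightarrow> square_integrable (weak_deriv \<alpha> f)"
proof -
  show "continuous_on UNIV f" using assms by (simp add: H_mix_0_def H_mix_def)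
  have "closure {x. f x \<noteq> 0} \<subseteq> cbox 0 1" using assms by (simp add: H_mix_0_def)
  then show "f x = 0" if "x \<notin> cbox 0 1"
    using that closure_subset[of "{x. f x \<noteq> 0}"] by blast
  have derivs: "(\<exists>g. has_weak_deriv \<alpha> f g) \<and> square_integrable (weak_deriv \<alpha> f)" if "\<forall>i. \<alpha> i \<le> r"
    using assms that unfolding H_mix_0_def H_mix_def mem_Collect_eq by blast
  show "has_weak_deriv \<alpha> f (weak_deriv \<alpha> f)" if "\<And>i. \<alpha> i \<le> r"
  proof -
    have "\<exists>g. has_weak_deriv \<alpha> f g" using derivs that by blast
    from someI_ex[OF this] show ?thesis unfolding weak_deriv_def .
  qed
  show "square_integrable (weak_deriv \<alpha> f)" if "\<And>i. \<alpha> i \<le> r"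
    using derivs that by simp
qed

text \<open>Multiplying out the product of the one-dimensional weights yields one term per
  multi-index, so the large sieve can be applied to each weak derivative with the same
  \<open>C\<close>. The sieve matrix is \<open>transpose S\<close> because its pairing with
  \<open>real_vec k\<close> produces the frequency \<open>S *v real_vec k\<close>.\<close>

lemma weighted_fourier_sum_le:
  fixes S :: "real ^ 'n ^ 'n"
  assumes f: "f \<in> H_mix_0 r" and det: "det S \<noteq> 0" and "finite K" and "finite M"
    and cover: "\<And>x. x \<in> cbox 0 1 \<Longrightarrow> \<exists>m\<in>M. transpose S *v x - real_vec m \<in> cell"
    and C: "C > 0" "real (card M) \<le> C * \<bar>det S\<bar>"
  shows "(\<Sum>k\<in>K. (\<Prod>j\<in>UNIV. sobolev_weight r ((S *v real_vec k) $ j))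
        * (cmod (LINT x|lborel. f x *\<^sub>R ee ((S *v real_vec k) \<bullet> x)))\<^sup>2) \<le> C * (H_mix_norm r f)\<^sup>2"
proof -
  let ?I = "{\<alpha> :: 'n \<Rightarrow> nat. \<forall>i. \<alpha> i \<le> r}"
  let ?F = "\<lambda>k. cmod (LINT x|lborel. f x *\<^sub>R ee ((S *v real_vec k) \<bullet> x))"
  let ?G = "\<lambda>\<alpha> k. cmod (LINT x|lborel. (indicator (cbox 0 1) x * weak_deriv \<alpha> f x) *\<^sub>R ee ((S *v real_vec k) \<bullet> x))"
  have I: "?I = (\<Pi>\<^sub>E i\<in>UNIV. {..r})" by (auto simp: PiE_def)
  have detT: "det (transpose S) \<noteq> 0" "\<bar>det (transpose S)\<bar> = \<bar>det S\<bar>" using det by (auto simp: det_transpose)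
  have weight: "(\<Prod>j\<in>UNIV. sobolev_weight r ((S *v real_vec k) $ j)) * (?F k)\<^sup>2 = (\<Sum>\<alpha>\<in>?I. (?G \<alpha> k)\<^sup>2)" for k
  proof -
    have "(\<Prod>j\<in>UNIV. sobolev_weight r ((S *v real_vec k) $ j))
        = (\<Sum>\<alpha>\<in>?I. \<Prod>j\<in>UNIV. \<bar>2 * pi * (S *v real_vec k) $ j\<bar> ^ (2 * \<alpha> j))"
      unfolding sobolev_weight_def I by (rule prod_sum_PiE) auto
    also have "\<dots> * (?F k)\<^sup>2 = (\<Sum>\<alpha>\<in>?I. ((\<Prod>j\<in>UNIV. \<bar>2 * pi * (S *v real_vec k) $ j\<bar> ^ \<alpha> j) * ?F k)\<^sup>2)"
      unfolding sum_distrib_right power_mult_distrib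
      by (intro sum.cong refl arg_cong2[where f="(*)"])
         (simp only: power_mult[symmetric] prod_power_distrib mult.commute)
    also have "\<dots> = (\<Sum>\<alpha>\<in>?I. (?G \<alpha> k)\<^sup>2)"
    proof (intro sum.cong refl)
      fix \<alpha> assume "\<alpha> \<in> ?I"
      then have "has_weak_deriv \<alpha> f (weak_deriv \<alpha> f)" by (intro H_mix_0D(3)[OF f]) auto
      from weak_deriv_fourier[OF this H_mix_0D(2)[OF f], of "S *v real_vec k"]
      show "((\<Prod>j\<in>UNIV. \<bar>2 * pi * (S *v real_vec k) $ j\<bar> ^ \<alpha> j) * ?F k)\<^sup>2 = (?G \<alpha> k)\<^sup>2" by simp
    qed
    finally show ?thesis .
  qed
  have sieve: "(\<Sum>k\<in>K. (?G \<alpha> k)\<^sup>2) \<le> C * (L2_norm_on (cbox 0 1) (weak_deriv \<alpha> f))\<^sup>2" if "\<alpha> \<in> ?I" for \<alpha>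
  proof -
    have sq: "square_integrable (weak_deriv \<alpha> f)" using that by (intro H_mix_0D(4)[OF f]) auto
    then have m: "weak_deriv \<alpha> f \<in> borel_measurable borel" by (simp add: square_integrable_def)
    have "integrable lborel (\<lambda>x. (weak_deriv \<alpha> f x)\<^sup>2)" using sq by (simp add: square_integrable_def)
    then have int: "integrable lborel (\<lambda>x. indicator (cbox 0 1) x * (weak_deriv \<alpha> f x)\<^sup>2)"
      using integrable_mult_indicator[of "cbox 0 1" lborel "\<lambda>x. (weak_deriv \<alpha> f x)\<^sup>2"] by simp
    have "(L2_norm_on (cbox 0 1) (weak_deriv \<alpha> f))\<^sup>2 = (LINT x|lborel. indicator (cbox 0 1) x * (weak_deriv \<alpha> f x)\<^sup>2)"
      by (simp add: L2_norm_on_def set_lebesgue_integral_def)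
    then show ?thesis
      using large_sieve[OF detT(1) compact_cbox \<open>finite K\<close> \<open>finite M\<close> cover m int C(1)] C(2)
      unfolding inner_transpose_mult_vec detT(2) by simp
  qed
  have "(\<Sum>k\<in>K. (\<Prod>j\<in>UNIV. sobolev_weight r ((S *v real_vec k) $ j)) * (?F k)\<^sup>2) = (\<Sum>\<alpha>\<in>?I. \<Sum>k\<in>K. (?G \<alpha> k)\<^sup>2)"
    unfolding weight by (rule sum.swap)
  also have "\<dots> \<le> (\<Sum>\<alpha>\<in>?I. C * (L2_norm_on (cbox 0 1) (weak_deriv \<alpha> f))\<^sup>2)"
    by (intro sum_mono sieve)
  also have "\<dots> = C * (H_mix_norm r f)\<^sup>2"
    by (simp add: H_mix_norm_def sum_distrib_left sum_nonneg)
  finally show ?thesis .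
qed

lemma det_scaled_diag_mult:
  "det (s *\<^sub>R (diag u ** B)) = s ^ CARD('n) * (\<Prod>j\<in>UNIV. u $ j) * det (B :: real ^ 'n ^ 'n)"
proof -
  have "s *\<^sub>R (diag u ** B) = diag (\<chi> j. s * u $ j) ** B"
    unfolding matrix_eq using diag_mult_vec[of s u B] diag_mult_vec[of 1 "\<chi> j. s * u $ j" B] by simp
  moreover have "det (diag (\<chi> j. s * u $ j) :: real ^ 'n ^ 'n) = (\<Prod>j\<in>UNIV. s * u $ j)"
    by (subst det_diagonal) (auto simp: diag_def)
  ultimately show ?thesis by (simp add: det_mul prod.distrib)
qed

lemma scaled_diag_mult_nth: "(s *\<^sub>R (diag u ** B)) $ j $ i = s * u $ j * (B :: real ^ 'n ^ 'n) $ j $ i"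
  by (simp add: matrix_matrix_mult_def diag_def if_distrib[of "\<lambda>c. c * _"] cong: if_cong)

theorem theorem3:
  fixes r :: nat and B :: "real ^ 'n ^ 'n"
  assumes "r \<ge> 1"
    and "frolov_matrix B"
  shows "\<exists>c>0. \<forall>(v :: real ^ 'n) (n :: nat). \<forall>f \<in> H_mix_0 r. n \<ge> 2 \<longrightarrow>
    (SUP u \<in> cbox 1 (\<chi> j. 2 powr (1 / real CARD('n))).
       ereal \<bar>quadrature ((real n powr (1 / real CARD('n))) *\<^sub>R (diag u ** B)) v f
              - (LINT x|lborel. f x)\<bar>)
    \<le> ereal (c * real n powr (- real r) * ln (real n) powr ((real CARD('n) - 1) / 2)
              * H_mix_norm r f)"
proof -
  let ?d = "CARD('n)"
  have detB: "det B \<noteq> 0"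
    using assms(2) by (auto simp: frolov_matrix_def invertible_det_nz)
  obtain C0 where C0: "C0 > 0"
    and lattice: "\<forall>n u K. n \<ge> 2 \<longrightarrow> u \<in> cbox 1 (\<chi> j. 2 powr (1 / real ?d)) \<longrightarrow> finite K \<longrightarrow> 0 \<notin> K \<longrightarrow>
     (\<Sum>k\<in>K. 1 / (\<Prod>j\<in>UNIV. sobolev_weight r
        ((((real n powr (1 / real ?d)) *\<^sub>R (diag u ** B)) *v real_vec k) $ j)))
     \<le> C0 * ln (real n) ^ (?d - 1) / real n ^ (2 * r)"
    using frolov_lattice_sum[OF assms] by blast
  \<comment> \<open>The sum of all entries in modulus bounds every column sum, hence every
    coordinate of the image of the unit cube under \<open>transpose B\<close>.\<close>
  define b where "b = (\<Sum>i\<in>UNIV. \<Sum>j\<in>UNIV. \<bar>B $ j $ i\<bar>)"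
  have "b \<ge> 0" unfolding b_def by (intro sum_nonneg) auto
  \<comment> \<open>The image of the cube under \<open>transpose S\<close> has coordinates at most
    \<open>2 * b * N\<close>, so it meets at most \<open>(4 * b * N + 2) ^ ?d\<close> cells. As
    \<open>N\<close> is at least 1, this is at most \<open>(4 * b + 2) ^ ?d * n\<close>, and
    \<open>n * \<bar>det B\<bar>\<close> is at most \<open>\<bar>det S\<bar>\<close>.\<close>
  define C1 where "C1 = (4 * b + 2) ^ ?d / \<bar>det B\<bar>"
  have "C1 > 0" using detB \<open>b \<ge> 0\<close> by (simp add: C1_def)
  show ?thesis
  proof (intro exI[of _ "sqrt (C1 * C0)"] conjI allI ballI impI SUP_least)
    show "sqrt (C1 * C0) > 0" using C0 \<open>C1 > 0\<close> by simp
    fix v :: "real ^ 'n" and n :: nat and f :: "real ^ 'n \<Rightarrow> real" and u :: "real ^ 'n"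
    assume f: "f \<in> H_mix_0 r" and n: "n \<ge> 2" and u: "u \<in> cbox 1 (\<chi> j. 2 powr (1 / real ?d))"
    define N where "N = real n powr (1 / real ?d)"
    have "N \<ge> 1" using n by (simp add: N_def ge_one_powr_ge_zero)
    have Nd: "N ^ ?d = real n" using n by (simp add: N_def powr_realpow[symmetric] powr_powr)
    define S where "S = N *\<^sub>R (diag u ** B)"
    have u1: "u $ j \<ge> 1" for j using u by (simp add: mem_box_cart)
    have u2: "u $ j \<le> 2" for j
    proof -
      have "u $ j \<le> 2 powr (1 / real ?d)" using u by (simp add: mem_box_cart)
      also have "\<dots> \<le> 2 powr 1" by (intro powr_mono) auto
      finally show ?thesis by simp
    qed
    have pu: "(\<Prod>j\<in>UNIV. u $ j) \<ge> 1" using u1 by (intro prod_ge_1) auto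
    have detS: "\<bar>det S\<bar> \<ge> real n * \<bar>det B\<bar>"
      using pu mult_left_mono[OF pu, of "real n * \<bar>det B\<bar>"]
      by (simp add: S_def det_scaled_diag_mult Nd abs_mult mult_ac)
    moreover have "real n * \<bar>det B\<bar> > 0" using n detB by simp
    ultimately have "\<bar>det S\<bar> > 0" by linarith
    then have "det S \<noteq> 0" by simp
    define M where "M = (lattice_cube (2 * b * N + 1/2) :: (int ^ 'n) set)"
    have cover: "\<exists>m\<in>M. transpose S *v x - real_vec m \<in> cell" if "x \<in> cbox 0 1" for x
      unfolding M_def
    proof (rule exists_cell_translate)
      fix i
      have "\<bar>(transpose S *v x) $ i\<bar> = \<bar>\<Sum>j\<in>UNIV. N * u $ j * B $ j $ i * x $ j\<bar>"
        unfolding matrix_vector_mult_def transpose_def vec_lambda_beta S_def scaled_diag_mult_nth ..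
      also have "\<dots> \<le> (\<Sum>j\<in>UNIV. \<bar>N * u $ j * B $ j $ i * x $ j\<bar>)" by (rule sum_abs)
      also have "\<dots> \<le> (\<Sum>j\<in>UNIV. N * 2 * \<bar>B $ j $ i\<bar> * 1)"
      proof -
        have "\<bar>u $ j\<bar> \<le> 2" "\<bar>x $ j\<bar> \<le> 1" for j
          using u1[of j] u2[of j] that by (auto simp: mem_box_cart)
        then show ?thesis
          using \<open>N \<ge> 1\<close> unfolding abs_mult by (intro sum_mono mult_mono) auto
      qed
      also have "\<dots> = 2 * N * (\<Sum>j\<in>UNIV. \<bar>B $ j $ i\<bar>)" by (simp add: sum_distrib_left mult_ac)
      also have "\<dots> \<le> 2 * N * b"
        unfolding b_def using \<open>N \<ge> 1\<close>
        by (intro mult_left_mono member_le_sum[of i UNIV "\<lambda>i. \<Sum>j\<in>UNIV. \<bar>B $ j $ i\<bar>"]) (auto intro: sum_nonneg)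
      finally show "\<bar>(transpose S *v x) $ i\<bar> \<le> 2 * b * N" by (simp add: mult_ac)
    qed
    have "real (card M) \<le> (2 * (2 * b * N + 1/2) + 1) ^ ?d"
      unfolding M_def using \<open>b \<ge> 0\<close> \<open>N \<ge> 1\<close> by (intro card_lattice_cube) auto
    also have "\<dots> \<le> ((4 * b + 2) * N) ^ ?d"
      using \<open>b \<ge> 0\<close> \<open>N \<ge> 1\<close> by (intro power_mono) (auto simp: algebra_simps)
    also have "\<dots> = C1 * (real n * \<bar>det B\<bar>)"
      using detB by (simp add: power_mult_distrib Nd C1_def)
    also have "\<dots> \<le> C1 * \<bar>det S\<bar>" using detS \<open>C1 > 0\<close> by simp
    finally have cardM: "real (card M) \<le> C1 * \<bar>det S\<bar>" .
    have norm_nonneg: "H_mix_norm r f \<ge> 0" by (simp add: H_mix_norm_def sum_nonneg)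
    have ln_pos: "ln (real n) > 0" using n by simp
    let ?E = "sqrt (C1 * (H_mix_norm r f)\<^sup>2) * sqrt (C0 * ln (real n) ^ (?d - 1) / real n ^ (2 * r))"
    have "\<bar>quadrature S v f - (LINT x|lborel. f x)\<bar> \<le> ?E"
    proof (rule quadrature_error_le[OF \<open>det S \<noteq> 0\<close> H_mix_0D(1,2)[OF f]])
      fix K :: "(int ^ 'n) set" assume K: "finite K" "0 \<notin> K"
      define W where "W k = (\<Prod>j\<in>UNIV. sobolev_weight r ((S *v real_vec k) $ j))" for k
      have W: "W k > 0" for k unfolding W_def by (intro prod_pos sobolev_weight_ge(2))
      define F where "F k = cmod (LINT x|lborel. f x *\<^sub>R ee ((S *v real_vec k) \<bullet> x))" for k
      have "(\<Sum>k\<in>K. F k) = (\<Sum>k\<in>K. \<bar>sqrt (W k) * F k\<bar> * \<bar>1 / sqrt (W k)\<bar>)"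
      proof (intro sum.cong refl)
        fix k show "F k = \<bar>sqrt (W k) * F k\<bar> * \<bar>1 / sqrt (W k)\<bar>"
          using W[of k] by (simp add: F_def)
      qed
      also have "\<dots> \<le> L2_set (\<lambda>k. sqrt (W k) * F k) K * L2_set (\<lambda>k. 1 / sqrt (W k)) K"
        by (rule L2_set_mult_ineq)
      also have "\<dots> = sqrt (\<Sum>k\<in>K. W k * (F k)\<^sup>2) * sqrt (\<Sum>k\<in>K. 1 / W k)"
        using W by (simp add: L2_set_def power_mult_distrib power_divide less_imp_le)
      also have "\<dots> \<le> ?E"
      proof (intro mult_mono real_sqrt_le_mono)
        show "(\<Sum>k\<in>K. W k * (F k)\<^sup>2) \<le> C1 * (H_mix_norm r f)\<^sup>2"
          unfolding W_def F_def
          by (rule weighted_fourier_sum_le[OF f \<open>det S \<noteq> 0\<close> K(1) _ cover \<open>C1 > 0\<close> cardM]) (simp add: M_def)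
        show "(\<Sum>k\<in>K. 1 / W k) \<le> C0 * ln (real n) ^ (?d - 1) / real n ^ (2 * r)"
          using lattice n u K unfolding W_def S_def N_def by blast
      qed (use W \<open>C1 > 0\<close> in \<open>auto intro!: sum_nonneg simp: less_imp_le\<close>)
      finally show "(\<Sum>k\<in>K. cmod (LINT x|lborel. f x *\<^sub>R ee ((S *v real_vec k) \<bullet> x))) \<le> ?E"
        unfolding F_def .
    qed
    also have "?E = sqrt (C1 * C0) * real n powr (- real r) * ln (real n) powr ((real ?d - 1) / 2) * H_mix_norm r f"
    proof -
      \<comment> \<open>The square root halves the exponent of the logarithm. Passing from natural
        powers to \<open>powr\<close> requires \<open>ln n\<close> to be positive, which holds for
        \<open>n\<close> at least 2.\<close>
      have 1: "sqrt (ln (real n) ^ (?d - 1)) = ln (real n) powr ((real ?d - 1) / 2)"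
        using ln_pos by (simp add: powr_half_sqrt[symmetric] powr_realpow[symmetric] powr_powr of_nat_diff)
      have 2: "1 / sqrt (real n ^ (2 * r)) = real n powr (- real r)"
        using n by (simp add: power_mult[of _ 2 r] power_even_eq powr_minus powr_realpow divide_inverse)
      show ?thesis
        unfolding 1[symmetric] 2[symmetric] using norm_nonneg by (simp add: real_sqrt_mult real_sqrt_divide)
    qed
    finally show "ereal \<bar>quadrature ((real n powr (1 / real ?d)) *\<^sub>R (diag u ** B)) v f - (LINT x|lborel. f x)\<bar>
      \<le> ereal (sqrt (C1 * C0) * real n powr (- real r) * ln (real n) powr ((real ?d - 1) / 2) * H_mix_norm r f)"
      by (simp add: S_def N_def)
  qed
qed

end
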